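(* Let $q$ be a power of an odd prime $p$, let $M\geq2$ be an integer written as $M=t\cdot p^r$ with $p\nmid t$, $r\ge0$, and for $n\ge1$ let $a_n=\#\{x\in\mathrm{GL}_n(\mathbb{F}_q): x^M=\mathrm{Id}_n\}$. Then, as formal power series in $z$, $$1+\sum_{n=1}^{\infty}\frac{a_n}{|\mathrm{GL}_n(\mathbb{F}_q)|}z^n=\prod_{d\mid t}\left(1+\sum_{m\geq1}\ \sum_{\substack{\lambda\vdash m\\ \lambda_1\leq p^r}}\frac{z^{m\,e(d)}}{q^{e(d)\sum_i(\lambda_i')^2}\prod_{i\geq1}\prod_{j=1}^{m_i(\lambda)}\bigl(1-q^{-e(d)j}\bigr)}\right)^{\phi(d)/e(d)}.$$
   Context: $\phi$ is Euler's totient function; for a positive integer $d$ coprime to $q$, $e(d)$ is the multiplicative order of $q$ in $(\mathbb{Z}/d\mathbb{Z})^\times$ ($e(1)=1$). For a partition $\lambda$, $\lambda_1$ is its largest part, $\lambda'$ is its transpose (conjugate) partition with parts $\lambda'_1\ge\lambda'_2\ge\cdots$, and $m_i(\lambda)$ is the number of parts of $\lambda$ equal to $i$; an empty inner product equals $1$. *)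

theory Defs
  imports "Jordan_Normal_Form.Matrix" "HOL-Computational_Algebra.Formal_Power_Series"
    "HOL-Number_Theory.Number_Theory" "HOL-Library.Multiset"
begin

definition partitions_of :: "nat \<Rightarrow> nat multiset set" where
  "partitions_of m = {P. (\<forall>i \<in># P. 0 < i) \<and> sum_mset P = m}"

definition conj_part :: "nat multiset \<Rightarrow> nat \<Rightarrow> nat" where
  "conj_part P i = size (filter_mset (\<lambda>x. i \<le> x) P)"

text \<open>The d-th factor series (before taking the power), with parameters
  q, e = e(d), and bound B = p^r on the largest part.\<close>
definition factor_fps :: "nat \<Rightarrow> nat \<Rightarrow> nat \<Rightarrow> real fps" where
  "factor_fps q e B = Abs_fps (\<lambda>n. (if n = 0 then 1 else 0) +
     (\<Sum>m \<in> {m. 1 \<le> m \<and> m * e = n}.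
        \<Sum>P \<in> {P \<in> partitions_of m. Max (set_mset P) \<le> B}.
          1 / (real q ^ (e * (\<Sum>i=1..m. (conj_part P i)^2)) *
               (\<Prod>i=1..m. \<Prod>j=1..count P i. (1 - 1 / real q ^ (e * j))))))"

end

(* Write M = t B with B = p^r. Every A with A^M = 1 is uniquely a product of commuting maps S and 1 + N
   with S^t = 1 and N^B = 0. The number of such pairs (S, N), divided by the order of GL_n, is
   multiplicative over coprime factors of x^t - 1, because the space splits into the kernels of these
   factors evaluated at S. So let f be a single irreducible factor, of degree e. Then S turns the space
   into a vector space of dimension m = n / e over a field with Q = q^e elements, all such S form one
   conjugacy class with centralizer GL_m(Q), and N is a Q-linear map with N^B = 0. Restricting N to
   its image removes the first column of the partition of N and gives a recursion that the partition
   sum satisfies too. Finally, an irreducible polynomial dividing x^d - 1 but no x^k - 1 with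
   0 < k < d has degree e(d), and comparing degrees in x^t - 1 with the divisor sum of the totient
   function shows that there are phi(d) / e(d) of them. *)

theory Submission
  imports Defs "HOL-Library.FuncSet" "HOL-Library.Cardinality" "HOL-Library.Function_Algebras"
    "HOL-Computational_Algebra.Polynomial"
begin

section \<open>Linear maps over a residue field\<close>

text \<open>Every count rests on one device: a linear map is extended by one vector x at a time, and
  the admissible values at x are counted. Admissible means outside a forbidden subspace (injective
  maps, subspaces that avoid a given one) or, for surjections, inside or outside the present image.
  Bases, quotient spaces and group actions do not occur: dimension is the exponent in a cardinality,
  and a conjugacy class is counted through the isomorphisms from a model space onto V, of which each
  member of the class receives the same number.

  Division by the order of GL_n makes the counts multiplicative because the number of ordered
  splittings of an n-space into parts of dimensions i and n - i is |GL_n| / (|GL_i| |GL_(n-i)|).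
  Sums over splittings thereby become Cauchy products of power series.

  The two parts of A separate because B is a power of the characteristic and coprime to t: on
  polynomials in one endomorphism the B-th power is additive, so (1 + N)^B = 1 + N^B.\<close>

definition lin :: "('r \<Rightarrow> 'v::plus \<Rightarrow> 'v) \<Rightarrow> ('r \<Rightarrow> 'w::plus \<Rightarrow> 'w) \<Rightarrow> 'v set \<Rightarrow> 'w set \<Rightarrow> ('v \<Rightarrow> 'w) set" where
  "lin s1 s2 V W = {f \<in> V \<rightarrow>\<^sub>E W. (\<forall>v\<in>V. \<forall>w\<in>V. f (v + w) = f v + f w) \<and>
                                (\<forall>r. \<forall>v\<in>V. f (s1 r v) = s2 r (f v))}"

definition adj :: "('r \<Rightarrow> 'v::plus \<Rightarrow> 'v) \<Rightarrow> 'v set \<Rightarrow> 'v \<Rightarrow> 'v set" where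
  "adj sc U x = {u + sc r x | u r. u \<in> U}"

text \<open>The order of the general linear group of an m-dimensional space over a field with Q
  elements: a basis vector chosen after k others avoids the Q^k vectors that these span.\<close>

definition gl :: "nat \<Rightarrow> nat \<Rightarrow> real" where
  "gl Q m = (\<Prod>k<m. real Q ^ m - real Q ^ k)"

lemma lin_add: "f \<in> lin s1 s2 V W \<Longrightarrow> v \<in> V \<Longrightarrow> w \<in> V \<Longrightarrow> f (v + w) = f v + f w"
  by (auto simp: lin_def)

lemma lin_sc: "f \<in> lin s1 s2 V W \<Longrightarrow> v \<in> V \<Longrightarrow> f (s1 r v) = s2 r (f v)"
  by (auto simp: lin_def)

lemma lin_mem: "f \<in> lin s1 s2 V W \<Longrightarrow> v \<in> V \<Longrightarrow> f v \<in> W"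
  by (auto simp: lin_def)

lemma lin_ext: "f \<in> lin s1 s2 V W \<Longrightarrow> f \<in> extensional V"
  by (auto simp: lin_def PiE_def)

lemma lin_eqI: "f \<in> lin s1 s2 V W \<Longrightarrow> g \<in> lin s1 s2 V W' \<Longrightarrow> (\<And>v. v \<in> V \<Longrightarrow> f v = g v) \<Longrightarrow> f = g"
  by (rule extensionalityI[OF lin_ext lin_ext])

lemma linI:
  assumes "f \<in> extensional V" "\<And>v. v \<in> V \<Longrightarrow> f v \<in> W"
    "\<And>v w. v \<in> V \<Longrightarrow> w \<in> V \<Longrightarrow> f (v + w) = f v + f w"
    "\<And>r v. v \<in> V \<Longrightarrow> f (s1 r v) = s2 r (f v)"
  shows "f \<in> lin s1 s2 V W"
  using assms by (auto simp: lin_def PiE_def)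

lemma finite_lin: "finite V \<Longrightarrow> finite W \<Longrightarrow> finite (lin s1 s2 V W)"
  by (rule finite_subset[of _ "V \<rightarrow>\<^sub>E W"]) (auto simp: lin_def intro: finite_PiE)

lemma ex_new_elem: "finite U \<Longrightarrow> card U < card V \<Longrightarrow> \<exists>x. x \<in> V \<and> x \<notin> U"
  by (meson card_mono leD subsetI)

text \<open>A module over a commutative ring whose annihilator J is maximal with Q residue classes, that is, a
  vector space over the residue field. Scalars stay in the ring (later: polynomials acting through an
  endomorphism) because the size of the residue field varies inside the proof, so that no type can
  represent it. Subspaces are finite sets and linear maps are extensional functions.\<close>

locale kspace =
  fixes sc :: "'r::comm_ring_1 \<Rightarrow> 'v::ab_group_add \<Rightarrow> 'v" and X :: "'v set" and J :: "'r set" and Q :: nat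
  assumes zero_X: "0 \<in> X"
    and add_X: "v \<in> X \<Longrightarrow> w \<in> X \<Longrightarrow> v + w \<in> X"
    and sc_X: "v \<in> X \<Longrightarrow> sc r v \<in> X"
    and sc_add_right: "v \<in> X \<Longrightarrow> w \<in> X \<Longrightarrow> sc r (v + w) = sc r v + sc r w"
    and sc_add_left: "v \<in> X \<Longrightarrow> sc (r + s) v = sc r v + sc s v"
    and sc_mult: "v \<in> X \<Longrightarrow> sc (r * s) v = sc r (sc s v)"
    and sc_one: "v \<in> X \<Longrightarrow> sc 1 v = v"
    and sc_J: "r \<in> J \<Longrightarrow> v \<in> X \<Longrightarrow> sc r v = 0"
    and inv_J: "r \<notin> J \<Longrightarrow> \<exists>s. s * r - 1 \<in> J"
    and orbit: "v \<in> X \<Longrightarrow> v \<noteq> 0 \<Longrightarrow> card (range (\<lambda>r. sc r v)) = Q"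
    and Q_gt_1: "1 < Q"
begin

lemma sc_zero_right [simp]: "sc r 0 = 0"
  using sc_add_right[OF zero_X zero_X, of r] by simp

lemma sc_zero_left [simp]: "v \<in> X \<Longrightarrow> sc 0 v = 0"
  using sc_add_left[of v 0 0] by simp

lemma sc_minus_left: "v \<in> X \<Longrightarrow> sc (- r) v = - sc r v"
  using sc_add_left[of v r "- r"] by (simp add: eq_neg_iff_add_eq_0 add.commute)

lemma sc_minus_one: "v \<in> X \<Longrightarrow> sc (- 1) v = - v"
  by (simp add: sc_minus_left sc_one)

lemma neg_X: "v \<in> X \<Longrightarrow> - v \<in> X"
  using sc_X[of v "- 1"] by (simp add: sc_minus_one)

lemma sc_diff_left: "v \<in> X \<Longrightarrow> sc (r - s) v = sc r v - sc s v"
  using sc_add_left[of v r "- s"] by (simp add: sc_minus_left)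

lemma sc_minus_right: "v \<in> X \<Longrightarrow> sc r (- v) = - sc r v"
  using sc_add_right[of v "- v" r] neg_X[of v] by (simp add: eq_neg_iff_add_eq_0 add.commute)

lemma sc_eq_0_J: "v \<in> X \<Longrightarrow> v \<noteq> 0 \<Longrightarrow> sc r v = 0 \<Longrightarrow> r \<in> J"
proof (rule ccontr)
  assume v: "v \<in> X" "v \<noteq> 0" "sc r v = 0" and "r \<notin> J"
  then obtain s where s: "s * r - 1 \<in> J" using inv_J by blast
  have "sc (s * r - 1) v = sc s (sc r v) - v" using v by (simp add: sc_diff_left sc_mult sc_one)
  then show False using sc_J[OF s v(1)] v by simp
qed

section \<open>Subspaces and their cardinalities\<close>

definition sub :: "'v set \<Rightarrow> bool" where
  "sub V \<longleftrightarrow> V \<subseteq> X \<and> finite V \<and> 0 \<in> V \<and> (\<forall>v\<in>V. \<forall>w\<in>V. v + w \<in> V) \<and> (\<forall>r. \<forall>v\<in>V. sc r v \<in> V)"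

lemma subD:
  assumes "sub V"
  shows "V \<subseteq> X" "finite V" "0 \<in> V" "\<And>v w. v \<in> V \<Longrightarrow> w \<in> V \<Longrightarrow> v + w \<in> V"
    "\<And>r v. v \<in> V \<Longrightarrow> sc r v \<in> V" "\<And>v. v \<in> V \<Longrightarrow> - v \<in> V"
    "\<And>v w. v \<in> V \<Longrightarrow> w \<in> V \<Longrightarrow> v - w \<in> V" "\<And>v. v \<in> V \<Longrightarrow> v \<in> X" "card V > 0"
proof -
  show *: "V \<subseteq> X" "finite V" "0 \<in> V" "\<And>v w. v \<in> V \<Longrightarrow> w \<in> V \<Longrightarrow> v + w \<in> V"
    "\<And>r v. v \<in> V \<Longrightarrow> sc r v \<in> V" using assms by (auto simp: sub_def)
  then show "\<And>v. v \<in> V \<Longrightarrow> v \<in> X" "card V > 0" by (auto simp: card_gt_0_iff)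
  show **: "- v \<in> V" if "v \<in> V" for v
    using *(5)[OF that, of "-1"] sc_minus_one[of v] that *(1) by auto
  show "v - w \<in> V" if "v \<in> V" "w \<in> V" for v w
    using *(4)[OF that(1) **[OF that(2)]] by simp
qed

lemma sub_zero: "sub {0}"
  by (auto simp: sub_def zero_X)

text \<open>A scalar outside J has an inverse modulo J, which would carry \<open>sc r x\<close> back
  to x and put x into U.\<close>

lemma sc_mem_sub_J:
  assumes U: "sub U" and x: "x \<in> X" "x \<notin> U" and r: "sc r x \<in> U"
  shows "r \<in> J"
proof (rule ccontr)
  assume "r \<notin> J"
  then obtain s where s: "s * r - 1 \<in> J" using inv_J by blast
  have "sc (s * r - 1) x = sc s (sc r x) - x" using x by (simp add: sc_diff_left sc_mult sc_one)
  then have "sc s (sc r x) = x" using sc_J[OF s x(1)] by simp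
  then show False using subD(5)[OF U r, of s] x by simp
qed

lemma subset_adj: "x \<in> X \<Longrightarrow> U \<subseteq> adj sc U x"
  by (force simp: adj_def intro: exI[of _ 0])

lemma mem_adj: "sub U \<Longrightarrow> x \<in> X \<Longrightarrow> x \<in> adj sc U x"
  by (auto simp: adj_def sc_one subD intro!: exI[of _ 0] exI[of _ 1])

lemma adj_subset: "sub V \<Longrightarrow> U \<subseteq> V \<Longrightarrow> x \<in> V \<Longrightarrow> adj sc U x \<subseteq> V"
  by (auto simp: adj_def dest: subD)

lemma finite_orbit: "x \<in> X \<Longrightarrow> finite (range (\<lambda>r. sc r x))"
  using orbit[of x] Q_gt_1 by (cases "x = 0") (auto intro: card_ge_0_finite)

text \<open>Scalars are ring elements, not classes modulo J. Hence the representation of a vector of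
  \<open>adj sc U x\<close> fixes r only modulo J, while the vector \<open>sc r x\<close> itself is
  fixed.\<close>

lemma adj_sum_inj:
  assumes U: "sub U" and x: "x \<in> X" "x \<notin> U" and u: "u \<in> U" "u' \<in> U"
    and eq: "u + sc r x = u' + sc r' x"
  shows "u = u'" "r - r' \<in> J" "sc r x = sc r' x"
proof -
  have "sc (r - r') x = u' - u" using eq x by (simp add: sc_diff_left algebra_simps)
  then have "sc (r - r') x \<in> U" using subD(7)[OF U] u by simp
  then show J: "r - r' \<in> J" using sc_mem_sub_J[OF U x] by blast
  then show "sc r x = sc r' x" using sc_J[OF J x(1)] x by (simp add: sc_diff_left)
  then show "u = u'" using eq by simp
qed

lemma adj_image: "adj sc U x = (\<lambda>(u, z). u + z) ` (U \<times> range (\<lambda>r. sc r x))"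
  by (auto simp: adj_def image_iff)

lemma card_adj:
  assumes U: "sub U" and x: "x \<in> X" "x \<notin> U"
  shows "card (adj sc U x) = Q * card U"
proof -
  have "inj_on (\<lambda>(u, z). u + z) (U \<times> range (\<lambda>r. sc r x))"
    using adj_sum_inj[OF U x] by (auto simp: inj_on_def)
  moreover have "x \<noteq> 0" using x subD[OF U] by auto
  ultimately show ?thesis
    by (simp add: adj_image card_image card_cartesian_product orbit x)
qed

lemma sub_adj:
  assumes U: "sub U" and x: "x \<in> X"
  shows "sub (adj sc U x)"
  unfolding sub_def
proof (intro conjI ballI allI)
  show "adj sc U x \<subseteq> X" using subD[OF U] x by (auto simp: adj_def intro!: add_X sc_X)
  show "finite (adj sc U x)" using subD[OF U] finite_orbit[OF x] by (simp add: adj_image)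
  show "0 \<in> adj sc U x" using subset_adj[OF x, of U] subD[OF U] by auto
next
  fix v w assume "v \<in> adj sc U x" "w \<in> adj sc U x"
  then obtain a b r s where *: "v = a + sc r x" "w = b + sc s x" "a \<in> U" "b \<in> U"
    by (auto simp: adj_def)
  then have "v + w = (a + b) + sc (r + s) x" using x by (simp add: sc_add_left)
  then show "v + w \<in> adj sc U x" using * subD(4)[OF U] unfolding adj_def by blast
next
  fix r v assume "v \<in> adj sc U x"
  then obtain a s where *: "v = a + sc s x" "a \<in> U"
    by (auto simp: adj_def)
  then have "sc r v = sc r a + sc (r * s) x" using x subD[OF U] by (simp add: sc_add_right sc_mult sc_X)
  then show "sc r v \<in> adj sc U x" using * subD(5)[OF U] unfolding adj_def by blast
qed

text \<open>Dimension is only present as an exponent of Q. Each adjoined vector multiplies the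
  cardinality by Q, until U has grown to V.\<close>

lemma relative_dim:
  assumes "sub V" "sub U" "U \<subseteq> V"
  shows "\<exists>a. card V = Q ^ a * card U"
  using assms(2,3)
proof (induction "card V - card U" arbitrary: U rule: less_induct)
  case less
  show ?case
  proof (cases "U = V")
    case True then show ?thesis by (intro exI[of _ 0]) simp
  next
    case False
    then obtain x where x: "x \<in> V" "x \<notin> U" "x \<in> X" using less subD(1)[OF assms(1)] by blast
    have sub: "adj sc U x \<subseteq> V" using adj_subset[OF assms(1)] x less by blast
    have "card U < card (adj sc U x)"
      using card_adj[OF less(2) x(3,2)] Q_gt_1 subD(9)[OF less(2)] by simp
    moreover have "card (adj sc U x) \<le> card V" by (rule card_mono[OF subD(2)[OF assms(1)] sub])
    ultimately have "card V - card (adj sc U x) < card V - card U" by linarith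
    then obtain a where "card V = Q ^ a * card (adj sc U x)"
      using less(1)[OF _ sub_adj[OF less(2) x(3)] sub] by blast
    then show ?thesis using card_adj[OF less(2) x(3,2)] by (intro exI[of _ "Suc a"]) simp
  qed
qed

lemma dim_exists: "sub V \<Longrightarrow> \<exists>m. card V = Q ^ m"
  using relative_dim[of V "{0}"] sub_zero subD(3) by auto

lemma sub_of_dim:
  assumes "sub V" "card V = Q ^ n" "j \<le> n"
  shows "\<exists>U. sub U \<and> U \<subseteq> V \<and> card U = Q ^ j"
  using assms(3)
proof (induction j)
  case 0
  then show ?case using sub_zero subD(3)[OF assms(1)] by (intro exI[of _ "{0}"]) auto
next
  case (Suc j)
  then obtain U where U: "sub U" "U \<subseteq> V" "card U = Q ^ j" by auto
  have "card U < card V" using Suc.prems assms(2) U(3) Q_gt_1 by simp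
  then obtain x where x: "x \<in> V" "x \<notin> U" using ex_new_elem[OF subD(2)[OF U(1)]] by blast
  then have xX: "x \<in> X" using subD(1)[OF assms(1)] by blast
  show ?case using sub_adj[OF U(1) xX] card_adj[OF U(1) xX x(2)] adj_subset[OF assms(1) U(2) x(1)] U(3)
    by (intro exI[of _ "adj sc U x"]) auto
qed

definition ssum :: "'v set \<Rightarrow> 'v set \<Rightarrow> 'v set" where
  "ssum U V = (\<lambda>(u, v). u + v) ` (U \<times> V)"

lemma card_ssum:
  assumes "sub U" "sub V" "U \<inter> V = {0}"
  shows "card (ssum U V) = card U * card V"
proof -
  have "inj_on (\<lambda>(u, v). u + v) (U \<times> V)"
  proof (rule inj_onI, clarsimp)
    fix a b c d assume *: "a \<in> U" "b \<in> V" "c \<in> U" "d \<in> V" "a + b = c + d"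
    then have "a - c = d - b" by (simp add: algebra_simps)
    moreover have "a - c \<in> U" "d - b \<in> V"
      using subD(7)[OF assms(1) *(1,3)] subD(7)[OF assms(2) *(4,2)] .
    ultimately have "a - c \<in> U \<inter> V" by simp
    then show "a = c \<and> b = d" using assms(3) *(5) by auto
  qed
  then show ?thesis by (simp add: ssum_def card_image card_cartesian_product)
qed

lemma sub_ssum:
  assumes "sub U" "sub V"
  shows "sub (ssum U V)"
  unfolding sub_def
proof (intro conjI ballI allI)
  note U = subD[OF assms(1)] and V = subD[OF assms(2)]
  show "ssum U V \<subseteq> X" using U(8) V(8) by (auto simp: ssum_def intro!: add_X)
  show "finite (ssum U V)" using U(2) V(2) by (simp add: ssum_def)
  show "0 \<in> ssum U V" unfolding ssum_def by (rule image_eqI[of _ _ "(0, 0)"]) (simp_all add: U(3) V(3))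
  show "a + b \<in> ssum U V" if ab: "a \<in> ssum U V" "b \<in> ssum U V" for a b
  proof -
    obtain u v u' v' where *: "a = u + v" "b = u' + v'" "u \<in> U" "v \<in> V" "u' \<in> U" "v' \<in> V"
      using ab by (auto simp: ssum_def)
    then have "a + b = (u + u') + (v + v')" by (simp add: algebra_simps)
    moreover have "u + u' \<in> U" "v + v' \<in> V" using * U V by auto
    ultimately show ?thesis unfolding ssum_def by (auto simp: image_iff)
  qed
  show "sc r a \<in> ssum U V" if a: "a \<in> ssum U V" for r a
  proof -
    obtain u v where *: "a = u + v" "u \<in> U" "v \<in> V"
      using a by (auto simp: ssum_def)
    then have "sc r a = sc r u + sc r v" using U V by (auto intro: sc_add_right)
    moreover have "sc r u \<in> U" "sc r v \<in> V" using * U V by auto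
    ultimately show ?thesis unfolding ssum_def by (auto simp: image_iff)
  qed
qed

end

section \<open>Linear maps between two spaces over the same residue field\<close>

locale kpair = A: kspace sc1 X1 J Q + B: kspace sc2 X2 J Q
  for sc1 :: "'r::comm_ring_1 \<Rightarrow> 'v::ab_group_add \<Rightarrow> 'v" and X1
    and sc2 :: "'r \<Rightarrow> 'w::ab_group_add \<Rightarrow> 'w" and X2 and J Q
begin

lemma lin_zero: "A.sub V \<Longrightarrow> f \<in> lin sc1 sc2 V W \<Longrightarrow> f 0 = 0"
  using lin_add[of f sc1 sc2 V W 0 0] A.subD(3) by auto

lemma lin_minus: "A.sub V \<Longrightarrow> W \<subseteq> X2 \<Longrightarrow> f \<in> lin sc1 sc2 V W \<Longrightarrow> v \<in> V \<Longrightarrow> f (- v) = - f v"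
  using lin_sc[of f sc1 sc2 V W v "-1"] A.subD[of V] lin_mem[of f sc1 sc2 V W v]
  by (auto simp: A.sc_minus_one B.sc_minus_one)

lemma lin_diff: "A.sub V \<Longrightarrow> W \<subseteq> X2 \<Longrightarrow> f \<in> lin sc1 sc2 V W \<Longrightarrow> v \<in> V \<Longrightarrow> w \<in> V \<Longrightarrow> f (v - w) = f v - f w"
  using lin_add[of f sc1 sc2 V W v "- w"] lin_minus[of V W f w] A.subD(6)[of V w] by simp

lemma sub_image:
  assumes V: "A.sub V" and W: "W \<subseteq> X2" and f: "f \<in> lin sc1 sc2 V W"
  shows "B.sub (f ` V)"
  unfolding B.sub_def
proof (intro conjI ballI allI)
  show "f ` V \<subseteq> X2" using lin_mem[OF f] W by auto
  show "finite (f ` V)" using A.subD[OF V] by simp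
  show "0 \<in> f ` V" using lin_zero[OF V f] A.subD(3)[OF V] by (metis imageI)
next
  fix v w assume "v \<in> f ` V" "w \<in> f ` V"
  then show "v + w \<in> f ` V" using lin_add[OF f] A.subD(4)[OF V] by (metis (no_types, lifting) imageE imageI)
next
  fix r v assume "v \<in> f ` V"
  then show "sc2 r v \<in> f ` V" using lin_sc[OF f] A.subD(5)[OF V] by (metis (no_types, lifting) imageE imageI)
qed

lemma lin_restrict: "f \<in> lin sc1 sc2 V W \<Longrightarrow> A.sub U \<Longrightarrow> U \<subseteq> V \<Longrightarrow> restrict f U \<in> lin sc1 sc2 U W"
  by (rule linI) (auto simp: A.subD lin_mem lin_add lin_sc subset_iff)

text \<open>The value at \<open>u + sc1 r x\<close> has to be \<open>f u + sc2 r w\<close>. It is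
  well defined because r is fixed modulo J and J annihilates the second space too.\<close>

lemma lin_extend_one:
  assumes U: "A.sub U" and x: "x \<in> X1" "x \<notin> U" and W: "B.sub W"
    and f: "f \<in> lin sc1 sc2 U W" and w: "w \<in> W"
  shows "\<exists>!g. g \<in> lin sc1 sc2 (adj sc1 U x) W \<and> restrict g U = f \<and> g x = w"
proof -
  \<comment> \<open>The graph of the extension. As r is not a function of y, the graph is shown to
    be single-valued before the map is defined.\<close>
  define P where "P y z \<longleftrightarrow> (\<exists>u r. u \<in> U \<and> y = u + sc1 r x \<and> z = f u + sc2 r w)" for y z
  have wX: "w \<in> X2" using w B.subD[OF W] by blast
  have uniq: "z = z'" if "P y z" "P y z'" for y z z'
  proof -
    obtain u r u' r' where *: "u \<in> U" "y = u + sc1 r x" "z = f u + sc2 r w"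
      "u' \<in> U" "y = u' + sc1 r' x" "z' = f u' + sc2 r' w" using \<open>P y z\<close> \<open>P y z'\<close> unfolding P_def by blast
    then have "u = u'" "r - r' \<in> J" using A.adj_sum_inj[OF U x, of u u' r r'] by auto
    then have "sc2 r w = sc2 r' w" using B.sc_J[of "r - r'" w] wX by (simp add: B.sc_diff_left)
    then show ?thesis using * \<open>u = u'\<close> by simp
  qed
  define g where "g = (\<lambda>y\<in>adj sc1 U x. THE z. P y z)"
  have g: "g (u + sc1 r x) = f u + sc2 r w" if "u \<in> U" for u r
  proof -
    have "P (u + sc1 r x) (f u + sc2 r w)" using that by (auto simp: P_def)
    then have "(THE z. P (u + sc1 r x) z) = f u + sc2 r w" using uniq by blast
    moreover have "u + sc1 r x \<in> adj sc1 U x" using that by (auto simp: adj_def)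
    ultimately show ?thesis by (simp add: g_def)
  qed
  have gU: "g u = f u" if "u \<in> U" for u using g[OF that, of 0] x wX by simp
  have gx: "g x = w" using g[OF A.subD(3)[OF U], of 1] x wX lin_zero[OF U f] by (simp add: A.sc_one B.sc_one)
  show ?thesis
  proof (rule ex1I[of _ g])
    have "g \<in> lin sc1 sc2 (adj sc1 U x) W"
    proof (rule linI)
      show "g \<in> extensional (adj sc1 U x)" by (simp add: g_def)
    next
      fix v assume "v \<in> adj sc1 U x"
      then obtain u r where "v = u + sc1 r x" "u \<in> U" by (auto simp: adj_def)
      then show "g v \<in> W" using g lin_mem[OF f] B.subD[OF W] w by auto
    next
      fix v v' assume "v \<in> adj sc1 U x" "v' \<in> adj sc1 U x"
      then obtain u r u' r' where *: "v = u + sc1 r x" "u \<in> U" "v' = u' + sc1 r' x" "u' \<in> U"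
        by (auto simp: adj_def)
      then have eq: "v + v' = (u + u') + sc1 (r + r') x" using x by (simp add: A.sc_add_left)
      have "g (v + v') = f (u + u') + sc2 (r + r') w" unfolding eq
        by (rule g[OF A.subD(4)[OF U *(2,4)]])
      then show "g (v + v') = g v + g v'" using * wX lin_add[OF f] g by (simp add: B.sc_add_left)
    next
      fix s v assume "v \<in> adj sc1 U x"
      then obtain u r where *: "v = u + sc1 r x" "u \<in> U" by (auto simp: adj_def)
      then have "sc1 s v = sc1 s u + sc1 (s * r) x"
        using x A.subD[OF U] by (simp add: A.sc_add_right A.sc_mult A.sc_X)
      then have "g (sc1 s v) = f (sc1 s u) + sc2 (s * r) w" using g A.subD(5)[OF U] * by simp
      moreover have "f u \<in> X2" using lin_mem[OF f] * B.subD[OF W] by blast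
      ultimately show "g (sc1 s v) = sc2 s (g v)" using * wX lin_sc[OF f] g
        by (simp add: B.sc_mult B.sc_add_right B.sc_X)
    qed
    moreover have "restrict g U = f" using gU lin_ext[OF f] by (auto simp: fun_eq_iff extensional_def)
    ultimately show "g \<in> lin sc1 sc2 (adj sc1 U x) W \<and> restrict g U = f \<and> g x = w" using gx by simp
  next
    fix h assume h: "h \<in> lin sc1 sc2 (adj sc1 U x) W \<and> restrict h U = f \<and> h x = w"
    have hU: "h u = f u" if "u \<in> U" for u using h that by auto
    show "h = g"
    proof (rule extensionalityI)
      show "h \<in> extensional (adj sc1 U x)" using h lin_ext by blast
      show "g \<in> extensional (adj sc1 U x)" by (simp add: g_def)
      fix v assume "v \<in> adj sc1 U x"
      then obtain u r where *: "v = u + sc1 r x" "u \<in> U" by (auto simp: adj_def)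
      have xa: "x \<in> adj sc1 U x" "u \<in> adj sc1 U x" "sc1 r x \<in> adj sc1 U x"
        using A.mem_adj[OF U x(1)] A.subset_adj[OF x(1), of U] * A.subD(5)[OF A.sub_adj[OF U x(1)]] by auto
      have "h v = h u + sc2 r (h x)" using h * xa by (auto simp: lin_add lin_sc)
      then show "h v = g v" using g * h hU by simp
    qed
  qed
qed

section \<open>Counting the extensions of a linear map\<close>

definition ext1 :: "'v set \<Rightarrow> 'v \<Rightarrow> 'w set \<Rightarrow> ('v \<Rightarrow> 'w) \<Rightarrow> 'w \<Rightarrow> ('v \<Rightarrow> 'w)" where
  "ext1 U x W f w = (THE g. g \<in> lin sc1 sc2 (adj sc1 U x) W \<and> restrict g U = f \<and> g x = w)"

lemma ext1:
  assumes "A.sub U" "x \<in> X1" "x \<notin> U" "B.sub W" "f \<in> lin sc1 sc2 U W" "w \<in> W"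
  shows "ext1 U x W f w \<in> lin sc1 sc2 (adj sc1 U x) W" "restrict (ext1 U x W f w) U = f"
    "ext1 U x W f w x = w"
    "u \<in> U \<Longrightarrow> ext1 U x W f w (u + sc1 r x) = f u + sc2 r w"
proof -
  note * = theI'[OF lin_extend_one[OF assms], folded ext1_def]
  show 1: "ext1 U x W f w \<in> lin sc1 sc2 (adj sc1 U x) W" "restrict (ext1 U x W f w) U = f"
    "ext1 U x W f w x = w" using * by auto
  show "ext1 U x W f w (u + sc1 r x) = f u + sc2 r w" if "u \<in> U"
  proof -
    have xa: "x \<in> adj sc1 U x" "u \<in> adj sc1 U x" "sc1 r x \<in> adj sc1 U x"
      using A.mem_adj A.subset_adj[of x U] assms that A.subD(5)[OF A.sub_adj] by auto
    have "ext1 U x W f w u = f u" using 1(2) that by (metis restrict_apply')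
    then show ?thesis using 1(3) lin_add[OF 1(1) xa(2,3)] lin_sc[OF 1(1) xa(1)] by simp
  qed
qed

text \<open>The extensions are sorted by their value w at x. \<open>P\<close> is left open so that
  the count of avoiding maps and the count of surjections share this step.\<close>

lemma ext_sum:
  assumes V: "A.sub V" and U: "A.sub U" "U \<subseteq> V" and x: "x \<in> V" "x \<notin> U" and W: "B.sub W"
    and f: "f \<in> lin sc1 sc2 U W"
  shows "card {g \<in> lin sc1 sc2 V W. restrict g U = f \<and> P g} =
    (\<Sum>w\<in>W. card {g \<in> lin sc1 sc2 V W. restrict g (adj sc1 U x) = ext1 U x W f w \<and> P g})"
proof -
  have xX: "x \<in> X1" using x A.subD[OF V] by blast
  note e = ext1[OF U(1) xX x(2) W f]
  have sub: "adj sc1 U x \<subseteq> V" using A.adj_subset[OF V U(2) x(1)] .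
  have Ua: "U \<subseteq> adj sc1 U x" by (rule A.subset_adj[OF xX])
  have xa: "x \<in> adj sc1 U x" by (rule A.mem_adj[OF U(1) xX])
  let ?E = "\<lambda>w. {g \<in> lin sc1 sc2 V W. restrict g (adj sc1 U x) = ext1 U x W f w \<and> P g}"
  have eq: "{g \<in> lin sc1 sc2 V W. restrict g U = f \<and> P g} =
     (\<Union>w\<in>W. ?E w)"
  proof (intro equalityI subsetI)
    fix g assume "g \<in> {g \<in> lin sc1 sc2 V W. restrict g U = f \<and> P g}"
    then have g: "g \<in> lin sc1 sc2 V W" "restrict g U = f" "P g" by auto
    have gx: "g x \<in> W" using lin_mem[OF g(1) x(1)] .
    have "restrict (restrict g (adj sc1 U x)) U = f" using g(2) Ua by (simp add: Int_absorb1)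
    moreover have "restrict g (adj sc1 U x) x = g x" using xa by simp
    ultimately have "ext1 U x W f (g x) = restrict g (adj sc1 U x)"
      unfolding ext1_def using lin_restrict[OF g(1) A.sub_adj[OF U(1) xX] sub]
      by (intro the1_equality lin_extend_one[OF U(1) xX x(2) W f gx]) simp
    then have "g \<in> ?E (g x)"
      using g(1,3) by simp
    then show "g \<in> (\<Union>w\<in>W. ?E w)"
      using gx by blast
  next
    fix g assume "g \<in> (\<Union>w\<in>W. ?E w)"
    then obtain w where g: "w \<in> W" "g \<in> lin sc1 sc2 V W" "restrict g (adj sc1 U x) = ext1 U x W f w" "P g"
      by blast
    have "restrict g U = f" using e(2)[OF g(1)] g(3) Ua by (metis Int_absorb1 restrict_restrict)
    then show "g \<in> {g \<in> lin sc1 sc2 V W. restrict g U = f \<and> P g}" using g by blast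
  qed
  show ?thesis unfolding eq
  proof (rule card_UN_disjoint)
    show "finite W" using B.subD[OF W] by simp
    show "\<forall>w\<in>W. finite (?E w)"
      by (auto intro!: finite_subset[OF _ finite_lin[OF A.subD(2)[OF V] B.subD(2)[OF W]]])
    show "\<forall>w\<in>W. \<forall>w'\<in>W. w \<noteq> w' \<longrightarrow>
       ?E w \<inter>
       ?E w' = {}"
      using e(3) by (auto dest: fun_cong[of _ _ x])
  qed
qed

text \<open>By \<open>av\<close>, f is injective on U and f(U) meets Z only in 0. The values
  forbidden at a new vector x therefore form the subspace f(U) + Z with
  \<open>card U * card Z\<close> elements. Adjoining x multiplies \<open>card U\<close> by Q, whence
  the factor Q^k after k vectors.\<close>

lemma card_ext_avoiding:
  assumes V: "A.sub V" and W: "B.sub W" and Z: "B.sub Z" "Z \<subseteq> W"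
    and U: "A.sub U" "U \<subseteq> V" and f: "f \<in> lin sc1 sc2 U W"
    and av: "\<And>u. u \<in> U \<Longrightarrow> f u \<in> Z \<Longrightarrow> u = 0" and card: "card V = Q ^ a * card U"
  shows "real (card {g \<in> lin sc1 sc2 V W. restrict g U = f \<and> (\<forall>v\<in>V. g v \<in> Z \<longrightarrow> v = 0)}) =
    (\<Prod>k<a. real (card W) - real (card U) * real (card Z) * real Q ^ k)"
  using U f av card
proof (induction a arbitrary: U f)
  case 0
  then have "U = V" using A.subD[OF V] card_subset_eq[of V U] by auto
  moreover have "restrict g V = g" if "g \<in> lin sc1 sc2 V W" for g
    using lin_ext[OF that] by (simp add: extensional_restrict)
  ultimately have eq: "{g \<in> lin sc1 sc2 V W. restrict g U = f \<and> (\<forall>v\<in>V. g v \<in> Z \<longrightarrow> v = 0)} = {f}"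
    using 0 by auto
  show ?case unfolding eq by simp
next
  case (Suc a)
  note U = \<open>A.sub U\<close> \<open>U \<subseteq> V\<close> and f = \<open>f \<in> lin sc1 sc2 U W\<close> and card = \<open>card V = Q ^ Suc a * card U\<close>
  have cU: "card U > 0" using A.subD(9)[OF U(1)] .
  then have "card U < card V" using card A.Q_gt_1 one_less_power[of Q "Suc a"] by simp
  then obtain x where x: "x \<in> V" "x \<notin> U" using ex_new_elem[OF A.subD(2)[OF U(1)]] by blast
  then have xX: "x \<in> X1" using A.subD(1)[OF V] by blast
  note e = ext1[OF U(1) xX x(2) W f]
  let ?A = "adj sc1 U x"
  let ?c = "\<lambda>w. card {g \<in> lin sc1 sc2 V W. restrict g ?A = ext1 U x W f w \<and> (\<forall>v\<in>V. g v \<in> Z \<longrightarrow> v = 0)}"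
  have sub: "?A \<subseteq> V" using A.adj_subset[OF V U(2) x(1)] .
  have cA: "card ?A = Q * card U" using A.card_adj[OF U(1) xX x(2)] .
  define S where "S = B.ssum (f ` U) Z"
  have fU: "B.sub (f ` U)" using sub_image[OF U(1) B.subD(1)[OF W] f] .
  have int: "f ` U \<inter> Z = {0}"
    using Suc.prems(4) B.subD(3)[OF Z(1)] B.subD(3)[OF fU] lin_zero[OF U(1) f] by auto
  have inj: "inj_on f U"
  proof (rule inj_onI)
    fix u u' assume u: "u \<in> U" "u' \<in> U" "f u = f u'"
    then have "f (u - u') \<in> Z" using lin_diff[OF U(1) B.subD(1)[OF W] f] B.subD(3)[OF Z(1)] by simp
    then have "u - u' = 0" by (intro Suc.prems(4) A.subD(7)[OF U(1)] u)
    then show "u = u'" by simp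
  qed
  have cS: "card S = card U * card Z" unfolding S_def
    using B.card_ssum[OF fU Z(1) int] card_image[OF inj] by simp
  have SW: "S \<subseteq> W" using lin_mem[OF f] Z B.subD[OF W] by (auto simp: S_def B.ssum_def)
  \<comment> \<open>With the value f u + z at x, the extension sends x - u to z in Z, although x - u
    is not 0.\<close>
  have 1: "?c w = 0" if w: "w \<in> S" for w
  proof -
    obtain u z where *: "w = f u + z" "u \<in> U" "z \<in> Z" using w by (auto simp: S_def B.ssum_def)
    have wW: "w \<in> W" using w SW by blast
    have False if g: "g \<in> lin sc1 sc2 V W" "restrict g ?A = ext1 U x W f w" "\<forall>v\<in>V. g v \<in> Z \<longrightarrow> v = 0" for g
    proof -
      have uV: "u \<in> V" using * U by blast
      have "g x = w" using fun_cong[OF g(2), of x] A.mem_adj[OF U(1) xX] e(3)[OF wW] by simp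
      moreover have "g u = f u"
        using fun_cong[OF g(2), of u] A.subset_adj[OF xX, of U] * e(2)[OF wW]
        by (metis restrict_apply' subsetD)
      ultimately have "g (x - u) = z" using lin_diff[OF V B.subD(1)[OF W] g(1) x(1) uV] * by simp
      then have "x - u = 0" using g(3) A.subD(7)[OF V x(1) uV] *(3) by blast
      then show False using x(2) *(2) by simp
    qed
    then have "{g \<in> lin sc1 sc2 V W. restrict g ?A = ext1 U x W f w \<and> (\<forall>v\<in>V. g v \<in> Z \<longrightarrow> v = 0)} = {}"
      by blast
    then show ?thesis by (simp only: card.empty)
  qed
  have 2: "real (?c w) = (\<Prod>k<a. real (card W) - real (card ?A) * real (card Z) * real Q ^ k)"
    if w: "w \<in> W - S" for w
  proof (rule Suc.IH)
    show "A.sub ?A" using A.sub_adj[OF U(1) xX] .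
    show "?A \<subseteq> V" by (rule sub)
    show "ext1 U x W f w \<in> lin sc1 sc2 ?A W" using e w by blast
    show "card V = Q ^ a * card ?A" using card cA by simp
    fix v assume v: "v \<in> ?A" "ext1 U x W f w v \<in> Z"
    then obtain u r where *: "v = u + sc1 r x" "u \<in> U" by (auto simp: adj_def)
    then have z: "f u + sc2 r w \<in> Z" using v e(4)[of w u r] w by simp
    have wX: "w \<in> X2" using w B.subD[OF W] by blast
    have "w \<notin> S" using w by blast
    \<comment> \<open>An element of Z minus an element of f(U). A scalar r outside J would therefore
      put w itself into S, which shows that the extension still avoids Z.\<close>
    moreover have "sc2 r w \<in> S"
    proof -
      have "sc2 r w = f (- u) + (f u + sc2 r w)" using lin_minus[OF U(1) B.subD(1)[OF W] f *(2)] by simp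
      moreover have "- u \<in> U" using * A.subD(6)[OF U(1)] by blast
      ultimately show ?thesis using z unfolding S_def B.ssum_def
        by (intro image_eqI[of _ _ "(f (- u), f u + sc2 r w)"]) auto
    qed
    moreover have "B.sub S" unfolding S_def by (rule B.sub_ssum[OF fU Z(1)])
    ultimately have "r \<in> J" using B.sc_mem_sub_J wX by blast
    then have "sc1 r x = 0" "sc2 r w = 0" using A.sc_J B.sc_J xX wX by auto
    then show "v = 0" using * z Suc.prems(4) by simp
  qed
  have "real (card {g \<in> lin sc1 sc2 V W. restrict g U = f \<and> (\<forall>v\<in>V. g v \<in> Z \<longrightarrow> v = 0)}) = (\<Sum>w\<in>W. real (?c w))"
    by (simp add: ext_sum[OF V U x W f])
  also have "\<dots> = (\<Sum>w\<in>W - S. real (?c w)) + (\<Sum>w\<in>S. real (?c w))"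
    by (rule sum.subset_diff[OF SW]) (simp add: B.subD[OF W])
  also have "\<dots> = real (card (W - S)) * (\<Prod>k<a. real (card W) - real (card ?A) * real (card Z) * real Q ^ k)"
    using 1 2 by simp
  also have "real (card (W - S)) = real (card W) - real (card U) * real (card Z)"
    using cS card_mono[OF B.subD(2)[OF W] SW] finite_subset[OF SW B.subD(2)[OF W]] SW by (simp add: card_Diff_subset of_nat_diff)
  also have "(real (card W) - real (card U) * real (card Z)) *
     (\<Prod>k<a. real (card W) - real (card ?A) * real (card Z) * real Q ^ k) =
     (\<Prod>k<Suc a. real (card W) - real (card U) * real (card Z) * real Q ^ k)"
    unfolding prod.lessThan_Suc_shift cA by (simp add: mult_ac)
  finally show ?case .
qed

text \<open>The recursion met when one more vector is sent into or outside of a subspace with c elements and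
  codimension b.\<close>

lemma surj_factor_rec:
  fixes c y z :: real
  assumes b: "b > 0"
  shows "c * (c ^ a * (\<Prod>i<b. y ^ a - y ^ i)) +
     (y ^ b * c - c) * ((y * c) ^ a * (\<Prod>i<b - 1. y ^ a - y ^ i))
   = c ^ Suc a * (\<Prod>i<b. y ^ Suc a - y ^ i)"
proof -
  obtain b' where b': "b = Suc b'" using b by (cases b) auto
  have "(\<Prod>i<Suc b'. y ^ Suc a - y ^ i) = (y ^ Suc a - 1) * (\<Prod>i<b'. y * (y ^ a - y ^ i))"
    unfolding prod.lessThan_Suc_shift by (simp add: algebra_simps)
  also have "\<dots> = (y ^ Suc a - 1) * (y ^ b' * (\<Prod>i<b'. y ^ a - y ^ i))"
    by (simp add: prod.distrib)
  finally have R: "(\<Prod>i<Suc b'. y ^ Suc a - y ^ i) = (y ^ Suc a - 1) * (y ^ b' * (\<Prod>i<b'. y ^ a - y ^ i))" .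
  show ?thesis unfolding b' R by (simp add: algebra_simps power_mult_distrib)
qed

text \<open>An extension of f induces a map from the a-dimensional V / U to the b-dimensional W /
  f(U), and it is onto exactly if the induced map is. The product counts the induced surjections;
  with c the number of elements of f(U), each of them lifts in c^a ways. In the induction, a value
  inside the present image keeps b, a value outside lowers b by 1 and multiplies c by Q.\<close>

lemma card_ext_surj:
  assumes V: "A.sub V" and W: "B.sub W"
    and U: "A.sub U" "U \<subseteq> V" and f: "f \<in> lin sc1 sc2 U W"
    and cardW: "card W = Q ^ b * card (f ` U)" and card: "card V = Q ^ a * card U"
  shows "real (card {g \<in> lin sc1 sc2 V W. restrict g U = f \<and> g ` V = W}) =
    real (card (f ` U)) ^ a * (\<Prod>i<b. real Q ^ a - real Q ^ i)"
  using U f cardW card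
proof (induction a arbitrary: U f b)
  case 0
  then have UV: "U = V" using A.subD[OF V] card_subset_eq[of V U] by auto
  have "restrict g V = g" if "g \<in> lin sc1 sc2 V W" for g
    using lin_ext[OF that] by (simp add: extensional_restrict)
  then have "g \<in> lin sc1 sc2 V W \<and> restrict g U = f \<and> g ` V = W \<longleftrightarrow> g = f \<and> f ` U = W" for g
    using \<open>f \<in> lin sc1 sc2 U W\<close> unfolding UV by metis
  then have eq: "{g \<in> lin sc1 sc2 V W. restrict g U = f \<and> g ` V = W} = {g. g = f \<and> f ` U = W}"
    by presburger
  show ?case
  proof (cases "b = 0")
    case True
    then have "f ` U = W" using 0 lin_mem[OF \<open>f \<in> _\<close>] B.subD(2)[OF W] card_subset_eq[of W "f ` U"] by auto
    then show ?thesis unfolding eq True by simp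
  next
    case False
    then have "f ` U \<noteq> W" using 0(4) one_less_power[OF A.Q_gt_1, of b] B.subD(9)[OF W] by auto
    moreover have "(\<Prod>i<b. real Q ^ 0 - real Q ^ i) = 0" using False by (intro prod_zero) (auto intro!: bexI[of _ 0])
    ultimately show ?thesis unfolding eq by simp
  qed
next
  case (Suc a)
  note U = \<open>A.sub U\<close> \<open>U \<subseteq> V\<close> and f = \<open>f \<in> lin sc1 sc2 U W\<close> and card = \<open>card V = Q ^ Suc a * card U\<close>
  have cU: "card U > 0" using A.subD(9)[OF U(1)] .
  then have "card U < card V" using card A.Q_gt_1 one_less_power[of Q "Suc a"] by simp
  then obtain x where x: "x \<in> V" "x \<notin> U" using ex_new_elem[OF A.subD(2)[OF U(1)]] by blast
  then have xX: "x \<in> X1" using A.subD(1)[OF V] by blast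
  note e = ext1[OF U(1) xX x(2) W f]
  let ?A = "adj sc1 U x"
  let ?c = "\<lambda>w. card {g \<in> lin sc1 sc2 V W. restrict g ?A = ext1 U x W f w \<and> g ` V = W}"
  have sub: "?A \<subseteq> V" using A.adj_subset[OF V U(2) x(1)] .
  have cA: "card ?A = Q * card U" using A.card_adj[OF U(1) xX x(2)] .
  have fU: "B.sub (f ` U)" using sub_image[OF U(1) B.subD(1)[OF W] f] .
  have SW: "f ` U \<subseteq> W" using lin_mem[OF f] by auto
  have img: "ext1 U x W f w ` ?A = adj sc2 (f ` U) w" if w: "w \<in> W" for w
  proof (intro equalityI subsetI)
    fix y assume "y \<in> ext1 U x W f w ` ?A"
    then obtain u r where "u \<in> U" "y = ext1 U x W f w (u + sc1 r x)" by (auto simp: adj_def)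
    then show "y \<in> adj sc2 (f ` U) w" using e(4)[OF w] by (auto simp: adj_def)
  next
    fix y assume "y \<in> adj sc2 (f ` U) w"
    then obtain u r where "u \<in> U" "y = f u + sc2 r w" by (auto simp: adj_def)
    then show "y \<in> ext1 U x W f w ` ?A"
      by (intro image_eqI[of _ _ "u + sc1 r x"]) (auto simp: e(4)[OF w] adj_def)
  qed
  have 1: "real (?c w) = real (card (f ` U)) ^ a * (\<Prod>i<b. real Q ^ a - real Q ^ i)" if w: "w \<in> f ` U" for w
  proof -
    have wW: "w \<in> W" using w SW by blast
    have ad: "adj sc2 (f ` U) w = f ` U"
      using B.subset_adj[of w "f ` U"] B.adj_subset[OF fU subset_refl w] B.subD[OF fU] w by auto
    have "card W = Q ^ b * card (ext1 U x W f w ` ?A)" "card V = Q ^ a * card ?A"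
      using img[OF wW] ad card cA Suc.prems(4) by auto
    from Suc.IH[OF A.sub_adj[OF U(1) xX] sub e(1)[OF wW] this]
    show ?thesis unfolding img[OF wW] ad .
  qed
  have 2: "real (?c w) = (real Q * real (card (f ` U))) ^ a * (\<Prod>i<b - 1. real Q ^ a - real Q ^ i)" if w: "w \<in> W - f ` U" and b: "b > 0" for w
  proof -
    have wW: "w \<in> W" "w \<in> X2" using w B.subD(1)[OF W] by auto
    have ca: "card (adj sc2 (f ` U) w) = Q * card (f ` U)"
      using B.card_adj[OF fU wW(2)] w by blast
    have "card W = Q ^ (b - 1) * card (ext1 U x W f w ` ?A)"
      using img[OF wW(1)] ca Suc.prems(4) b by (cases b) auto
    moreover have "card V = Q ^ a * card ?A" using card cA by simp
    ultimately show ?thesis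
      using Suc.IH[OF A.sub_adj[OF U(1) xX] sub e(1)[OF wW(1)]] unfolding img[OF wW(1)] ca of_nat_mult by blast
  qed
  have "real (card {g \<in> lin sc1 sc2 V W. restrict g U = f \<and> g ` V = W}) = (\<Sum>w\<in>W. real (?c w))"
    by (simp add: ext_sum[OF V U x W f])
  also have eq: "\<dots> = (\<Sum>w\<in>W - f ` U. real (?c w)) + (\<Sum>w\<in>f ` U. real (?c w))"
    by (rule sum.subset_diff[OF SW]) (simp add: B.subD[OF W])
  also have "\<dots> = real (card (f ` U)) ^ Suc a * (\<Prod>i<b. real Q ^ Suc a - real Q ^ i)"
  proof (cases "b = 0")
    case True
    then have "f ` U = W" using Suc.prems(4) SW B.subD(2)[OF W] card_subset_eq[of W "f ` U"] by auto
    then show ?thesis using 1 True by simp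
  next
    case False
    have "real (card (W - f ` U)) = real Q ^ b * real (card (f ` U)) - real (card (f ` U))"
      using Suc.prems(4) card_mono[OF B.subD(2)[OF W] SW] finite_subset[OF SW B.subD(2)[OF W]] SW
      by (simp add: card_Diff_subset of_nat_diff)
    moreover have "(\<Sum>w\<in>W - f ` U. real (?c w)) =
        (\<Sum>w\<in>W - f ` U. (real Q * real (card (f ` U))) ^ a * (\<Prod>i<b - 1. real Q ^ a - real Q ^ i))"
      using 2 False by (intro sum.cong) auto
    moreover have "(\<Sum>w\<in>f ` U. real (?c w)) = (\<Sum>w\<in>f ` U. real (card (f ` U)) ^ a * (\<Prod>i<b. real Q ^ a - real Q ^ i))"
      using 1 by (intro sum.cong) auto
    ultimately show ?thesis
      using surj_factor_rec[of b "real (card (f ` U))" a "real Q"] False by (simp only: sum_constant) linarith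
  qed
  finally show ?case .
qed

lemma card_avoiding:
  assumes V: "A.sub V" and W: "B.sub W" and Z: "B.sub Z" "Z \<subseteq> W" and card: "card V = Q ^ a"
  shows "real (card {g \<in> lin sc1 sc2 V W. \<forall>v\<in>V. g v \<in> Z \<longrightarrow> v = 0}) =
    (\<Prod>k<a. real (card W) - real (card Z) * real Q ^ k)"
proof -
  let ?f = "\<lambda>v\<in>{0}. 0"
  have f: "?f \<in> lin sc1 sc2 {0} W"
    using B.subD(3)[OF W] by (intro linI) auto
  have "restrict g {0} = ?f" if "g \<in> lin sc1 sc2 V W" for g
    using lin_zero[OF V that] by (auto simp: fun_eq_iff)
  then have eq: "{g \<in> lin sc1 sc2 V W. \<forall>v\<in>V. g v \<in> Z \<longrightarrow> v = 0} =
    {g \<in> lin sc1 sc2 V W. restrict g {0} = ?f \<and> (\<forall>v\<in>V. g v \<in> Z \<longrightarrow> v = 0)}" by auto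
  show ?thesis unfolding eq
    using card_ext_avoiding[OF V W Z A.sub_zero _ f, of a] A.subD(3)[OF V] card by simp
qed

lemma inj_on_iff_kernel:
  assumes V: "A.sub V" and W: "W \<subseteq> X2" and f: "f \<in> lin sc1 sc2 V W"
  shows "inj_on f V \<longleftrightarrow> (\<forall>v\<in>V. f v \<in> {0} \<longrightarrow> v = 0)"
proof
  assume "inj_on f V"
  then show "\<forall>v\<in>V. f v \<in> {0} \<longrightarrow> v = 0"
    using lin_zero[OF V f] A.subD(3)[OF V] by (metis inj_onD singletonD)
next
  assume *: "\<forall>v\<in>V. f v \<in> {0} \<longrightarrow> v = 0"
  show "inj_on f V"
  proof (rule inj_onI)
    fix u v assume "u \<in> V" "v \<in> V" "f u = f v"
    then have "f (u - v) = 0" "u - v \<in> V" using lin_diff[OF V W f] A.subD(7)[OF V] by auto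
    then show "u = v" using * by force
  qed
qed

lemma card_inj:
  assumes V: "A.sub V" and W: "B.sub W" and card: "card V = Q ^ a" "card W = Q ^ b"
  shows "real (card {g \<in> lin sc1 sc2 V W. inj_on g V}) = (\<Prod>k<a. real Q ^ b - real Q ^ k)"
proof -
  have "{g \<in> lin sc1 sc2 V W. inj_on g V} = {g \<in> lin sc1 sc2 V W. \<forall>v\<in>V. g v \<in> {0} \<longrightarrow> v = 0}"
    using inj_on_iff_kernel[OF V B.subD(1)[OF W]] by blast
  then show ?thesis
    using card_avoiding[OF V W B.sub_zero _ card(1)] B.subD(3)[OF W] card by simp
qed

lemma card_iso:
  assumes "A.sub V" "B.sub W" "card V = Q ^ a" "card W = Q ^ a"
  shows "real (card {g \<in> lin sc1 sc2 V W. inj_on g V}) = gl Q a"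
  using card_inj[OF assms] by (simp add: gl_def)

end

section \<open>Counting subspaces that avoid a given one\<close>

context kspace
begin

lemma self_pair: "kpair sc X sc X J Q"
  by (simp add: kpair_def kspace_axioms)

text \<open>Injective maps from a fixed j-dimensional \<open>W0\<close> whose image meets Z only in
  0 are counted in two ways: by their values, and by their image W, which is the image of
  \<open>gl Q j\<close> of them. Taking Z = {0} gives all j-dimensional subspaces; Z of dimension n
  - j gives its complements.\<close>

lemma card_complements:
  assumes V: "sub V" and Z: "sub Z" "Z \<subseteq> V" and card: "card V = Q ^ n" and j: "j \<le> n"
  shows "real (card {W. sub W \<and> W \<subseteq> V \<and> card W = Q ^ j \<and> W \<inter> Z = {0}}) * gl Q j =
    (\<Prod>k<j. real Q ^ n - real (card Z) * real Q ^ k)"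
proof -
  interpret S: kpair sc X sc X J Q by (rule self_pair)
  obtain W0 where W0: "sub W0" "W0 \<subseteq> V" "card W0 = Q ^ j" using sub_of_dim[OF V card j] by blast
  let ?D = "{W. sub W \<and> W \<subseteq> V \<and> card W = Q ^ j \<and> W \<inter> Z = {0}}"
  let ?I = "\<lambda>W. {g \<in> lin sc sc W0 W. inj_on g W0}"
  have fD: "finite ?D" by (rule finite_subset[of _ "Pow V"]) (use subD(2)[OF V] in auto)
  have "{g \<in> lin sc sc W0 V. \<forall>v\<in>W0. g v \<in> Z \<longrightarrow> v = 0} = (\<Union>W\<in>?D. ?I W)" (is "?L = ?R")
  proof (intro equalityI subsetI)
    fix g assume "g \<in> ?L"
    then have g: "g \<in> lin sc sc W0 V" "\<And>v. v \<in> W0 \<Longrightarrow> g v \<in> Z \<Longrightarrow> v = 0" by auto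
    have inj: "inj_on g W0" unfolding S.inj_on_iff_kernel[OF W0(1) subD(1)[OF V] g(1)]
      using g(2) subD(3)[OF Z(1)] by auto
    have s: "sub (g ` W0)" by (rule S.sub_image[OF W0(1) subD(1)[OF V] g(1)])
    have "g \<in> lin sc sc W0 (g ` W0)" using g(1) by (auto simp: lin_def PiE_def)
    moreover have "g ` W0 \<in> ?D"
      using s lin_mem[OF g(1)] card_image[OF inj] W0(3) g(2) S.lin_zero[OF W0(1) g(1)] subD(3)[OF Z(1)] subD(3)[OF s]
      by auto
    ultimately show "g \<in> ?R" using inj by blast
  next
    fix g assume "g \<in> ?R"
    then obtain W where W: "W \<in> ?D" and g: "g \<in> lin sc sc W0 W" "inj_on g W0" by blast
    have "g \<in> lin sc sc W0 V" using g W by (auto simp: lin_def PiE_def)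
    moreover have "v = 0" if "v \<in> W0" "g v \<in> Z" for v
      using S.inj_on_iff_kernel[OF W0(1) _ g(1)] g(2) W that lin_mem[OF g(1) that(1)] subD(1)[of W] by blast
    ultimately show "g \<in> ?L" by blast
  qed
  moreover have "card (\<Union>W\<in>?D. ?I W) = (\<Sum>W\<in>?D. card (?I W))"
  proof (rule card_UN_disjoint[OF fD])
    show "\<forall>W\<in>?D. finite (?I W)"
    proof
      fix W assume "W \<in> ?D"
      then have "finite W" using subD(2) by blast
      then show "finite (?I W)"
        by (rule finite_subset[OF _ finite_lin[OF subD(2)[OF W0(1)]], rotated]) auto
    qed
    \<comment> \<open>Equal cardinalities make an injective map into W a map onto W, so that g
      determines W.\<close>
    have img: "g ` W0 = W" if W: "W \<in> ?D" and g: "g \<in> ?I W" for g W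
      using W g W0(3) lin_mem[of g sc sc W0 W] card_image[of g W0] subD(2)[of W] card_subset_eq[of W "g ` W0"]
      by auto
    show "\<forall>W\<in>?D. \<forall>W'\<in>?D. W \<noteq> W' \<longrightarrow> ?I W \<inter> ?I W' = {}"
    proof (intro ballI impI equals0I)
      fix W W' g assume "W \<in> ?D" "W' \<in> ?D" "W \<noteq> W'" "g \<in> ?I W \<inter> ?I W'"
      then show False using img[of W g] img[of W' g] by blast
    qed
  qed
  moreover have "(\<Sum>W\<in>?D. real (card (?I W))) = real (card ?D) * gl Q j"
    using S.card_iso[OF W0(1) _ W0(3)] by simp
  ultimately show ?thesis using S.card_avoiding[OF W0(1) V Z W0(3)] card by simp
qed

end

section \<open>Counting nilpotent maps\<close>

text \<open>The q-Pochhammer symbol at 1/Q. For Q > 0 it is the order \<open>gl Q j\<close> divided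
  by Q^(j^2).\<close>

definition qpoch :: "nat \<Rightarrow> nat \<Rightarrow> real" where
  "qpoch Q j = (\<Prod>i=1..j. 1 - 1 / real Q ^ i)"

text \<open>The number of nilpotent maps N on an m-dimensional space with corank a and N to the power B equal
  to 0, divided by the order of the general linear group. The recursion restricts N to its image,
  where it has corank b.\<close>

fun nilw :: "nat \<Rightarrow> nat \<Rightarrow> nat \<Rightarrow> nat \<Rightarrow> real" where
  "nilw Q 0 m a = (if m = 0 \<and> a = 0 then 1 else 0)"
| "nilw Q (Suc B) m a =
     (if a \<le> m then \<Sum>b\<le>a. nilw Q B (m - a) b / (real Q ^ (a\<^sup>2) * qpoch Q (a - b)) else 0)"

lemma nilw_eq_0: "m < a \<Longrightarrow> nilw Q B m a = 0"
  by (cases B) auto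

lemma prod_lessThan_add:
  fixes f :: "nat \<Rightarrow> 'a::comm_monoid_mult"
  shows "(\<Prod>k<n + a. f k) = (\<Prod>k<n. f k) * (\<Prod>k<a. f (n + k))"
  by (induction a) (simp_all add: mult_ac)

text \<open>A basis consists of m - a vectors followed by a vectors that form a basis modulo the
  span of the former; each of these a vectors has Q^(m - a) lifts.\<close>

lemma gl_split:
  assumes "a \<le> m"
  shows "gl Q m = (\<Prod>k<m - a. real Q ^ m - real Q ^ k) * (real Q ^ ((m - a) * a) * gl Q a)"
proof -
  have "gl Q m = (\<Prod>k<(m - a) + a. real Q ^ m - real Q ^ k)" using assms by (simp add: gl_def)
  also have "\<dots> = (\<Prod>k<m - a. real Q ^ m - real Q ^ k) * (\<Prod>k<a. real Q ^ m - real Q ^ ((m - a) + k))"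
    by (rule prod_lessThan_add)
  also have "(\<Prod>k<a. real Q ^ m - real Q ^ ((m - a) + k)) = (\<Prod>k<a. real Q ^ (m - a) * (real Q ^ a - real Q ^ k))"
    using assms by (intro prod.cong refl) (simp add: algebra_simps flip: power_add)
  also have "\<dots> = real Q ^ ((m - a) * a) * gl Q a" by (simp add: gl_def prod.distrib power_mult)
  finally show ?thesis .
qed

lemma gl_pos: "1 < Q \<Longrightarrow> 0 < gl Q m"
  unfolding gl_def by (intro prod_pos) (auto intro!: power_strict_increasing)

lemma qpoch_pos: "1 < Q \<Longrightarrow> 0 < qpoch Q j"
  unfolding qpoch_def by (intro prod_pos) (auto simp: divide_less_eq intro!: one_less_power)

text \<open>The product on the left counts the surjections from dimension a to dimension b. The
  factors of \<open>gl Q a\<close> that are missing from it, those with b \<le> i < a, are Q^a times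
  1 - 1/Q^(a - i) and make up \<open>qpoch Q (a - b)\<close>. The denominator in \<open>nilw\<close>
  originates here.\<close>

lemma surj_factor_eq:
  assumes Q: "1 < Q" and b: "b \<le> a"
  shows "(\<Prod>i<b. real Q ^ a - real Q ^ i) * (real Q ^ (a\<^sup>2) * qpoch Q (a - b)) = real Q ^ (a * b) * gl Q a"
proof -
  have "gl Q a = (\<Prod>i<b. real Q ^ a - real Q ^ i) * (\<Prod>i\<in>{b..<a}. real Q ^ a - real Q ^ i)"
    unfolding gl_def using b prod.atLeastLessThan_concat[of 0 b a "\<lambda>i. real Q ^ a - real Q ^ i"]
    by (simp add: atLeast0LessThan)
  also have "(\<Prod>i\<in>{b..<a}. real Q ^ a - real Q ^ i) = (\<Prod>j\<in>{1..a - b}. real Q ^ a * (1 - 1 / real Q ^ j))"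
  proof (rule prod.reindex_bij_witness[of _ "\<lambda>j. a - j" "\<lambda>i. a - i"])
    fix i assume i: "i \<in> {b..<a}"
    have "real Q ^ a = real Q ^ i * real Q ^ (a - i)" using i by (simp flip: power_add)
    then show "real Q ^ a * (1 - 1 / real Q ^ (a - i)) = real Q ^ a - real Q ^ i"
      using Q by (simp add: field_simps)
  qed (use b in auto)
  also have "\<dots> = real Q ^ (a * (a - b)) * qpoch Q (a - b)"
    by (simp only: prod.distrib qpoch_def) (simp add: power_mult)
  finally have "real Q ^ (a * b) * gl Q a =
     (\<Prod>i<b. real Q ^ a - real Q ^ i) * (real Q ^ (a * b + a * (a - b)) * qpoch Q (a - b))"
    by (simp add: power_add)
  also have "a * b + a * (a - b) = a\<^sup>2" using b by (simp add: power2_eq_square flip: add_mult_distrib2)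
  finally show ?thesis by simp
qed

lemma funpow_restrict:
  assumes "\<And>w. w \<in> W \<Longrightarrow> N w \<in> W" "w \<in> W"
  shows "(restrict N W ^^ k) w = (N ^^ k) w \<and> (N ^^ k) w \<in> W"
  using assms(2) by (induction k) (auto intro: assms(1))

lemma card_UNION_eq_sum:
  assumes "finite I" "\<And>i. i \<in> I \<Longrightarrow> finite (A i)"
    "\<And>i j x. i \<in> I \<Longrightarrow> j \<in> I \<Longrightarrow> x \<in> A i \<Longrightarrow> x \<in> A j \<Longrightarrow> i = j"
  shows "card (\<Union>i\<in>I. A i) = (\<Sum>i\<in>I. card (A i))"
  by (rule card_UN_disjoint) (use assms in blast)+

context kspace
begin

lemma lin_zero_space: "lin sc sc {0} {0} = {\<lambda>v\<in>{0}. 0}"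
proof (intro equalityI subsetI)
  fix f assume "f \<in> lin sc sc {0::'v} {0}"
  then show "f \<in> {\<lambda>v\<in>{0}. 0}" using lin_mem[of f sc sc "{0}" "{0}"] lin_ext[of f sc sc "{0}" "{0}"]
    by (auto intro!: extensionalityI[of f "{0}"])
qed (auto intro!: linI)

lemma card_1_imp_zero: "sub V \<Longrightarrow> card V = 1 \<Longrightarrow> V = {0}"
  by (metis card_1_singletonE singletonD subD(3))

text \<open>The last condition expresses that the image has codimension a, without subtraction and
  without a notion of rank.\<close>

definition nilp :: "'v set \<Rightarrow> nat \<Rightarrow> nat \<Rightarrow> ('v \<Rightarrow> 'v) set" where
  "nilp V B a = {N \<in> lin sc sc V V. (\<forall>v\<in>V. (N ^^ B) v = 0) \<and> Q ^ a * card (N ` V) = card V}"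

lemma finite_nilp: "sub V \<Longrightarrow> finite (nilp V B a)"
  unfolding nilp_def using finite_lin[OF subD(2) subD(2), of V V sc sc] by simp

lemma nilp_disjoint:
  assumes "sub V" "N \<in> nilp V B a" "N \<in> nilp V B b"
  shows "a = b"
proof -
  have "Q ^ a * card (N ` V) = Q ^ b * card (N ` V)" using assms by (simp add: nilp_def)
  moreover have "card (N ` V) > 0" using subD(2,3)[OF assms(1)] by (auto simp: card_gt_0_iff)
  ultimately show ?thesis using Q_gt_1 by (simp add: power_inject_exp)
qed

lemma nilpotents_UNION:
  assumes V: "sub V" and m: "card V = Q ^ m"
  shows "{N \<in> lin sc sc V V. \<forall>v\<in>V. (N ^^ B) v = 0} = (\<Union>a\<in>{..m}. nilp V B a)"
proof (intro equalityI subsetI)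
  interpret S: kpair sc X sc X J Q by (rule self_pair)
  fix N assume "N \<in> {N \<in> lin sc sc V V. \<forall>v\<in>V. (N ^^ B) v = 0}"
  then have N: "N \<in> lin sc sc V V" "\<forall>v\<in>V. (N ^^ B) v = 0" by auto
  have s: "sub (N ` V)" by (rule S.sub_image[OF V subD(1)[OF V] N(1)])
  obtain a where a: "card V = Q ^ a * card (N ` V)"
    using relative_dim[OF V s] lin_mem[OF N(1)] by blast
  have "Q ^ a * 1 \<le> Q ^ a * card (N ` V)" using subD(9)[OF s] by (intro mult_left_mono) auto
  then have "Q ^ a \<le> Q ^ m" using a m by simp
  then have "a \<le> m" using Q_gt_1 by simp
  then show "N \<in> (\<Union>a\<in>{..m}. nilp V B a)" using N a by (auto simp: nilp_def)
qed (auto simp: nilp_def)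

text \<open>With W = N(V), the condition N^(B+1) = 0 on V says exactly that N^B = 0 on W. So N
  amounts to its image W, a map N' on W with N'^B = 0, and an extension of N' that maps V onto W.
  The clause on {0} gives the index set the form that \<open>card_complements\<close>
  counts.\<close>

lemma nilp_Suc:
  assumes V: "sub V" and m: "card V = Q ^ m" and a: "a \<le> m"
  shows "nilp V (Suc B) a =
    (\<Union>W\<in>{W. sub W \<and> W \<subseteq> V \<and> card W = Q ^ (m - a) \<and> W \<inter> {0} = {0}}. \<Union>b\<in>{..m - a}. \<Union>N'\<in>nilp W B b.
        {N \<in> lin sc sc V W. restrict N W = N' \<and> N ` V = W})" (is "_ = ?R")
proof (intro equalityI subsetI)
  interpret S: kpair sc X sc X J Q by (rule self_pair)
  {
    fix N assume "N \<in> nilp V (Suc B) a"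
    then have N: "N \<in> lin sc sc V V" "\<And>v. v \<in> V \<Longrightarrow> (N ^^ Suc B) v = 0" "Q ^ a * card (N ` V) = card V"
      by (auto simp: nilp_def)
    define W where "W = N ` V"
    have W: "sub W" unfolding W_def by (rule S.sub_image[OF V subD(1)[OF V] N(1)])
    have WV: "W \<subseteq> V" using lin_mem[OF N(1)] by (auto simp: W_def)
    have "Q ^ a * card W = Q ^ a * Q ^ (m - a)" using N(3) m a by (simp add: W_def flip: power_add)
    then have cW: "card W = Q ^ (m - a)" using Q_gt_1 by simp
    have NW: "N w \<in> W" if "w \<in> W" for w using that WV by (auto simp: W_def)
    have N1: "N \<in> lin sc sc V W" using N(1) by (auto simp: lin_def PiE_def W_def)
    have "restrict N W \<in> lin sc sc W W"
      by (rule linI) (use NW WV lin_add[OF N(1)] lin_sc[OF N(1)] subD[OF W] in \<open>auto simp: subset_iff\<close>)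
    moreover have "(restrict N W ^^ B) w = 0" if w: "w \<in> W" for w
    proof -
      obtain v where "v \<in> V" "w = N v" using w by (auto simp: W_def)
      then have "(N ^^ B) w = 0" using N(2)[of v] by (simp add: funpow_swap1)
      then show ?thesis using funpow_restrict[of W N w B] NW w by auto
    qed
    ultimately have "restrict N W \<in> (\<Union>b\<in>{..m - a}. nilp W B b)"
      unfolding nilpotents_UNION[OF W cW, symmetric] by blast
    moreover have "W \<inter> {0} = {0}" using subD(3)[OF W] by auto
    ultimately show "N \<in> ?R" using W WV cW N1 W_def by blast
  next
    fix N assume "N \<in> ?R"
    then obtain W b N' where W: "sub W" "W \<subseteq> V" "card W = Q ^ (m - a)" and N': "N' \<in> nilp W B b"
      and N: "N \<in> lin sc sc V W" "restrict N W = N'" "N ` V = W" by blast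
    have "N \<in> lin sc sc V V" using N(1) W(2) by (auto simp: lin_def PiE_def)
    moreover have "(N ^^ Suc B) v = 0" if "v \<in> V" for v
    proof -
      have v: "N v \<in> W" using that N(3) by blast
      have "(N' ^^ B) (N v) = 0" using N' v by (auto simp: nilp_def)
      then have "(N ^^ B) (N v) = 0"
        using funpow_restrict[of W N "N v" B] v W(2) lin_mem[OF N(1)] unfolding N(2) by auto
      then show ?thesis by (simp add: funpow_swap1)
    qed
    moreover have "Q ^ a * card (N ` V) = card V" using N(3) W(3) m a by (simp flip: power_add)
    ultimately show "N \<in> nilp V (Suc B) a" by (auto simp: nilp_def)
  }
qed

theorem card_nilp:
  "sub V \<Longrightarrow> card V = Q ^ m \<Longrightarrow> real (card (nilp V B a)) = gl Q m * nilw Q B m a"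
proof (induction B arbitrary: V m a)
  case 0
  show ?case
  proof (cases "m = 0")
    case True
    then have V: "V = {0}" using 0 card_1_imp_zero by simp
    have "nilp V 0 a = (if a = 0 then {\<lambda>v\<in>{0}. 0} else {})"
      using V Q_gt_1 lin_zero_space by (auto simp: nilp_def)
    then show ?thesis using True by (simp add: gl_def)
  next
    case False
    have "nilp V 0 a = {}"
    proof (rule equals0I)
      fix N assume "N \<in> nilp V 0 a"
      then have "V \<subseteq> {0}" by (auto simp: nilp_def)
      then have "card V \<le> 1" using card_mono[of "{0}" V] by simp
      then show False using 0(2) False one_less_power[OF Q_gt_1, of m] by simp
    qed
    then show ?thesis using False by simp
  qed
next
  case (Suc B)
  note V = Suc.prems(1) and m = Suc.prems(2)
  interpret S: kpair sc X sc X J Q by (rule self_pair)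
  show ?case
  proof (cases "a \<le> m")
    case False
    have "nilp V (Suc B) a = {}"
    proof (rule equals0I)
      fix N assume "N \<in> nilp V (Suc B) a"
      then have *: "Q ^ a * card (N ` V) = Q ^ m" using m by (auto simp: nilp_def)
      have "card (N ` V) > 0" using subD(2,3)[OF V] by (auto simp: card_gt_0_iff)
      then have "Q ^ a * 1 \<le> Q ^ a * card (N ` V)" by (intro mult_left_mono) auto
      then have "Q ^ a \<le> Q ^ m" using * by simp
      then show False using False Q_gt_1 by simp
    qed
    then show ?thesis using False by simp
  next
    case True
    let ?D = "{W. sub W \<and> W \<subseteq> V \<and> card W = Q ^ (m - a) \<and> W \<inter> {0} = {0}}"
    let ?E = "\<lambda>W N'. {N \<in> lin sc sc V W. restrict N W = N' \<and> N ` V = W}"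
    let ?P = "\<lambda>b. \<Prod>i<b. real Q ^ a - real Q ^ i"
    let ?t = "\<lambda>b. nilw Q B (m - a) b / (real Q ^ (a\<^sup>2) * qpoch Q (a - b))"
    let ?M = "\<Prod>k<m - a. real Q ^ m - real Q ^ k"
    have fD: "finite ?D" by (rule finite_subset[of _ "Pow V"]) (use subD(2)[OF V] in auto)
    have fE: "finite (?E W N')" if "W \<in> ?D" for W N'
    proof -
      have "finite W" using that subD(2) by blast
      then show ?thesis by (rule finite_subset[OF _ finite_lin[OF subD(2)[OF V]], rotated]) auto
    qed
    \<comment> \<open>An instance of \<open>card_ext_surj\<close>: the image of N' has codimension b
      in W, and W has codimension a in V.\<close>
    have cE: "real (card (?E W N')) = real Q ^ ((m - a - b) * a) * ?P b"
      if W: "W \<in> ?D" and b: "b \<le> m - a" and N': "N' \<in> nilp W B b" for W b N'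
    proof -
      have W': "sub W" "W \<subseteq> V" "card W = Q ^ (m - a)" using W by auto
      have N'': "N' \<in> lin sc sc W W" "Q ^ b * card (N' ` W) = card W" using N' by (auto simp: nilp_def)
      have "Q ^ b * card (N' ` W) = Q ^ b * Q ^ (m - a - b)" 
        unfolding N''(2) W'(3) power_add[symmetric] le_add_diff_inverse[OF b] by (rule refl)
      then have c: "card (N' ` W) = Q ^ (m - a - b)" using Q_gt_1 by simp
      have c2: "card V = Q ^ a * card W" using m W'(3) True by (simp flip: power_add)
      show ?thesis using S.card_ext_surj[OF V W'(1) W'(1,2) N''(1) N''(2)[symmetric] c2] unfolding c
        by (simp add: power_mult)
    qed
    \<comment> \<open>For b > a there is no surjective extension, since the factor i = a of
      \<open>?P b\<close> is 0; the conditional on the right records this.\<close>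
    have tm: "gl Q (m - a) * nilw Q B (m - a) b * (real Q ^ ((m - a - b) * a) * ?P b) =
       gl Q (m - a) * (real Q ^ ((m - a) * a) * gl Q a) *
         (if b \<le> a then ?t b else 0)"
      if b: "b \<le> m - a" for b
    proof (cases "b \<le> a")
      case False
      then have "?P b = 0" by (intro prod_zero) (auto intro!: bexI[of _ a])
      then show ?thesis using False by simp
    next
      case ba: True
      define D where "D = real Q ^ (a\<^sup>2) * qpoch Q (a - b)"
      have nz: "D \<noteq> 0" using qpoch_pos[OF Q_gt_1, of "a - b"] Q_gt_1 by (simp add: D_def)
      have "(m - a) * a = (m - a - b) * a + a * b" 
        using add_mult_distrib[of "m - a - b" b a] unfolding le_add_diff_inverse2[OF b] by (simp only: mult.commute[of a b])
      then have "real Q ^ ((m - a) * a) * gl Q a = real Q ^ ((m - a - b) * a) * (real Q ^ (a * b) * gl Q a)"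
        by (simp add: power_add)
      also have "\<dots> = real Q ^ ((m - a - b) * a) * ?P b * D"
        using surj_factor_eq[OF Q_gt_1 ba] by (simp add: D_def)
      finally show ?thesis using ba nz unfolding D_def[symmetric] by simp
    qed
    have "card (nilp V (Suc B) a) = (\<Sum>W\<in>?D. \<Sum>b\<le>m - a. \<Sum>N'\<in>nilp W B b. card (?E W N'))"
      unfolding nilp_Suc[OF V m True]
    proof (subst card_UNION_eq_sum[OF fD])
      fix W assume W: "W \<in> ?D"
      then have sW: "sub W" by blast
      show "finite (\<Union>b\<in>{..m - a}. \<Union>N'\<in>nilp W B b. ?E W N')"
        using finite_nilp[OF sW] fE[OF W] by (intro finite_UN_I) auto
    next
      show "(\<Sum>W\<in>?D. card (\<Union>b\<in>{..m - a}. \<Union>N'\<in>nilp W B b. ?E W N')) =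
        (\<Sum>W\<in>?D. \<Sum>b\<le>m - a. \<Sum>N'\<in>nilp W B b. card (?E W N'))"
      proof (rule sum.cong[OF refl])
        fix W assume W: "W \<in> ?D"
        then have sW: "sub W" by blast
        have 1: "card (\<Union>N'\<in>nilp W B b. ?E W N') = (\<Sum>N'\<in>nilp W B b. card (?E W N'))" for b
          by (rule card_UNION_eq_sum[OF finite_nilp[OF sW] fE[OF W]]) auto
        have "card (\<Union>b\<in>{..m - a}. \<Union>N'\<in>nilp W B b. ?E W N') = (\<Sum>b\<le>m - a. card (\<Union>N'\<in>nilp W B b. ?E W N'))"
        proof (rule card_UNION_eq_sum)
          show "finite (\<Union>N'\<in>nilp W B b. ?E W N')" for b
            using finite_nilp[OF sW] fE[OF W] by (intro finite_UN_I) auto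
          show "b = c" if "N \<in> (\<Union>N'\<in>nilp W B b. ?E W N')" "N \<in> (\<Union>N'\<in>nilp W B c. ?E W N')" for b c N
            using that nilp_disjoint[OF sW] by blast
        qed simp
        then show "card (\<Union>b\<in>{..m - a}. \<Union>N'\<in>nilp W B b. ?E W N') =
          (\<Sum>b\<le>m - a. \<Sum>N'\<in>nilp W B b. card (?E W N'))" using 1 by simp
      qed
    qed blast
    then have "real (card (nilp V (Suc B) a)) = (\<Sum>W\<in>?D. \<Sum>b\<le>m - a. \<Sum>N'\<in>nilp W B b. real (card (?E W N')))"
      by simp
    also have "\<dots> = (\<Sum>W\<in>?D. \<Sum>b\<le>m - a. real (card (nilp W B b)) * (real Q ^ ((m - a - b) * a) * ?P b))"
      by (intro sum.cong refl) (simp add: cE)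
    also have "\<dots> = (\<Sum>W\<in>?D. \<Sum>b\<le>m - a. gl Q (m - a) * nilw Q B (m - a) b * (real Q ^ ((m - a - b) * a) * ?P b))"
      by (intro sum.cong refl) (simp add: Suc.IH)
    also have "\<dots> = (\<Sum>W\<in>?D. \<Sum>b\<le>m - a. gl Q (m - a) * (real Q ^ ((m - a) * a) * gl Q a) *
         (if b \<le> a then ?t b else 0))"
      by (intro sum.cong refl tm) auto
    also have "\<dots> = (real (card ?D) * gl Q (m - a)) * (real Q ^ ((m - a) * a) * gl Q a) *
        (\<Sum>b\<le>m - a. if b \<le> a then ?t b else 0)"
      by (simp only: sum_constant sum_distrib_left[symmetric] mult.assoc)
    \<comment> \<open>The factor \<open>gl Q (m - a)\<close> from the induction hypothesis completes
      the number of images W to the m - a initial factors of \<open>gl Q m\<close>.\<close>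
    also have "real (card ?D) * gl Q (m - a) = ?M"
      using card_complements[OF V sub_zero _ m, of "m - a"] subD(3)[OF V] by simp
    also have "?M * (real Q ^ ((m - a) * a) * gl Q a) = gl Q m" using gl_split[OF True] by simp
    also have "(\<Sum>b\<le>m - a. if b \<le> a then ?t b else 0) =
       (\<Sum>b\<in>{..m - a} \<inter> {..a}. ?t b)"
      by (subst sum.inter_restrict) auto
    \<comment> \<open>Terms with b > m - a are 0, as a corank cannot exceed the dimension.\<close>
    also have "\<dots> = (\<Sum>b\<le>a. ?t b)"
      by (rule sum.mono_neutral_left) (auto simp: nilw_eq_0)
    finally show ?thesis using True by simp
  qed
qed

corollary card_nilpotents:
  assumes "sub V" "card V = Q ^ m"
  shows "real (card {N \<in> lin sc sc V V. \<forall>v\<in>V. (N ^^ B) v = 0}) = gl Q m * (\<Sum>a\<le>m. nilw Q B m a)"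
proof -
  have "card {N \<in> lin sc sc V V. \<forall>v\<in>V. (N ^^ B) v = 0} = (\<Sum>a\<le>m. card (nilp V B a))"
    unfolding nilpotents_UNION[OF assms]
    by (rule card_UNION_eq_sum) (use finite_nilp nilp_disjoint assms in auto)
  then show ?thesis using card_nilp[OF assms] by (simp add: sum_distrib_left)
qed

end

section \<open>Adding a column to a partition\<close>

definition bounded_parts :: "nat \<Rightarrow> nat \<Rightarrow> nat \<Rightarrow> nat multiset set" where
  "bounded_parts B m a = {P \<in> partitions_of m. (\<forall>x\<in>#P. x \<le> B) \<and> size P = a}"

text \<open>N is an upper limit for the indices and not a datum of the partition:
  \<open>factor_fps\<close> uses the size m of the partition, the induction on B uses B.\<close>

definition part_weight :: "nat \<Rightarrow> nat \<Rightarrow> nat multiset \<Rightarrow> real" where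
  "part_weight Q N P = 1 / (real Q ^ (\<Sum>i=1..N. (conj_part P i)\<^sup>2) * (\<Prod>i=1..N. qpoch Q (count P i)))"

text \<open>Puts a new first column of length a in front of the Young diagram.\<close>

definition add_column :: "nat \<Rightarrow> nat multiset \<Rightarrow> nat multiset" where
  "add_column a P = image_mset Suc P + replicate_mset (a - size P) 1"

lemma qpoch_0 [simp]: "qpoch Q 0 = 1"
  by (simp add: qpoch_def)

text \<open>Beyond the largest part the columns are empty and the multiplicities are 0, so such
  indices change neither the sum nor the product.\<close>

lemma part_weight_bound:
  assumes "\<forall>x\<in>#P. x \<le> N" "\<forall>x\<in>#P. x \<le> N'"
  shows "part_weight Q N P = part_weight Q N' P"
proof -
  have *: "part_weight Q (min N N') P = part_weight Q K P" if "K \<in> {N, N'}" for K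
  proof -
    have le: "\<forall>x\<in>#P. x \<le> min N N'" using assms by auto
    have "conj_part P i = 0" if "i > min N N'" for i
      using le that by (fastforce simp: conj_part_def filter_mset_eq_conv)
    then have "(\<Sum>i=1..min N N'. (conj_part P i)\<^sup>2) = (\<Sum>i=1..K. (conj_part P i)\<^sup>2)"
      using that by (intro sum.mono_neutral_left) auto
    moreover have "count P i = 0" if "i > min N N'" for i
      using le that by (metis leD not_in_iff)
    then have "(\<Prod>i=1..min N N'. qpoch Q (count P i)) = (\<Prod>i=1..K. qpoch Q (count P i))"
      using that by (intro prod.mono_neutral_left) auto
    ultimately show ?thesis by (simp add: part_weight_def)
  qed
  show ?thesis using *[of N] *[of N'] by simp
qed

lemma sum_mset_image_Suc: "sum_mset (image_mset Suc P) = sum_mset P + size P"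
  by (induction P) auto

lemma count_image_Suc: "count (image_mset Suc P) (Suc k) = count P k"
  by (induction P) auto

lemma filter_replicate_mset: "filter_mset R (replicate_mset n x) = (if R x then replicate_mset n x else {#})"
  by (induction n) auto

lemma size_le_sum_mset: "\<forall>x\<in>#P. 0 < (x::nat) \<Longrightarrow> size P \<le> sum_mset P"
  by (induction P) force+

text \<open>The multiplicity of k > 0 in P is that of k + 1 in \<open>add_column a P\<close>. The
  new parts affect the multiplicity of 1 alone, and 0 is excluded as a part.\<close>

lemma inj_add_column:
  assumes "\<forall>x\<in>#P. 0 < x" "\<forall>x\<in>#P'. 0 < x" "add_column a P = add_column a P'"
  shows "P = P'"
proof (rule multiset_eqI)
  have c: "count (add_column a R) (Suc k) = count R k" if "\<forall>x\<in>#R. 0 < x" "0 < k" for R k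
    using that by (simp add: add_column_def count_image_Suc)
  have z: "count R 0 = 0" if "\<forall>x\<in>#R. 0 < x" for R :: "nat multiset" using that by (metis less_irrefl not_in_iff)
  fix k show "count P k = count P' k"
    using c[OF assms(1), of k] c[OF assms(2), of k] z[OF assms(1)] z[OF assms(2)] assms(3) by (cases "k = 0") auto
qed

text \<open>In the other direction every part shrinks by 1 and the parts equal to 1 vanish. This
  leaves b \<le> a parts, and the a - b lost ones are those that \<open>add_column\<close>
  restores.\<close>

lemma bounded_parts_Suc:
  assumes "a \<le> m"
  shows "bounded_parts (Suc B) m a = add_column a ` (\<Union>b\<in>{..a}. bounded_parts B (m - a) b)"
proof (intro equalityI subsetI)
  fix P assume "P \<in> bounded_parts (Suc B) m a"
  then have P: "\<And>x. x \<in># P \<Longrightarrow> 0 < x" "sum_mset P = m" "\<And>x. x \<in># P \<Longrightarrow> x \<le> Suc B" "size P = a"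
    by (auto simp: bounded_parts_def partitions_of_def)
  define P' where "P' = image_mset (\<lambda>x. x - 1) (filter_mset (\<lambda>x. x \<noteq> 1) P)"
  have S: "image_mset Suc P' = filter_mset (\<lambda>x. x \<noteq> 1) P"
  proof -
    have "image_mset Suc P' = image_mset (\<lambda>x. Suc (x - 1)) (filter_mset (\<lambda>x. x \<noteq> 1) P)"
      by (simp add: P'_def image_mset.compositionality comp_def)
    also have "\<dots> = image_mset (\<lambda>x. x) (filter_mset (\<lambda>x. x \<noteq> 1) P)"
      using P(1) by (intro image_mset_cong) fastforce
    finally show ?thesis by simp
  qed
  have part: "P = filter_mset (\<lambda>x. x \<noteq> 1) P + replicate_mset (count P 1) 1"
    using multiset_partition[of P "\<lambda>x. x \<noteq> 1"] by (simp add: filter_eq_replicate_mset)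
  then have sz: "size P = size P' + count P 1"
    using trans[OF arg_cong[OF part, of size] size_union]
    by (simp only: P'_def size_image_mset size_replicate_mset)
  have eq: "P = add_column a P'"
    using part S sz P(4) by (simp add: add_column_def)
  have "sum_mset P = sum_mset P' + a"
    using arg_cong[OF eq, of sum_mset] sz P(4) by (simp add: add_column_def sum_mset_image_Suc sum_mset_replicate_mset)
  then have mem: "P' \<in> bounded_parts B (m - a) (size P')"
    using P by (fastforce simp: bounded_parts_def partitions_of_def P'_def)
  have "size P' \<in> {..a}" using sz P(4) by simp
  then have "P' \<in> (\<Union>b\<in>{..a}. bounded_parts B (m - a) b)" using mem by blast
  then show "P \<in> add_column a ` (\<Union>b\<in>{..a}. bounded_parts B (m - a) b)"
    by (subst eq) (rule imageI)
next
  fix P assume "P \<in> add_column a ` (\<Union>b\<in>{..a}. bounded_parts B (m - a) b)"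
  then obtain b P' where P': "P = add_column a P'" "b \<le> a" "\<And>x. x \<in># P' \<Longrightarrow> 0 < x" "sum_mset P' = m - a"
    "\<And>x. x \<in># P' \<Longrightarrow> x \<le> B" "size P' = b"
    by (auto simp: bounded_parts_def partitions_of_def)
  have "sum_mset P = m" using P' assms by (simp add: add_column_def sum_mset_image_Suc sum_mset_replicate_mset)
  moreover have "size P = a" using P' by (simp add: add_column_def)
  moreover have "0 < x \<and> x \<le> Suc B" if "x \<in># P" for x
    using that P' by (auto simp: add_column_def split: if_splits)
  ultimately show "P \<in> bounded_parts (Suc B) m a" by (auto simp: bounded_parts_def partitions_of_def)
qed

lemma bounded_parts_empty: "m < a \<Longrightarrow> bounded_parts B m a = {}"
  using size_le_sum_mset by (fastforce simp: bounded_parts_def partitions_of_def)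

lemma bounded_parts_0: "bounded_parts 0 m a = (if m = 0 \<and> a = 0 then {{#}} else {})"
proof -
  have "P = {#}" if "P \<in> bounded_parts 0 m a" for P
    using that by (cases P) (auto simp: bounded_parts_def partitions_of_def)
  then have "bounded_parts 0 m a \<subseteq> {{#}}" by blast
  moreover have "{#} \<in> bounded_parts 0 m a \<longleftrightarrow> m = 0 \<and> a = 0"
    by (auto simp: bounded_parts_def partitions_of_def)
  ultimately show ?thesis by auto
qed

lemma finite_bounded_parts: "finite (bounded_parts B m a)"
proof (induction B arbitrary: m a)
  case 0 show ?case by (simp add: bounded_parts_0)
next
  case (Suc B) then show ?case
    by (cases "a \<le> m") (simp_all add: bounded_parts_Suc bounded_parts_empty)
qed

lemma sum_1_Suc: "(\<Sum>i=1..Suc B. f i) = f 1 + (\<Sum>i=1..B. f (Suc i))" for f :: "nat \<Rightarrow> nat"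
  by (induction B) simp_all

lemma prod_1_Suc: "(\<Prod>i=1..Suc B. f i) = f 1 * (\<Prod>i=1..B. f (Suc i))" for f :: "nat \<Rightarrow> real"
  by (induction B) simp_all

text \<open>The new column contributes a^2 to the exponent, the a - b new parts equal to 1
  contribute \<open>qpoch Q (a - b)\<close>, and all other columns and multiplicities move up by one
  index.\<close>

lemma part_weight_add_column:
  assumes P: "\<forall>x\<in>#P. 0 < x" "size P = b" "b \<le> a"
  shows "part_weight Q (Suc B) (add_column a P) = part_weight Q B P / (real Q ^ (a\<^sup>2) * qpoch Q (a - b))"
proof -
  have z: "count P 0 = 0" using P by (metis less_irrefl not_in_iff)
  have 1: "conj_part (add_column a P) 1 = a"
    using P by (simp add: conj_part_def add_column_def filter_mset_image_mset filter_replicate_mset comp_def)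
  have 2: "conj_part (add_column a P) (Suc i) = conj_part P i" if "i \<in> {1..B}" for i
    using that by (simp add: conj_part_def add_column_def filter_mset_image_mset filter_replicate_mset comp_def)
  have c1: "count (add_column a P) 1 = a - b"
    using P z count_image_Suc[of P 0] by (simp add: add_column_def)
  have c2: "count (add_column a P) (Suc i) = count P i" if "i \<in> {1..B}" for i
    using that by (simp add: add_column_def count_image_Suc)
  have "(\<Sum>i=1..Suc B. (conj_part (add_column a P) i)\<^sup>2) = a\<^sup>2 + (\<Sum>i=1..B. (conj_part P i)\<^sup>2)"
    unfolding sum_1_Suc 1 by (intro arg_cong2[of _ _ _ _ "(+)"] sum.cong refl) (simp add: 2)
  moreover have "(\<Prod>i=1..Suc B. qpoch Q (count (add_column a P) i)) = qpoch Q (a - b) * (\<Prod>i=1..B. qpoch Q (count P i))"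
    unfolding prod_1_Suc c1 by (intro arg_cong2[of _ _ _ _ "(*)"] prod.cong refl) (simp add: c2)
  ultimately show ?thesis unfolding part_weight_def by (simp add: power_add mult_ac)
qed

theorem sum_part_weight: "(\<Sum>P\<in>bounded_parts B m a. part_weight Q B P) = nilw Q B m a"
proof (induction B arbitrary: m a)
  case 0
  show ?case by (simp add: bounded_parts_0 part_weight_def)
next
  case (Suc B)
  show ?case
  proof (cases "a \<le> m")
    case False then show ?thesis by (simp add: bounded_parts_empty)
  next
    case True
    have pos: "\<forall>x\<in>#P. 0 < x" "size P = b" if "P \<in> bounded_parts B (m - a) b" for P b
      using that by (auto simp: bounded_parts_def partitions_of_def)
    have inj: "inj_on (add_column a) (\<Union>b\<in>{..a}. bounded_parts B (m - a) b)"
    proof (rule inj_onI)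
      fix P P' assume "P \<in> (\<Union>b\<in>{..a}. bounded_parts B (m - a) b)" "P' \<in> (\<Union>b\<in>{..a}. bounded_parts B (m - a) b)"
        "add_column a P = add_column a P'"
      then show "P = P'" using pos(1) by (elim UN_E) (rule inj_add_column)
    qed
    have "(\<Sum>P\<in>bounded_parts (Suc B) m a. part_weight Q (Suc B) P) =
      (\<Sum>P\<in>(\<Union>b\<in>{..a}. bounded_parts B (m - a) b). part_weight Q (Suc B) (add_column a P))"
      unfolding bounded_parts_Suc[OF True]
      by (subst sum.reindex[OF inj]) simp
    also have "\<dots> = (\<Sum>b\<le>a. \<Sum>P\<in>bounded_parts B (m - a) b. part_weight Q (Suc B) (add_column a P))"
      by (rule sum.UNION_disjoint) (auto simp: finite_bounded_parts dest: pos(2))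
    also have "\<dots> = (\<Sum>b\<le>a. \<Sum>P\<in>bounded_parts B (m - a) b. part_weight Q B P / (real Q ^ (a\<^sup>2) * qpoch Q (a - b)))"
      by (intro sum.cong refl part_weight_add_column pos) auto
    also have "\<dots> = (\<Sum>b\<le>a. nilw Q B (m - a) b / (real Q ^ (a\<^sup>2) * qpoch Q (a - b)))"
      by (simp add: Suc.IH flip: sum_divide_distrib)
    finally show ?thesis using True by simp
  qed
qed

lemma nilw_0_0: "nilw Q B 0 0 = 1"
  by (induction B) auto

lemma le_sum_mset: "x \<in># P \<Longrightarrow> x \<le> (sum_mset P :: nat)"
  by (metis le_add1 multi_member_split sum_mset.add_mset)

text \<open>With Q = q^e the exponents that are multiples of e become those of
  \<open>part_weight\<close>, and only powers of z with exponent divisible by e occur.\<close>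

theorem factor_fps_nth:
  assumes e: "0 < e"
  shows "fps_nth (factor_fps q e B) n = (if e dvd n then \<Sum>a\<le>n div e. nilw (q ^ e) B (n div e) a else 0)"
proof -
  let ?w = "\<lambda>m P. 1 / (real q ^ (e * (\<Sum>i=1..m. (conj_part P i)^2)) *
               (\<Prod>i=1..m. \<Prod>j=1..count P i. (1 - 1 / real q ^ (e * j))))"
  have w: "?w m P = part_weight (q ^ e) m P" for m P
    by (simp add: part_weight_def qpoch_def power_mult)
  have main: "(\<Sum>P\<in>{P\<in>partitions_of m. Max (set_mset P) \<le> B}. ?w m P) = (\<Sum>a\<le>m. nilw (q ^ e) B m a)"
    if m: "1 \<le> m" for m
  proof -
    \<comment> \<open>\<open>Max\<close> is only meaningful on a nonempty set; 1 \<le> m rules out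
      the empty partition.\<close>
    have ne: "P \<noteq> {#}" if "P \<in> partitions_of m" for P using that m by (auto simp: partitions_of_def)
    have "{P\<in>partitions_of m. Max (set_mset P) \<le> B} = {P\<in>partitions_of m. \<forall>x\<in>#P. x \<le> B}"
      using ne by (intro Collect_cong conj_cong refl Max_le_iff) auto
    also have "\<dots> = (\<Union>a\<in>{..m}. bounded_parts B m a)"
      using size_le_sum_mset by (fastforce simp: bounded_parts_def partitions_of_def)
    finally have eq: "{P\<in>partitions_of m. Max (set_mset P) \<le> B} = (\<Union>a\<in>{..m}. bounded_parts B m a)" .
    have "(\<Sum>P\<in>{P\<in>partitions_of m. Max (set_mset P) \<le> B}. ?w m P) =
      (\<Sum>a\<le>m. \<Sum>P\<in>bounded_parts B m a. part_weight (q ^ e) m P)"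
      unfolding eq w by (rule sum.UNION_disjoint) (simp_all add: finite_bounded_parts, auto simp: bounded_parts_def)
    also have "\<dots> = (\<Sum>a\<le>m. \<Sum>P\<in>bounded_parts B m a. part_weight (q ^ e) B P)"
      by (intro sum.cong refl part_weight_bound) (auto simp: bounded_parts_def partitions_of_def dest: le_sum_mset)
    finally show ?thesis by (simp add: sum_part_weight)
  qed
  show ?thesis
  proof (cases "e dvd n \<and> n \<noteq> 0")
    case True
    then have "{m. 1 \<le> m \<and> m * e = n} = {n div e}" "1 \<le> n div e" using e by auto
    then show ?thesis using True main[of "n div e"] by (simp add: factor_fps_def)
  next
    case False
    \<comment> \<open>Two cases meet here: for n = 0 the coefficient is the 1 that stands outside
      the sum, for the other n it is 0 because e does not divide n.\<close>
    then have E: "{m. 1 \<le> m \<and> m * e = n} = {}" using e by auto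
    show ?thesis unfolding factor_fps_def fps_nth_Abs_fps E sum.empty using False by (auto simp: nilw_0_0)
  qed
qed

section \<open>Polynomials acting on a vector space\<close>

lemma poly_bezout:
  fixes g h :: "'a::field poly"
  shows "\<exists>a b. (a * g + b * h) dvd g \<and> (a * g + b * h) dvd h"
proof (induction "euclidean_size h" arbitrary: g h rule: less_induct)
  case less
  show ?case
  proof (cases "h = 0")
    case True
    then show ?thesis by (intro exI[of _ 1] exI[of _ 0]) simp
  next
    case False
    then obtain a b where ab: "(a * h + b * (g mod h)) dvd h" "(a * h + b * (g mod h)) dvd (g mod h)"
      using less[of "g mod h" h] mod_size_less by blast
    have eq: "a * h + b * (g mod h) = b * g + (a - b * (g div h)) * h"
      by (simp add: minus_div_mult_eq_mod[symmetric] algebra_simps)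
    have "(a * h + b * (g mod h)) dvd g" using dvd_mod_imp_dvd[OF ab(2,1)] .
    then show ?thesis using ab(1) unfolding eq by blast
  qed
qed

text \<open>In f = (a f + b r) c one of the two factors is a unit. It is not c, since otherwise f
  would divide the combination and hence r.\<close>

lemma irreducible_bezout:
  fixes f :: "'a::field poly"
  assumes "irreducible f" "\<not> f dvd r"
  shows "\<exists>a b. a * f + b * r = 1"
proof -
  obtain a b where ab: "(a * f + b * r) dvd f" "(a * f + b * r) dvd r" using poly_bezout by blast
  then obtain c where c: "f = (a * f + b * r) * c" by blast
  have "\<not> c dvd 1"
  proof
    assume "c dvd 1"
    then obtain c' where "c * c' = 1" by (metis dvd_def)
    then have "a * f + b * r = f * c'" using c by (metis mult.assoc mult.right_neutral)
    then have "f dvd r" using ab(2) by (metis dvd_trans dvd_triv_left)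
    then show False using assms by blast
  qed
  then have "(a * f + b * r) dvd 1" using assms(1) c by (metis irreducible_def)
  then obtain u where "(a * f + b * r) * u = 1" by (metis dvd_def)
  then have "(u * a) * f + (u * b) * r = 1" by (simp add: algebra_simps)
  then show ?thesis by blast
qed

text \<open>The zero polynomial has degree 0, so at e = 0 the set would be empty while the power on
  the right is 1.\<close>

lemma card_polys_degree_less:
  assumes "0 < e"
  shows "finite {r :: 'a::{finite,field} poly. degree r < e}"
    "card {r :: 'a::{finite,field} poly. degree r < e} = CARD('a) ^ e"
proof -
  have "finite {r :: 'a poly. degree r < e} \<and> card {r :: 'a poly. degree r < e} = CARD('a) ^ e"
    using assms
  proof (induction e rule: nat_induct_non_zero)
    case 1
    have eq: "{r :: 'a poly. degree r < 1} = (\<lambda>c. [:c:]) ` UNIV"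
      by (auto simp: image_iff elim!: degree_eq_zeroE)
    show ?case unfolding eq by (auto intro!: card_image inj_onI)
  next
    case (Suc e)
    have eq: "{r :: 'a poly. degree r < Suc e} = (\<lambda>(c, r). pCons c r) ` (UNIV \<times> {r. degree r < e})"
    proof (intro equalityI subsetI)
      fix r :: "'a poly" assume r: "r \<in> {r. degree r < Suc e}"
      obtain c r' where "r = pCons c r'" by (rule pCons_cases)
      moreover have "degree r' < e" using r calculation Suc(1) by (cases "r' = 0") auto
      ultimately show "r \<in> (\<lambda>(c, r). pCons c r) ` (UNIV \<times> {r. degree r < e})" by auto
    next
      fix r :: "'a poly" assume "r \<in> (\<lambda>(c, r). pCons c r) ` (UNIV \<times> {r. degree r < e})"
      then obtain c r' where "r = pCons c r'" "degree r' < e" by auto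
      then show "r \<in> {r. degree r < Suc e}" using degree_pCons_le[of c r'] by simp
    qed
    have "inj_on (\<lambda>(c :: 'a, r). pCons c r) (UNIV \<times> {r. degree r < e})" by (auto intro!: inj_onI)
    then show ?case unfolding eq using Suc(2)
      by (simp add: card_image card_cartesian_product)
  qed
  then show "finite {r :: 'a::{finite,field} poly. degree r < e}"
    "card {r :: 'a::{finite,field} poly. degree r < e} = CARD('a) ^ e" by auto
qed

lemma dvd_diff_imp_eq:
  fixes f :: "'a::field poly"
  assumes "f dvd r - s" "degree r < degree f" "degree s < degree f"
  shows "r = s"
proof -
  have "degree (r - s) < degree f" using assms(2,3) by (rule degree_diff_less)
  then have "r - s = 0" using assms(1) dvd_imp_degree_le[of f "r - s"] by (metis leD)
  then show ?thesis by simp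
qed

section \<open>Evaluation of polynomials at an endomorphism\<close>

definition act :: "('a::comm_ring_1 \<Rightarrow> 'v::ab_group_add \<Rightarrow> 'v) \<Rightarrow> ('v \<Rightarrow> 'v) \<Rightarrow> 'a poly \<Rightarrow> 'v \<Rightarrow> 'v" where
  "act sc S p v = (\<Sum>i\<le>degree p. sc (coeff p i) ((S ^^ i) v))"

locale fspace = kspace sc X "{0 :: 'a::{finite,field}}" "CARD('a::{finite,field})"
  for sc :: "'a::{finite,field} \<Rightarrow> 'v::ab_group_add \<Rightarrow> 'v" and X
begin

abbreviation End where "End V \<equiv> lin sc sc V V"

lemma funpow_mem: "S \<in> End V \<Longrightarrow> v \<in> V \<Longrightarrow> (S ^^ i) v \<in> V"
  by (induction i) (auto simp: lin_mem)

lemma act_bound: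
  assumes "sub V" "S \<in> End V" "v \<in> V" "degree p \<le> n"
  shows "act sc S p v = (\<Sum>i\<le>n. sc (coeff p i) ((S ^^ i) v))"
  unfolding act_def
proof (rule sum.mono_neutral_left)
  show "\<forall>i\<in>{..n} - {..degree p}. sc (coeff p i) ((S ^^ i) v) = 0"
    using funpow_mem[OF assms(2,3)] subD(8)[OF assms(1)] by (auto simp: coeff_eq_0)
qed (use assms in auto)

lemma act_0: "sub V \<Longrightarrow> v \<in> V \<Longrightarrow> act sc S 0 v = 0"
  by (simp add: act_def subD)

lemma act_pCons:
  assumes "sub V" "S \<in> End V" "v \<in> V"
  shows "act sc S (pCons c p) v = sc c v + act sc S p (S v)"
proof -
  have "act sc S (pCons c p) v = (\<Sum>i\<le>Suc (degree p). sc (coeff (pCons c p) i) ((S ^^ i) v))"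
    by (rule act_bound[OF assms]) (rule degree_pCons_le)
  also have "\<dots> = sc c v + (\<Sum>i\<le>degree p. sc (coeff p i) ((S ^^ i) (S v)))"
    by (simp add: sum.atMost_Suc_shift funpow_swap1 del: sum.atMost_Suc)
  finally show ?thesis by (simp add: act_def)
qed

lemma act_1: "sub V \<Longrightarrow> v \<in> V \<Longrightarrow> act sc S 1 v = v"
  by (simp add: act_def sc_one subD)

lemma act_const: "sub V \<Longrightarrow> S \<in> End V \<Longrightarrow> v \<in> V \<Longrightarrow> act sc S [:c:] v = sc c v"
  using act_pCons[of V S v c 0] by (simp add: act_0 lin_mem)

lemma act_X: "sub V \<Longrightarrow> S \<in> End V \<Longrightarrow> v \<in> V \<Longrightarrow> act sc S [:0, 1:] v = S v"
  using act_pCons[of V S v 0 "[:1:]"] act_const[of V S "S v" 1] lin_mem[of S sc sc V V v]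
  by (simp add: sc_one subD)

lemma act_mem: "sub V \<Longrightarrow> S \<in> End V \<Longrightarrow> v \<in> V \<Longrightarrow> act sc S p v \<in> V"
  by (induction p arbitrary: v) (auto simp: act_0 act_pCons subD lin_mem)

lemma act_add:
  assumes "sub V" "S \<in> End V" "v \<in> V"
  shows "act sc S (p + r) v = act sc S p v + act sc S r v"
proof -
  let ?n = "max (degree p) (degree r)"
  have m: "(S ^^ i) v \<in> X" for i using funpow_mem[OF assms(2,3)] subD(8)[OF assms(1)] by blast
  have "act sc S (p + r) v = (\<Sum>i\<le>?n. sc (coeff (p + r) i) ((S ^^ i) v))"
    by (rule act_bound[OF assms]) (rule degree_add_le_max)
  also have "\<dots> = (\<Sum>i\<le>?n. sc (coeff p i) ((S ^^ i) v)) + (\<Sum>i\<le>?n. sc (coeff r i) ((S ^^ i) v))"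
    by (simp add: sc_add_left m sum.distrib)
  finally show ?thesis using act_bound[OF assms, of p ?n] act_bound[OF assms, of r ?n] by simp
qed

lemma act_monom:
  assumes "sub V" "S \<in> End V" "v \<in> V"
  shows "act sc S (monom 1 k) v = (S ^^ k) v"
proof -
  have m: "(S ^^ i) v \<in> X" for i using funpow_mem[OF assms(2,3)] subD(8)[OF assms(1)] by blast
  have "act sc S (monom 1 k) v = (\<Sum>i\<le>k. sc (coeff (monom 1 k) i) ((S ^^ i) v))"
    by (rule act_bound[OF assms]) (rule degree_monom_le)
  also have "\<dots> = (\<Sum>i\<in>{k}. sc (coeff (monom 1 k) i) ((S ^^ i) v))"
    using m by (intro sum.mono_neutral_right) auto
  finally show ?thesis using m by (simp add: sc_one)
qed

end

text \<open>Two spaces of different type are allowed because the lemma serves two purposes: with one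
  space and one endomorphism it treats maps that commute with S, and with the model space as source
  it transports a polynomial identity to V.\<close>

lemma act_intertwine:
  assumes A: "fspace s1 X1" and B: "fspace s2 X2" and V: "kspace.sub s1 X1 V" and W: "kspace.sub s2 X2 W"
    and S: "S \<in> lin s1 s1 V V" and T: "T \<in> lin s2 s2 W W" and f: "f \<in> lin s1 s2 V W"
    and ST: "\<And>v. v \<in> V \<Longrightarrow> f (S v) = T (f v)" and v: "v \<in> V"
  shows "f (act s1 S p v) = act s2 T p (f v)"
  using v
proof (induction p arbitrary: v)
  interpret A: fspace s1 X1 by fact
  interpret B: fspace s2 X2 by fact
  interpret P: kpair s1 X1 s2 X2 "{0}" "CARD('a)" by unfold_locales
  case 0
  then show ?case using V W P.lin_zero[OF V f] lin_mem[OF f] by (simp add: A.act_0[OF V] B.act_0[OF W])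
next
  interpret A: fspace s1 X1 by fact
  interpret B: fspace s2 X2 by fact
  case (pCons c p)
  have m: "S v \<in> V" "s1 c v \<in> V" "act s1 S p (S v) \<in> V" "f v \<in> W"
    using pCons(3) lin_mem[OF S] lin_mem[OF f] A.subD(5)[OF V] A.act_mem[OF V S] by auto
  show ?case
    using pCons m by (simp add: A.act_pCons[OF V S] B.act_pCons[OF W T] lin_add[OF f] lin_sc[OF f] ST)
qed

context fspace
begin

lemma act_commute:
  assumes V: "sub V" "S \<in> End V" "N \<in> End V" and c: "\<And>v. v \<in> V \<Longrightarrow> N (S v) = S (N v)" and v: "v \<in> V"
  shows "N (act sc S p v) = act sc S p (N v)"
  by (rule act_intertwine[OF fspace_axioms fspace_axioms]) (use assms in auto)

lemma act_linear: "sub V \<Longrightarrow> S \<in> End V \<Longrightarrow> v \<in> V \<Longrightarrow> w \<in> V \<Longrightarrow> act sc S p (v + w) = act sc S p v + act sc S p w"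
proof (induction p arbitrary: v w)
  case (pCons c p)
  have m: "S v \<in> V" "S w \<in> V" "v \<in> X" "w \<in> X" using pCons lin_mem[of S sc sc V V] subD(8) by auto
  show ?case using pCons m by (simp add: act_pCons lin_add subD(4) sc_add_right algebra_simps)
qed (simp add: act_0 subD)

lemma act_smult:
  assumes "sub V" "S \<in> End V" "v \<in> V"
  shows "act sc S (smult c p) v = sc c (act sc S p v)"
  using assms(3)
proof (induction p arbitrary: v)
  case 0
  then show ?case by (simp add: act_0[OF assms(1)])
next
  case (pCons d p)
  have m: "S v \<in> V" "v \<in> X" "sc d v \<in> X" "act sc S p (S v) \<in> X"
    using pCons lin_mem[OF assms(2)] subD[OF assms(1)] act_mem[OF assms(1,2)] by auto
  show ?case using pCons m by (simp add: act_pCons[OF assms(1,2)] sc_add_right sc_mult)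
qed

lemma act_mult:
  assumes "sub V" "S \<in> End V" "v \<in> V"
  shows "act sc S (p * r) v = act sc S p (act sc S r v)"
  using assms(3)
proof (induction p arbitrary: v)
  case 0
  then show ?case using assms by (simp add: act_0 act_mem)
next
  case (pCons d p)
  have m: "S v \<in> V" "act sc S r v \<in> V"
    using pCons lin_mem[OF assms(2)] act_mem[OF assms(1,2)] by auto
  have "S (act sc S r v) = act sc S r (S v)"
    by (rule act_commute) (use assms pCons in auto)
  then show ?case using pCons m
    by (simp add: act_pCons[OF assms(1,2)] act_add[OF assms(1,2)] act_smult[OF assms(1,2)] sc_zero_left subD(8)[OF assms(1)])
qed

lemma act_diff:
  assumes "sub V" "S \<in> End V" "v \<in> V"
  shows "act sc S (p - r) v = act sc S p v - act sc S r v"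
  using act_add[OF assms, of "p - r" r] by simp

text \<open>As f(S) = 0, polynomials act through the residue field modulo f. Bezout gives the
  inverses, and the orbit of v \<noteq> 0 is in bijection with the remainders of degree less than
  \<open>degree f\<close>, which accounts for the size of the field.\<close>

lemma kspace_act:
  assumes V: "sub V" and S: "S \<in> End V" and f: "irreducible f" and fS: "\<And>v. v \<in> V \<Longrightarrow> act sc S f v = 0"
  shows "kspace (act sc S) V {r. f dvd r} (CARD('a) ^ degree f)"
proof
  note a = act_add[OF V S] act_mult[OF V S] act_1[OF V]
  have d: "0 < degree f" using f by (metis irreducible_def is_unit_iff_degree gr0I)
  show "0 \<in> V" using V by (simp add: subD)
  show "v + w \<in> V" if "v \<in> V" "w \<in> V" for v w using V that by (simp add: subD)
  show "act sc S r v \<in> V" if "v \<in> V" for v r using act_mem[OF V S that] .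
  show "act sc S r (v + w) = act sc S r v + act sc S r w" if "v \<in> V" "w \<in> V" for r v w
    using act_linear[OF V S that] .
  show "act sc S (r + s) v = act sc S r v + act sc S s v" if "v \<in> V" for r s v using a that by simp
  show "act sc S (r * s) v = act sc S r (act sc S s v)" if "v \<in> V" for r s v using a that by simp
  show "act sc S 1 v = v" if "v \<in> V" for v using a that by simp
  show J: "act sc S r v = 0" if r: "r \<in> {r. f dvd r}" and v: "v \<in> V" for r v
  proof -
    obtain c where "r = c * f" using r by (auto simp: dvd_def mult.commute)
    then have "act sc S r v = act sc S c 0" using a(2)[OF v] fS[OF v] by simp
    also have "\<dots> = 0" using act_linear[OF V S subD(3)[OF V] subD(3)[OF V], of c] by simp
    finally show ?thesis .
  qed
  show inv: "\<exists>s. s * r - 1 \<in> {r. f dvd r}" if r: "r \<notin> {r. f dvd r}" for r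
  proof -
    obtain a b where ab: "a * f + b * r = 1" using irreducible_bezout[OF f, of r] r by auto
    have "b * r - 1 = (- a) * f" unfolding ab[symmetric] by simp
    then have "f dvd b * r - 1" by (metis dvd_triv_right)
    then show ?thesis by blast
  qed
  show "card (range (\<lambda>r. act sc S r v)) = CARD('a) ^ degree f" if v: "v \<in> V" "v \<noteq> 0" for v
  proof -
    have "range (\<lambda>r. act sc S r v) = (\<lambda>r. act sc S r v) ` {r. degree r < degree f}"
    proof (intro equalityI subsetI)
      fix y assume "y \<in> range (\<lambda>r. act sc S r v)"
      then obtain r where y: "y = act sc S r v" by blast
      have "act sc S r v = act sc S (r div f * f + r mod f) v" by simp
      also have "\<dots> = act sc S (r mod f) v" 
        by (subst act_add[OF V S v(1)]) (use J[of "r div f * f" v] v in simp)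
      finally have "y = act sc S (r mod f) v" using y by simp
      moreover have "degree (r mod f) < degree f" using d degree_mod_less[of f r] by (cases "f = 0") auto
      ultimately show "y \<in> (\<lambda>r. act sc S r v) ` {r. degree r < degree f}" by blast
    qed auto
    moreover have "inj_on (\<lambda>r. act sc S r v) {r. degree r < degree f}"
    proof (rule inj_onI)
      fix r s assume rs: "r \<in> {r. degree r < degree f}" "s \<in> {r. degree r < degree f}" "act sc S r v = act sc S s v"
      then have z: "act sc S (r - s) v = 0" using act_diff[OF V S v(1)] by simp
      have "f dvd r - s"
      proof (rule ccontr)
        assume "\<not> f dvd r - s"
        then obtain a b where ab: "a * f + b * (r - s) = 1" using irreducible_bezout[OF f] by blast
        have "v = act sc S (a * f + b * (r - s)) v" unfolding ab using a(3)[OF v(1)] by simp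
        also have "\<dots> = act sc S b (act sc S (r - s) v)"
          using J[of "a * f" v] v act_add[OF V S v(1)] act_mult[OF V S v(1)] by simp
        also have "\<dots> = 0" unfolding z using act_linear[OF V S subD(3)[OF V] subD(3)[OF V], of b] by simp
        finally show False using v by simp
      qed
      then show "r = s" using dvd_diff_imp_eq[of f r s] rs by simp
    qed
    ultimately show ?thesis using card_polys_degree_less(2)[OF d, where 'a='a] by (simp add: card_image)
  qed
  show "1 < CARD('a) ^ degree f" using one_less_power[OF Q_gt_1 d] by simp
qed

end

text \<open>Constants and X generate the polynomial ring, so linearity over it is linearity over the
  ground field plus compatibility with X. For S = T the right side is the centralizer of S; its
  bijective members in general conjugate S to T.\<close>

lemma lin_act_eq:
  assumes A: "fspace s1 X1" and B: "fspace s2 X2" and V: "kspace.sub s1 X1 V" and W: "kspace.sub s2 X2 W"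
    and S: "S \<in> lin s1 s1 V V" and T: "T \<in> lin s2 s2 W W"
  shows "lin (act s1 S) (act s2 T) V W = {f \<in> lin s1 s2 V W. \<forall>v\<in>V. f (S v) = T (f v)}"
proof -
  interpret A: fspace s1 X1 by fact
  interpret B: fspace s2 X2 by fact
  show ?thesis
  proof (intro equalityI subsetI)
    fix f assume f: "f \<in> lin (act s1 S) (act s2 T) V W"
    have "f \<in> lin s1 s2 V W"
    proof (rule linI)
      fix c v assume v: "v \<in> V"
      show "f (s1 c v) = s2 c (f v)"
        using lin_sc[OF f v, of "[:c:]"] A.act_const[OF V S v] B.act_const[OF W T lin_mem[OF f v]] by simp
    qed (use f in \<open>auto simp: lin_mem lin_add lin_ext\<close>)
    moreover have "f (S v) = T (f v)" if v: "v \<in> V" for v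
      using lin_sc[OF f v, of "[:0, 1:]"] A.act_X[OF V S v] B.act_X[OF W T lin_mem[OF f v]] by simp
    ultimately show "f \<in> {f \<in> lin s1 s2 V W. \<forall>v\<in>V. f (S v) = T (f v)}" by blast
  next
    fix f assume f: "f \<in> {f \<in> lin s1 s2 V W. \<forall>v\<in>V. f (S v) = T (f v)}"
    then show "f \<in> lin (act s1 S) (act s2 T) V W"
      using act_intertwine[OF A B V W S T, of f]
      by (intro linI) (auto simp: lin_mem lin_add lin_ext)
  qed
qed

section \<open>Irreducible factors of $x^t - 1$\<close>

definition monic_irreds :: "'a::field poly \<Rightarrow> 'a poly set" where
  "monic_irreds h = {f. irreducible f \<and> lead_coeff f = 1 \<and> f dvd h}"

definition xpow_1 :: "nat \<Rightarrow> 'a::field poly" where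
  "xpow_1 k = [:0, 1:] ^ k - 1"

lemma irreducible_dvd_mult:
  fixes f :: "'a::field poly"
  assumes "irreducible f" "f dvd a * b" "\<not> f dvd a"
  shows "f dvd b"
proof -
  obtain u v where uv: "u * f + v * a = 1" using irreducible_bezout[OF assms(1,3)] by blast
  have "b = (u * f + v * a) * b" unfolding uv by simp
  also have "\<dots> = u * b * f + v * (a * b)" by (simp add: algebra_simps)
  finally show ?thesis using assms(2) by (metis dvd_add dvd_mult dvd_refl)
qed

lemma irreducible_not_dvd_prod:
  fixes f :: "'a::field poly"
  assumes "irreducible f" "finite A" "\<And>a. a \<in> A \<Longrightarrow> \<not> f dvd g a"
  shows "\<not> f dvd (\<Prod>a\<in>A. g a)"
  using assms(2,3)
proof (induction A rule: finite_induct)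
  case empty
  then show ?case using assms(1) by (auto simp: irreducible_def)
next
  case (insert x F)
  then have "\<not> f dvd g x" "\<not> f dvd prod g F" by auto
  then show ?case unfolding prod.insert[OF insert(1,2)] using irreducible_dvd_mult[OF assms(1)] by blast
qed

lemma irreducible_degree_pos: "irreducible (f :: 'a::field poly) \<Longrightarrow> 0 < degree f"
  by (metis irreducible_def is_unit_iff_degree gr0I)

lemma finite_monic_irreds:
  fixes h :: "'a::{finite,field} poly"
  assumes "h \<noteq> 0"
  shows "finite (monic_irreds h)"
  by (rule finite_subset[OF _ card_polys_degree_less(1)[of "Suc (degree h)"]])
    (use assms in \<open>auto simp: monic_irreds_def less_Suc_eq_le intro: dvd_imp_degree_le\<close>)

lemma irreducible_smult:
  fixes f :: "'a::field poly"
  assumes "irreducible f" "c \<noteq> 0"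
  shows "irreducible (smult c f)"
proof (rule irreducibleI)
  show "smult c f \<noteq> 0" using assms by (auto simp: irreducible_def)
  show "\<not> smult c f dvd 1" using assms by (simp add: irreducible_def smult_dvd_iff)
  fix a b assume "smult c f = a * b"
  then have "f = smult (inverse c) (a * b)" using assms(2) by (metis left_inverse smult_1_left smult_smult)
  then have "f = smult (inverse c) a * b" by simp
  then have "smult (inverse c) a dvd 1 \<or> b dvd 1" using assms(1) by (metis irreducible_def)
  then show "a dvd 1 \<or> b dvd 1" using assms(2) by (simp add: smult_dvd_iff)
qed

lemma monic_irreds_nonempty:
  fixes h :: "'a::field poly"
  assumes "0 < degree h"
  shows "\<exists>f. f \<in> monic_irreds h"
  using assms
proof (induction "degree h" arbitrary: h rule: less_induct)
  case less
  have h0: "h \<noteq> 0" using less by auto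
  show ?case
  proof (cases "irreducible h")
    case True
    let ?f = "smult (inverse (lead_coeff h)) h"
    have "?f \<in> monic_irreds h"
      using irreducible_smult[OF True] h0 by (auto simp: monic_irreds_def smult_dvd_iff)
    then show ?thesis by blast
  next
    case False
    have "\<not> h dvd 1" using less(2) h0 by (simp add: is_unit_iff_degree)
    then obtain a b where ab: "h = a * b" "\<not> a dvd 1" "\<not> b dvd 1" using False h0 by (auto simp: irreducible_def)
    have nz: "a \<noteq> 0" "b \<noteq> 0" using ab h0 by auto
    have d: "0 < degree a" "0 < degree b" using ab nz by (auto simp: is_unit_iff_degree)
    then have "degree a < degree h" using ab nz by (simp add: degree_mult_eq)
    then obtain f where "f \<in> monic_irreds a" using less d by blast
    then have "f \<in> monic_irreds h" using ab by (auto simp: monic_irreds_def)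
    then show ?thesis by blast
  qed
qed

lemma monic_irreducible_dvd_eq:
  fixes f g :: "'a::field poly"
  assumes "irreducible f" "irreducible g" "lead_coeff f = 1" "lead_coeff g = 1" "f dvd g"
  shows "f = g"
proof -
  obtain c where c: "g = f * c" using assms(5) by blast
  have nz: "c \<noteq> 0" "f \<noteq> 0" using c assms by (auto simp: irreducible_def)
  have "c dvd 1" using assms(1,2) c by (metis irreducible_def)
  then have "degree c = 0" using nz by (simp add: is_unit_iff_degree)
  then obtain a where a: "c = [:a:]" by (rule degree_eq_zeroE)
  have "a = 1" using assms(3,4) c a nz by (simp add: lead_coeff_mult)
  then show ?thesis using c a by simp
qed

lemma monic_irreds_mult:
  fixes f g :: "'a::field poly"
  assumes "irreducible f" "lead_coeff f = 1" "\<not> f dvd g"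
  shows "monic_irreds (f * g) = insert f (monic_irreds g)" "f \<notin> monic_irreds g"
proof -
  show "monic_irreds (f * g) = insert f (monic_irreds g)"
  proof (intro equalityI subsetI)
    fix h assume h: "h \<in> monic_irreds (f * g)"
    then have "h dvd f \<or> h dvd g" using irreducible_dvd_mult[of h f g] by (auto simp: monic_irreds_def)
    then show "h \<in> insert f (monic_irreds g)"
      using h assms monic_irreducible_dvd_eq[of h f] by (auto simp: monic_irreds_def)
  qed (use assms in \<open>auto simp: monic_irreds_def\<close>)
  show "f \<notin> monic_irreds g" using assms by (simp add: monic_irreds_def)
qed

text \<open>One monic irreducible factor is split off at a time. Squarefreeness makes it coprime to
  the cofactor, which is what multiplicativity over coprime factors asks for. The two hypotheses on
  h form one conjunction so that the rule consumes a single fact.\<close>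

lemma squarefree_induct [consumes 1, case_names const mult]:
  fixes h :: "'a::field poly"
  assumes "h \<noteq> 0 \<and> (\<forall>f. irreducible f \<longrightarrow> \<not> f * f dvd h)"
    and const: "\<And>c. c \<noteq> 0 \<Longrightarrow> P [:c:]"
    and mult: "\<And>f g. irreducible f \<Longrightarrow> lead_coeff f = 1 \<Longrightarrow> \<not> f dvd g \<Longrightarrow> g \<noteq> 0 \<Longrightarrow> P g \<Longrightarrow> P (f * g)"
  shows "P h"
  using assms(1)
proof (induction "degree h" arbitrary: h rule: less_induct)
  case less
  have h0: "h \<noteq> 0" and sf: "\<And>f. irreducible f \<Longrightarrow> \<not> f * f dvd h" using less(2) by auto
  show ?case
  proof (cases "degree h = 0")
    case True
    then obtain c where "h = [:c:]" by (rule degree_eq_zeroE)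
    then show ?thesis using const h0 by auto
  next
    case False
    then obtain f where f: "irreducible f" "lead_coeff f = 1" "f dvd h"
      using monic_irreds_nonempty[of h] by (auto simp: monic_irreds_def)
    then obtain g where g: "h = f * g" by blast
    have nz: "f \<noteq> 0" "g \<noteq> 0" using g h0 by auto
    have nd: "\<not> f dvd g" using sf[OF f(1)] g by (auto simp: mult_dvd_mono)
    have "degree g < degree h" using g nz irreducible_degree_pos[OF f(1)] by (simp add: degree_mult_eq)
    moreover have "\<not> f' * f' dvd g" if "irreducible f'" for f' using sf[OF that] g by auto
    ultimately have "P g" using less(1) nz by blast
    then show ?thesis using mult f nd nz g by blast
  qed
qed

lemma monic_irreds_const: "c \<noteq> 0 \<Longrightarrow> monic_irreds [:c:] = {}"
proof -
  assume c: "c \<noteq> 0"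
  have "f dvd 1" if "f dvd [:c:]" for f using that c by (metis dvd_trans is_unit_const_poly_iff dvd_field_iff one_neq_zero)
  then show ?thesis by (auto simp: monic_irreds_def irreducible_def)
qed

lemma sum_degree_monic_irreds:
  fixes h :: "'a::{finite,field} poly"
  assumes "h \<noteq> 0 \<and> (\<forall>f. irreducible f \<longrightarrow> \<not> f * f dvd h)"
  shows "(\<Sum>f\<in>monic_irreds h. degree f) = degree h"
  using assms
proof (induction rule: squarefree_induct)
  case (const c)
  then show ?case by (simp add: monic_irreds_const)
next
  case (mult f g)
  have "f \<noteq> 0" using mult(1) by (simp add: irreducible_def)
  then show ?case
    using mult monic_irreds_mult[OF mult(1-3)] finite_monic_irreds[OF mult(4)]
    by (auto simp: degree_mult_eq)
qed

section \<open>Squarefreeness of x^t - 1; orders, degrees and number of its factors\<close>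

lemma coprime_CARD_of_nat:
  assumes "coprime t CARD('a::{finite,field})"
  shows "of_nat t \<noteq> (0 :: 'a)"
proof
  assume "of_nat t = (0 :: 'a)"
  then have "CHAR('a) dvd t" by (simp add: of_nat_eq_0_iff_char_dvd)
  then have "CHAR('a) dvd 1" using assms CHAR_dvd_CARD[where 'a='a] by (metis coprime_common_divisor_nat One_nat_def is_unit_gcd nat_dvd_1_iff_1)
  then show False by simp
qed

lemma xpow_1_nonzero: "0 < t \<Longrightarrow> xpow_1 t \<noteq> (0 :: 'a::field poly)"
proof
  assume "0 < t" "xpow_1 t = (0 :: 'a poly)"
  then have "poly (xpow_1 t) (0::'a) = 0" by simp
  then show False using \<open>0 < t\<close> by (simp add: xpow_1_def power_0_left)
qed

lemma degree_xpow_1: "degree (xpow_1 t :: 'a::field poly) = t"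
proof (cases "t = 0")
  case False
  have "degree ([:0, 1:] ^ t :: 'a poly) = t" by (simp add: degree_power_eq)
  then show ?thesis using False unfolding xpow_1_def
    by (subst degree_add_eq_left[of "- 1", simplified]) auto
qed (simp add: xpow_1_def)

text \<open>A double factor f divides the derivative, and X times the derivative is t X^t. As t is
  invertible in the field, f divides both X^t and X^t - 1, hence 1.\<close>

lemma xpow_1_squarefree:
  fixes f :: "'a::{finite,field} poly"
  assumes t: "coprime t CARD('a)" "0 < t" and f: "irreducible f"
  shows "\<not> f * f dvd xpow_1 t"
proof
  assume "f * f dvd xpow_1 t"
  then obtain c where c: "xpow_1 t = f * f * c" by blast
  have "f dvd pderiv (xpow_1 t)" unfolding c by (simp add: pderiv_mult)
  moreover obtain n where n: "t = Suc n" using t(2) by (cases t) auto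
  have "pderiv ([:0, 1:] ^ Suc n :: 'a poly) = smult (of_nat (Suc n)) ([:0, 1:] ^ n)"
    by (simp only: pderiv_power_Suc) (simp add: pderiv_pCons)
  then have "pderiv (xpow_1 t :: 'a poly) * [:0, 1:] = smult (of_nat t) ([:0, 1:] ^ t)"
    by (simp only: xpow_1_def n pderiv_diff pderiv_1 diff_0_right mult_smult_left power_Suc2)
  ultimately have "f dvd smult (of_nat t) ([:0, 1:] ^ t)" by (metis dvd_mult2)
  then have 1: "f dvd [:0, 1:] ^ t" using coprime_CARD_of_nat[OF t(1)] by (simp add: dvd_smult_iff)
  have "f dvd xpow_1 t" unfolding c by (simp add: mult.assoc)
  with 1 have "f dvd [:0, 1:] ^ t - xpow_1 t" by (rule dvd_diff)
  then have "f dvd 1" by (simp add: xpow_1_def)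
  then show False using f by (simp add: irreducible_def)
qed

text \<open>For d > 0 these are the f modulo which X has multiplicative order exactly d. If d is
  coprime to the characteristic, they are the monic irreducible factors of the d-th cyclotomic
  polynomial.\<close>

definition order_irreds :: "nat \<Rightarrow> 'a::field poly set" where
  "order_irreds d = {f. irreducible f \<and> lead_coeff f = 1 \<and> f dvd xpow_1 d \<and>
      (\<forall>k. 0 < k \<and> k < d \<longrightarrow> \<not> f dvd xpow_1 k)}"

lemma xpow_1_dvd: "xpow_1 d dvd (xpow_1 (d * s) :: 'a::field poly)"
  unfolding xpow_1_def power_mult using power_diff_1_eq[of "[:0, 1:] ^ d" s] by (metis dvd_triv_left)

lemma xpow_1_dvd': "d dvd k \<Longrightarrow> xpow_1 d dvd (xpow_1 k :: 'a::field poly)"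
  using xpow_1_dvd by (auto simp: dvd_def[of d])

text \<open>Division with remainder replaces the exponent k by k mod d, which lies below d and is
  therefore 0 by the minimality of d.\<close>

lemma order_irreds_dvd_iff:
  fixes f :: "'a::field poly"
  assumes f: "f \<in> order_irreds d" and d: "0 < d"
  shows "f dvd xpow_1 k \<longleftrightarrow> d dvd k"
proof
  assume "d dvd k"
  then show "f dvd xpow_1 k" using f xpow_1_dvd' by (auto simp: order_irreds_def intro: dvd_trans)
next
  assume k: "f dvd xpow_1 k"
  have "xpow_1 k = [:0, 1:] ^ (k mod d) * xpow_1 (d * (k div d)) + (xpow_1 (k mod d) :: 'a poly)"
    by (simp add: xpow_1_def algebra_simps flip: power_add)
  moreover have "f dvd xpow_1 (d * (k div d))"
    using f xpow_1_dvd by (auto simp: order_irreds_def intro: dvd_trans)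
  ultimately have "f dvd xpow_1 (k mod d)" using k by (metis dvd_add_right_iff dvd_mult)
  then have "k mod d = 0" using f d by (auto simp: order_irreds_def)
  then show "d dvd k" by auto
qed

text \<open>Each irreducible factor belongs to the class of its own order, the least positive k with
  f dividing x^k - 1, and that order divides t.\<close>

lemma monic_irreds_xpow_1:
  assumes "0 < t"
  shows "monic_irreds (xpow_1 t) = (\<Union>d\<in>{d. d dvd t}. order_irreds d :: 'a::field poly set)"
proof (intro equalityI subsetI)
  fix f :: "'a poly" assume "f \<in> monic_irreds (xpow_1 t)"
  then have f: "irreducible f" "lead_coeff f = 1" "f dvd xpow_1 t" by (auto simp: monic_irreds_def)
  define d where "d = (LEAST k. 0 < k \<and> f dvd xpow_1 k)"
  have d: "0 < d \<and> f dvd xpow_1 d" unfolding d_def by (rule LeastI[of _ t]) (use f assms in auto)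
  have "\<not> f dvd xpow_1 k" if "0 < k \<and> k < d" for k
    using not_less_Least[of k "\<lambda>k. 0 < k \<and> f dvd xpow_1 k"] that unfolding d_def[symmetric] by blast
  then have "f \<in> order_irreds d" using f d by (auto simp: order_irreds_def)
  moreover from this have "d dvd t" using order_irreds_dvd_iff d f by blast
  ultimately show "f \<in> (\<Union>d\<in>{d. d dvd t}. order_irreds d)" by blast
next
  fix f :: "'a poly" assume "f \<in> (\<Union>d\<in>{d. d dvd t}. order_irreds d)"
  then show "f \<in> monic_irreds (xpow_1 t)"
    using xpow_1_dvd' by (auto simp: order_irreds_def monic_irreds_def intro: dvd_trans)
qed

lemma order_irreds_disjoint:
  assumes "0 < d" "0 < d'" "f \<in> order_irreds d" "f \<in> order_irreds d'"
  shows "d = d'"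
  using assms order_irreds_dvd_iff[of f d d'] order_irreds_dvd_iff[of f d' d]
  by (auto simp: order_irreds_def intro: dvd_antisym)

text \<open>Multiplication by X permutes the nonzero remainders modulo f. Let P be the product of
  these N remainders; comparing products gives X^N P = P modulo f, and f does not divide P.\<close>

lemma fermat_irreducible:
  fixes f :: "'a::{finite,field} poly"
  assumes f: "irreducible f" and nx: "\<not> f dvd [:0, 1:]"
  shows "f dvd xpow_1 (CARD('a) ^ degree f - 1)"
proof -
  have d: "0 < degree f" using irreducible_degree_pos[OF f] .
  let ?R = "{r :: 'a poly. degree r < degree f} - {0}"
  let ?m = "\<lambda>r. ([:0, 1:] * r) mod f"
  note fin = card_polys_degree_less[OF d, where 'a='a]
  have nd: "\<not> f dvd r" if "r \<in> ?R" for r using that dvd_imp_degree_le[of f r] by auto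
  have nd2: "\<not> f dvd [:0, 1:] * r" if "r \<in> ?R" for r
    using irreducible_dvd_mult[OF f _ nx] nd[OF that] by blast
  have f0: "f \<noteq> 0" using d by auto
  have m: "?m r \<in> ?R" if "r \<in> ?R" for r
    using nd2[OF that] degree_mod_less[OF f0, of "[:0, 1:] * r"] d by (auto simp: dvd_eq_mod_eq_0)
  have inj: "inj_on ?m ?R"
  proof (rule inj_onI)
    fix r s assume rs: "r \<in> ?R" "s \<in> ?R" "?m r = ?m s"
    then have "f dvd [:0, 1:] * r - [:0, 1:] * s" by (simp only: mod_eq_dvd_iff)
    then have "f dvd [:0, 1:] * (r - s)" by (simp only: right_diff_distrib)
    then have "f dvd r - s" using irreducible_dvd_mult[OF f _ nx] by blast
    then show "r = s" using dvd_diff_imp_eq[of f r s] rs by simp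
  qed
  have img: "?m ` ?R = ?R" by (rule endo_inj_surj[OF _ image_subsetI[OF m] inj]) (use fin(1) in simp_all)
  have card: "card ?R = CARD('a) ^ degree f - 1" using fin d by (subst card_Diff_singleton) auto
  have "(\<Prod>r\<in>?R. [:0, 1:] * r) mod f = (\<Prod>r\<in>?R. ?m r) mod f" by (simp only: mod_prod_eq)
  also have "(\<Prod>r\<in>?R. ?m r) = (\<Prod>r\<in>?m ` ?R. r)" by (subst prod.reindex[OF inj]) simp
  also have "\<dots> = (\<Prod>r\<in>?R. r)" unfolding img ..
  finally have "f dvd (\<Prod>r\<in>?R. [:0, 1:] * r) - (\<Prod>r\<in>?R. r)" by (simp only: mod_eq_dvd_iff)
  also have "(\<Prod>r\<in>?R. [:0, 1:] * r) - (\<Prod>r\<in>?R. r) = (\<Prod>r\<in>?R. r) * xpow_1 (card ?R)"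
    by (simp only: prod.distrib prod_constant xpow_1_def) (simp add: algebra_simps)
  finally have 1: "f dvd (\<Prod>r\<in>?R. r) * xpow_1 (card ?R)" .
  have "\<not> f dvd (\<Prod>r\<in>?R. r)" by (rule irreducible_not_dvd_prod[OF f _ nd]) (use fin(1) in simp_all)
  then show ?thesis using irreducible_dvd_mult[OF f 1] card by simp
qed

lemma CARD_field_gt_1: "1 < CARD('a::{finite,field})"
  using card_mono[of UNIV "{0, 1 :: 'a}"] by simp

text \<open>The same permutation argument, for multiplication by c on the nonzero field
  elements.\<close>

lemma power_CARD_eq: "(c :: 'a::{finite,field}) ^ CARD('a) = c"
proof (cases "c = 0")
  case False
  have "inj_on (\<lambda>x. c * x) (UNIV - {0})" using False by (auto intro!: inj_onI)
  then have "(\<Prod>x\<in>UNIV - {0}. c * x) = (\<Prod>x\<in>(\<lambda>x. c * x) ` (UNIV - {0}). x)" by (subst prod.reindex) auto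
  also have "(\<lambda>x. c * x) ` (UNIV - {0}) = UNIV - {0}"
  proof (intro equalityI subsetI)
    fix y assume "y \<in> UNIV - {0 :: 'a}"
    then show "y \<in> (\<lambda>x. c * x) ` (UNIV - {0})" using False by (intro image_eqI[of _ _ "y / c"]) auto
  qed (use False in auto)
  finally have "c ^ card (UNIV - {0 :: 'a}) * (\<Prod>x\<in>UNIV - {0}. x) = (\<Prod>x\<in>UNIV - {0 :: 'a}. x)"
    by (simp add: prod.distrib)
  then have "c ^ (CARD('a) - 1) = 1" by (simp add: card_Diff_singleton)
  then show ?thesis by (metis finite_UNIV_card_ge_0 finite mult.right_neutral power_minus_mult mult.commute)
qed (simp add: finite_UNIV_card_ge_0)

text \<open>Over a field, a polynomial with more roots than its degree is 0. The field is the
  residue field modulo f, but it is not formed: coefficients and roots are representatives, A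
  contains at most one of each class, and being 0 means being divisible by f.\<close>

lemma roots_mod_irreducible:
  fixes f :: "'a::field poly" and P :: "'a poly poly"
  assumes f: "irreducible f"
  shows "finite A \<Longrightarrow> degree P < card A \<Longrightarrow> (\<And>a. a \<in> A \<Longrightarrow> f dvd poly P a) \<Longrightarrow>
    (\<And>a b. a \<in> A \<Longrightarrow> b \<in> A \<Longrightarrow> f dvd a - b \<Longrightarrow> a = b) \<Longrightarrow> f dvd coeff P i"
proof (induction "degree P" arbitrary: P A i)
  case 0
  obtain c where c: "P = [:c:]" using 0(1) by (metis degree_eq_zeroE)
  obtain a where "a \<in> A" using 0(3) by fastforce
  then have "f dvd c" using 0(4)[of a] c by simp
  then show ?case by (simp add: c coeff_pCons split: nat.split)
next
  case (Suc n)
  obtain a where a: "a \<in> A" using Suc(4) by fastforce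
  define R where "R = synthetic_div P a"
  have P: "[:- a, 1:] * R + [:poly P a:] = P" unfolding R_def by (rule synthetic_div_correct')
  have fa: "f dvd poly P a" by (rule Suc(5)[OF a])
  have R: "f dvd coeff R i" for i
  proof (rule Suc(1))
    show "n = degree R" using Suc(2) by (simp add: R_def degree_synthetic_div)
    then show "degree R < card (A - {a})" using Suc(2,3,4) a by simp
    show "finite (A - {a})" using Suc(3) by simp
    fix b assume b: "b \<in> A - {a}"
    have "poly P b = (b - a) * poly R b + poly P a" by (subst P[symmetric]) (simp add: algebra_simps)
    then have "(b - a) * poly R b = poly P b - poly P a" by simp
    then have "f dvd (b - a) * poly R b" using dvd_diff[OF Suc(5) fa, of b] b by simp
    moreover have "\<not> f dvd b - a" using Suc(6)[of b a] a b by blast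
    ultimately show "f dvd poly R b" using irreducible_dvd_mult[OF f] by blast
  next
    fix b c assume "b \<in> A - {a}" "c \<in> A - {a}" "f dvd b - c"
    then show "b = c" using Suc(6) by blast
  qed
  have "coeff P i = coeff ([:- a, 1:] * R) i + coeff [:poly P a:] i" by (subst P[symmetric]) (rule coeff_add)
  also have "coeff ([:- a, 1:] * R) i = - a * coeff R i + coeff (pCons 0 R) i" by simp
  finally show ?case using R fa by (auto simp: coeff_pCons split: nat.split)
qed

text \<open>If raising to the power q^j fixes X modulo f, it fixes every polynomial modulo f,
  because it is additive and fixes the constants. All q^(degree f) remainders are then roots of
  Y^(q^j) - Y, which has at most q^j roots.\<close>

lemma degree_le_of_frobenius:
  fixes f :: "'a::{finite,field} poly"
  assumes f: "irreducible f" and q: "CARD('a) = CHAR('a) ^ k" and j: "0 < j"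
    and dvd: "f dvd [:0, 1:] ^ (CARD('a) ^ j) - [:0, 1:]"
  shows "degree f \<le> j"
proof (rule ccontr)
  assume less: "\<not> degree f \<le> j"
  let ?N = "CARD('a) ^ j"
  have d: "0 < degree f" using irreducible_degree_pos[OF f] .
  have q1: "1 < CARD('a)" using CARD_field_gt_1 by blast
  have N1: "1 < ?N" using one_less_power[OF q1 j] .
  have "CHAR('a) \<noteq> 0" using finite_imp_CHAR_pos[where 'a='a] by simp
  then have pr: "prime CHAR('a poly)" using prime_CHAR_semidom[where 'a='a] by simp
  have frob: "(y + z) ^ ?N = y ^ ?N + z ^ ?N" for y z :: "'a poly"
    by (rule freshmans_dream'[OF pr, of _ "k * j"]) (simp add: q power_mult)
  have cN: "(c :: 'a) ^ (CARD('a) ^ i) = c" for c i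
    by (induction i) (simp_all add: power_CARD_eq power_mult)
  have gN: "f dvd g ^ ?N - g" for g
  proof (induction g)
    case 0
    have "(0 :: 'a poly) ^ ?N = 0" using N1 by (intro zero_power) simp
    then show ?case by (simp only: diff_self dvd_0_right)
  next
    case (pCons c g)
    have e: "pCons c g = [:c:] + [:0, 1:] * g" by simp
    have "[:c:] ^ ?N = [:c:]" using cN[of c j] by (simp add: poly_const_pow)
    then have "pCons c g ^ ?N - pCons c g = [:0, 1:] ^ ?N * g ^ ?N - [:0, 1:] * g"
      unfolding e frob power_mult_distrib by simp
    also have "\<dots> = ([:0, 1:] ^ ?N - [:0, 1:]) * g ^ ?N + [:0, 1:] * (g ^ ?N - g)"
      by (simp only: algebra_simps)
    finally show ?case using dvd pCons.IH by (metis dvd_add dvd_mult dvd_mult2)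
  qed
  let ?A = "{r :: 'a poly. degree r < degree f}"
  \<comment> \<open>Here \<open>[:0, 1:]\<close> is the variable Y over the ring of polynomials in
    X, not X itself. The leading coefficient is 1 because \<open>?N\<close> exceeds 1.\<close>
  let ?P = "monom 1 ?N - [:0, 1:] :: 'a poly poly"
  have degP: "degree ?P \<le> ?N"
    using N1 by (intro degree_diff_le degree_monom_le) auto
  have "f dvd coeff ?P ?N"
  proof (rule roots_mod_irreducible[OF f])
    show "finite ?A" using card_polys_degree_less(1)[OF d] .
    have "?N < CARD('a) ^ degree f" using less q1 by (intro power_strict_increasing) auto
    then show "degree ?P < card ?A" using degP card_polys_degree_less(2)[OF d, where 'a='a] by simp
    show "f dvd poly ?P a" for a using gN[of a] by (simp add: poly_monom)
    fix r s assume rs: "r \<in> ?A" "s \<in> ?A" "f dvd r - s"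
    then show "r = s" using dvd_diff_imp_eq[of f r s] by simp
  qed
  moreover have "coeff ([:0, 1:] :: 'a poly poly) ?N = 0" using N1 by (intro coeff_eq_0) simp
  then have "coeff ?P ?N = 1" by (simp only: coeff_diff coeff_monom) simp
  ultimately show False using f by (simp add: irreducible_def)
qed

text \<open>Both bounds use \<open>order_irreds_dvd_iff\<close> at exponents of the form q^i - 1.
  For i = \<open>degree f\<close>, Fermat shows that the order of q divides the degree; for i =
  \<open>ord d q\<close>, Frobenius shows that the degree is at most this order.\<close>

lemma degree_order_irreds:
  fixes f :: "'a::{finite,field} poly"
  assumes f: "f \<in> order_irreds d" and d: "0 < d" "coprime d CARD('a)" and q: "CARD('a) = CHAR('a) ^ k"
  shows "degree f = ord d CARD('a)"
proof -
  have irr: "irreducible f" and fd: "f dvd xpow_1 d" using f by (auto simp: order_irreds_def)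
  have q1: "1 < CARD('a)" using CARD_field_gt_1 by blast
  have nx: "\<not> f dvd [:0, 1:]"
  proof
    assume "f dvd [:0, 1:]"
    then have "f dvd [:0, 1:] ^ d" using d(1) by (metis dvd_power dvd_trans)
    then have "f dvd [:0, 1:] ^ d - xpow_1 d" using fd by (rule dvd_diff)
    then have "f dvd 1" by (simp add: xpow_1_def)
    then show False using irr by (simp add: irreducible_def)
  qed
  have cong: "[CARD('a) ^ i = 1] (mod d) \<longleftrightarrow> d dvd CARD('a) ^ i - 1" for i
    using cong_altdef_nat[of 1 "CARD('a) ^ i" d] q1 by simp
  have "d dvd CARD('a) ^ degree f - 1"
    using fermat_irreducible[OF irr nx] order_irreds_dvd_iff[OF f d(1)] by blast
  then have 1: "ord d CARD('a) dvd degree f" using cong ord_divides by blast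
  let ?j = "ord d CARD('a)"
  have j: "0 < ?j" using d(2) by (simp add: coprime_commute ord_eq_0)
  have "d dvd CARD('a) ^ ?j - 1" using cong ord by blast
  then have "f dvd xpow_1 (CARD('a) ^ ?j - 1)" using order_irreds_dvd_iff[OF f d(1)] by blast
  then have "f dvd [:0, 1:] * xpow_1 (CARD('a) ^ ?j - 1)" by (rule dvd_mult)
  also have "[:0, 1:] * xpow_1 (CARD('a) ^ ?j - 1) = [:0, 1:] ^ (CARD('a) ^ ?j) - ([:0, 1:] :: 'a poly)"
  proof -
    have "CARD('a) ^ ?j = Suc (CARD('a) ^ ?j - 1)" using q1 by simp
    then show ?thesis by (metis (no_types, lifting) xpow_1_def power_Suc right_diff_distrib mult.right_neutral)
  qed
  finally have "degree f \<le> ?j" using degree_le_of_frobenius[OF irr q j] by blast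
  moreover have "?j \<le> degree f" using 1 irreducible_degree_pos[OF irr] dvd_imp_le by blast
  ultimately show ?thesis by simp
qed

lemma finite_order_irreds: "0 < d \<Longrightarrow> finite (order_irreds d :: 'a::{finite,field} poly set)"
  by (rule finite_subset[OF _ finite_monic_irreds[OF xpow_1_nonzero]])
    (auto simp: order_irreds_def monic_irreds_def)

text \<open>Summed over the divisors of d, both sides give d: the left one as the degree of the
  squarefree polynomial x^d - 1, the right one by Gauss's identity. The induction hypothesis cancels
  the proper divisors.\<close>

lemma card_order_irreds:
  assumes q: "CARD('a::{finite,field}) = CHAR('a) ^ k"
  shows "0 < d \<Longrightarrow> coprime d CARD('a) \<Longrightarrow> card (order_irreds d :: 'a poly set) * ord d CARD('a) = totient d"
proof (induction d rule: less_induct)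
  case (less d)
  let ?O = "\<lambda>d. order_irreds d :: 'a poly set"
  have pos: "0 < d'" "coprime d' CARD('a)" if "d' dvd d" for d'
    using dvd_pos_nat[OF less(2) that] coprime_divisors[OF that dvd_refl less(3)] by auto
  have fin: "finite {d'. d' dvd d}" using less(2) by simp
  have "d = (\<Sum>f\<in>monic_irreds (xpow_1 d :: 'a poly). degree f)"
    by (subst sum_degree_monic_irreds)
      (use xpow_1_nonzero[OF less(2)] xpow_1_squarefree[OF less(3,2)] in \<open>auto simp: degree_xpow_1\<close>)
  also have "\<dots> = (\<Sum>d' | d' dvd d. \<Sum>f\<in>?O d'. degree f)"
    unfolding monic_irreds_xpow_1[OF less(2)]
    by (rule sum.UNION_disjoint) (use fin pos finite_order_irreds order_irreds_disjoint in blast)+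
  also have "\<dots> = (\<Sum>d' | d' dvd d. card (?O d') * ord d' CARD('a))"
    using pos degree_order_irreds[OF _ _ _ q] by (intro sum.cong refl) simp
  finally have "(\<Sum>d' | d' dvd d. card (?O d') * ord d' CARD('a)) = (\<Sum>d' | d' dvd d. totient d')"
    by (simp add: totient_divisor_sum)
  moreover have "{d'. d' dvd d} = insert d ({d'. d' dvd d} - {d})" by auto
  moreover have "(\<Sum>d'\<in>{d'. d' dvd d} - {d}. card (?O d') * ord d' CARD('a)) = (\<Sum>d'\<in>{d'. d' dvd d} - {d}. totient d')"
  proof (rule sum.cong[OF refl])
    fix d' assume "d' \<in> {d'. d' dvd d} - {d}"
    then have "d' dvd d" "d' < d" using less(2) by (auto dest: dvd_imp_le simp: le_neq_implies_less)
    then show "card (?O d') * ord d' CARD('a) = totient d'" using less(1) pos by blast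
  qed
  ultimately show ?case using fin by (metis (no_types, lifting) Diff_iff add_right_cancel finite_Diff insertI1 sum.insert)
qed

text \<open>The factors are grouped by the order d of X. The division in the exponent is exact by
  \<open>card_order_irreds\<close>, since the order of q modulo d is positive.\<close>

theorem prod_monic_irreds_xpow_1:
  fixes F :: "nat \<Rightarrow> 'c::comm_monoid_mult"
  assumes q: "CARD('a::{finite,field}) = CHAR('a) ^ k" and t: "0 < t" "coprime t CARD('a)"
  shows "(\<Prod>f\<in>monic_irreds (xpow_1 t :: 'a poly). F (degree f)) =
    (\<Prod>d | d dvd t. F (ord d CARD('a)) ^ (totient d div ord d CARD('a)))"
proof -
  let ?O = "\<lambda>d. order_irreds d :: 'a poly set"
  have pos: "0 < d" "coprime d CARD('a)" if "d dvd t" for d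
    using dvd_pos_nat[OF t(1) that] coprime_divisors[OF that dvd_refl t(2)] by auto
  have fin: "finite {d. d dvd t}" using t by simp
  have "(\<Prod>f\<in>monic_irreds (xpow_1 t :: 'a poly). F (degree f)) = (\<Prod>d | d dvd t. \<Prod>f\<in>?O d. F (degree f))"
    unfolding monic_irreds_xpow_1[OF t(1)]
    by (rule prod.UNION_disjoint) (use fin pos finite_order_irreds order_irreds_disjoint in blast)+
  also have "\<dots> = (\<Prod>d | d dvd t. F (ord d CARD('a)) ^ (totient d div ord d CARD('a)))"
  proof (rule prod.cong[OF refl])
    fix d assume "d \<in> {d. d dvd t}"
    then have d: "0 < d" "coprime d CARD('a)" using pos by auto
    have "0 < ord d CARD('a)" using d(2) by (simp add: coprime_commute ord_eq_0)
    then have "card (?O d) = totient d div ord d CARD('a)" using card_order_irreds[OF q d] by (metis nonzero_mult_div_cancel_right not_gr0)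
    moreover have "(\<Prod>f\<in>?O d. F (degree f)) = (\<Prod>f\<in>?O d. F (ord d CARD('a)))"
      using degree_order_irreds[OF _ d q] by (intro prod.cong refl) simp
    ultimately show "(\<Prod>f\<in>?O d. F (degree f)) = F (ord d CARD('a)) ^ (totient d div ord d CARD('a))" by simp
  qed
  finally show ?thesis .
qed

section \<open>Multiplicativity over coprime factors\<close>

context fspace
begin

definition pairs :: "'a poly \<Rightarrow> nat \<Rightarrow> 'v set \<Rightarrow> (('v \<Rightarrow> 'v) \<times> ('v \<Rightarrow> 'v)) set" where
  "pairs f B V = {(S, N). S \<in> End V \<and> N \<in> End V \<and> (\<forall>v\<in>V. act sc S f v = 0) \<and>
     (\<forall>v\<in>V. (N ^^ B) v = 0) \<and> (\<forall>v\<in>V. N (S v) = S (N v))}"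

text \<open>The numbers of pairs divided by the orders of GL_n are the coefficients of G. As a
  predicate it has rules for constants, for irreducible polynomials and for coprime products, which
  are combined along \<open>squarefree_induct\<close>.\<close>

definition pairs_series :: "'a poly \<Rightarrow> nat \<Rightarrow> real fps \<Rightarrow> bool" where
  "pairs_series f B G \<longleftrightarrow> (\<forall>V n. sub V \<longrightarrow> card V = CARD('a) ^ n \<longrightarrow>
     real (card (pairs f B V)) = gl CARD('a) n * fps_nth G n)"

lemma finite_End: "sub V \<Longrightarrow> finite (End V)"
  by (rule finite_lin[OF subD(2) subD(2)])

lemma finite_pairs: "sub V \<Longrightarrow> finite (pairs f B V)"
  by (rule finite_subset[of _ "End V \<times> End V"]) (auto simp: pairs_def finite_End)

text \<open>A nonzero constant annihilates only the zero space, and there the only pair consists of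
  two zero maps.\<close>

lemma pairs_series_const:
  assumes "c \<noteq> 0"
  shows "pairs_series [:c:] B 1"
  unfolding pairs_series_def
proof (intro allI impI)
  fix V n assume V: "sub V" and n: "card V = CARD('a) ^ n"
  show "real (card (pairs [:c:] B V)) = gl CARD('a) n * fps_nth 1 n"
  proof (cases "n = 0")
    case True
    then have V0: "V = {0}" using n card_1_imp_zero[OF V] by simp
    have z: "((\<lambda>v\<in>{0 :: 'v}. 0 :: 'v) ^^ B) 0 = 0" by (induction B) auto
    have "pairs [:c:] B V = {(\<lambda>v\<in>{0}. 0, \<lambda>v\<in>{0}. 0)}"
      using lin_zero_space z sub_zero zero_X unfolding V0 pairs_def by (auto simp: act_def)
    then show ?thesis using True by (simp add: gl_def)
  next
    case False
    have "V \<noteq> {0}" using n False one_less_power[OF Q_gt_1, of n] by auto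
    then obtain v where v: "v \<in> V" "v \<noteq> 0" using subD(3)[OF V] by blast
    then have vX: "v \<in> X" using subD(8)[OF V] by blast
    have "pairs [:c:] B V = {}"
    proof (rule equals0I)
      fix x assume "x \<in> pairs [:c:] B V"
      then obtain S where "S \<in> End V" "act sc S [:c:] v = 0" using v by (auto simp: pairs_def)
      then have "sc c v = 0" using act_const[OF V _ v(1)] by simp
      then show False using sc_eq_0_J[OF vX v(2)] assms by blast
    qed
    then show ?thesis using False by simp
  qed
qed

lemma restrict_End:
  assumes "S \<in> End V" "sub W" "W \<subseteq> V" "\<And>w. w \<in> W \<Longrightarrow> S w \<in> W"
  shows "restrict S W \<in> End W"
  by (rule linI) (use assms subD(4,5)[OF assms(2)] lin_add[OF assms(1)] lin_sc[OF assms(1)] in \<open>auto simp: subset_iff\<close>)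

lemma act_restrict:
  assumes "\<And>w. w \<in> W \<Longrightarrow> S w \<in> W" "v \<in> W"
  shows "act sc (restrict S W) p v = act sc S p v"
  unfolding act_def using funpow_restrict[of W S v] assms by simp

lemma sub_kernel:
  assumes V: "sub V" and S: "S \<in> End V"
  shows "sub {v \<in> V. act sc S g v = 0}"
proof -
  have "act sc S g (sc r v) = 0" if v: "v \<in> V" "act sc S g v = 0" for r v
  proof -
    have "act sc S g (sc r v) = act sc S (g * [:r:]) v" by (simp only: act_mult[OF V S v(1)] act_const[OF V S v(1)])
    also have "\<dots> = act sc S ([:r:] * g) v" by (simp only: mult.commute)
    also have "\<dots> = sc r (act sc S g v)" 
      by (simp only: act_mult[OF V S v(1)] act_const[OF V S act_mem[OF V S v(1)]])
    finally show ?thesis using v by simp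
  qed
  moreover have "act sc S g 0 = 0" using act_linear[OF V S subD(3)[OF V] subD(3)[OF V], of g] by simp
  ultimately show ?thesis using subD[OF V] act_linear[OF V S] unfolding sub_def by auto
qed

lemma glue_End:
  assumes V1: "sub V1" and V2: "sub V2" and int: "V1 \<inter> V2 = {0}" and V: "ssum V1 V2 = V"
    and S1: "S1 \<in> End V1" and S2: "S2 \<in> End V2"
  shows "\<exists>S\<in>End V. restrict S V1 = S1 \<and> restrict S V2 = S2"
proof -
  have sV: "sub V" using sub_ssum[OF V1 V2] V by simp
  have "\<forall>v\<in>V. \<exists>u. u \<in> V1 \<and> v - u \<in> V2" unfolding V[symmetric] by (force simp: ssum_def)
  \<comment> \<open>A choice of the component in V1; \<open>pu\<close> shows that it is unique
    because V1 and V2 meet only in 0.\<close>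
  then obtain p where p: "\<And>v. v \<in> V \<Longrightarrow> p v \<in> V1" "\<And>v. v \<in> V \<Longrightarrow> v - p v \<in> V2" by metis
  have sum_mem: "u + w \<in> V" if "u \<in> V1" "w \<in> V2" for u w
    unfolding V[symmetric] ssum_def using that by auto
  have pu: "p (u + w) = u" if uw: "u \<in> V1" "w \<in> V2" for u w
  proof -
    have m: "u + w \<in> V" by (rule sum_mem[OF uw])
    have "p (u + w) - u = w - (u + w - p (u + w))" by simp
    then have "p (u + w) - u \<in> V1 \<inter> V2"
      using subD(7)[OF V1 p(1)[OF m] uw(1)] subD(7)[OF V2 uw(2) p(2)[OF m]] by simp
    then show ?thesis using int by simp
  qed
  define S where "S = (\<lambda>v\<in>V. S1 (p v) + S2 (v - p v))"
  have S: "S (u + w) = S1 u + S2 w" if "u \<in> V1" "w \<in> V2" for u w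
    using sum_mem[OF that] pu[OF that] by (simp add: S_def)
  have dec: "\<exists>u w. u \<in> V1 \<and> w \<in> V2 \<and> v = u + w" if "v \<in> V" for v
    using that unfolding V[symmetric] by (auto simp: ssum_def)
  have z: "S1 0 = 0" "S2 0 = 0" using kpair.lin_zero[OF self_pair V1 S1] kpair.lin_zero[OF self_pair V2 S2] by auto
  have "S \<in> End V"
  proof (rule linI)
    show "S \<in> extensional V" by (simp add: S_def)
  next
    fix v assume "v \<in> V"
    then obtain u w where "u \<in> V1" "w \<in> V2" "v = u + w" using dec by blast
    then show "S v \<in> V" using S sum_mem lin_mem[OF S1] lin_mem[OF S2] by simp
  next
    fix v v' assume "v \<in> V" "v' \<in> V"
    then obtain u w u' w' where *: "u \<in> V1" "w \<in> V2" "v = u + w" "u' \<in> V1" "w' \<in> V2" "v' = u' + w'"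
      using dec by metis
    have e: "v + v' = (u + u') + (w + w')" using * by (simp add: algebra_simps)
    show "S (v + v') = S v + S v'" unfolding e
      using S[of "u + u'" "w + w'"] S[of u w] S[of u' w'] * subD(4)[OF V1] subD(4)[OF V2] lin_add[OF S1] lin_add[OF S2]
      by (simp add: algebra_simps)
  next
    fix r v assume "v \<in> V"
    then obtain u w where *: "u \<in> V1" "w \<in> V2" "v = u + w" using dec by blast
    have X: "u \<in> X" "w \<in> X" "S1 u \<in> X" "S2 w \<in> X" using * subD(8)[OF V1] subD(8)[OF V2] lin_mem[OF S1] lin_mem[OF S2] by auto
    have e: "sc r v = sc r u + sc r w" using * X by (simp add: sc_add_right)
    show "S (sc r v) = sc r (S v)" unfolding e
      using S[of "sc r u" "sc r w"] S[of u w] * X subD(5)[OF V1] subD(5)[OF V2] lin_sc[OF S1] lin_sc[OF S2]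
      by (simp add: sc_add_right)
  qed
  moreover have "restrict S V1 = S1"
    using S[of _ 0] subD(3)[OF V2] z lin_ext[OF S1] by (auto simp: fun_eq_iff extensional_def)
  moreover have "restrict S V2 = S2"
    using S[of 0] subD(3)[OF V1] z lin_ext[OF S2] by (auto simp: fun_eq_iff extensional_def)
  ultimately show ?thesis by blast
qed

text \<open>v is the sum of (a g)(S) v and (b h)(S) v. The former is killed by h(S) and the latter
  by g(S), so the summands lie in the two kernels in the opposite order.\<close>

lemma kernel_decomposition:
  assumes V: "sub V" and S: "S \<in> End V" and ab: "a * g + b * h = 1"
    and gh: "\<And>v. v \<in> V \<Longrightarrow> act sc S (g * h) v = 0"
  shows "{v \<in> V. act sc S g v = 0} \<inter> {v \<in> V. act sc S h v = 0} = {0}"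
    "ssum {v \<in> V. act sc S g v = 0} {v \<in> V. act sc S h v = 0} = V"
proof -
  let ?V1 = "{v \<in> V. act sc S g v = 0}" and ?V2 = "{v \<in> V. act sc S h v = 0}"
  have split: "v = act sc S (a * g) v + act sc S (b * h) v" if "v \<in> V" for v
    using act_add[OF V S that, of "a * g" "b * h"] act_1[OF V that] ab by simp
  have z: "act sc S p 0 = 0" for p using act_linear[OF V S subD(3)[OF V] subD(3)[OF V], of p] by simp
  show "?V1 \<inter> ?V2 = {0}"
  proof (intro equalityI subsetI)
    fix v assume "v \<in> ?V1 \<inter> ?V2"
    then show "v \<in> {0}" using split[of v] by (simp add: act_mult[OF V S] z)
  qed (use z subD(3)[OF V] in auto)
  show "ssum ?V1 ?V2 = V"
  proof (intro equalityI subsetI)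
    fix v assume v: "v \<in> V"
    have "act sc S h (act sc S (a * g) v) = act sc S a (act sc S (g * h) v)"
      unfolding act_mult[OF V S v, symmetric] by (simp add: mult_ac)
    then have 2: "act sc S (a * g) v \<in> ?V2" using gh[OF v] z act_mem[OF V S v] by simp
    have "act sc S g (act sc S (b * h) v) = act sc S b (act sc S (g * h) v)"
      unfolding act_mult[OF V S v, symmetric] by (simp add: mult_ac)
    then have 1: "act sc S (b * h) v \<in> ?V1" using gh[OF v] z act_mem[OF V S v] by simp
    show "v \<in> ssum ?V1 ?V2" unfolding ssum_def
      by (rule image_eqI[of _ _ "(act sc S (b * h) v, act sc S (a * g) v)"])
        (use split[OF v] 1 2 in \<open>simp_all add: add.commute\<close>)
  next
    fix v assume "v \<in> ssum ?V1 ?V2"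
    then show "v \<in> V" using subD(4)[OF V] by (auto simp: ssum_def)
  qed
qed

definition fibre where
  "fibre g h B V V1 V2 = {(S, N) \<in> pairs (g * h) B V.
     {v \<in> V. act sc S g v = 0} = V1 \<and> {v \<in> V. act sc S h v = 0} = V2}"

lemma funpow_linear:
  assumes "sub V" "N \<in> End V" "v \<in> V" "w \<in> V"
  shows "(N ^^ k) (v + w) = (N ^^ k) v + (N ^^ k) w"
  using act_linear[OF assms, of "monom 1 k"] act_monom[OF assms(1,2)] assms(3,4) subD(4)[OF assms(1)] by simp

lemma pairsD:
  assumes "(S, N) \<in> pairs f B V"
  shows "S \<in> End V" "N \<in> End V" "\<And>v. v \<in> V \<Longrightarrow> act sc S f v = 0" "\<And>v. v \<in> V \<Longrightarrow> (N ^^ B) v = 0"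
    "\<And>v. v \<in> V \<Longrightarrow> N (S v) = S (N v)"
  using assms by (auto simp: pairs_def)

text \<open>The kernel of g(S) is invariant under every endomorphism that commutes with S, hence
  under S and N.\<close>

lemma restrict_pair:
  assumes V: "sub V" and p: "(S, N) \<in> pairs f B V" and W: "W = {v \<in> V. act sc S g v = 0}"
  shows "(restrict S W, restrict N W) \<in> pairs g B W"
proof -
  note P = pairsD[OF p]
  have sW: "sub W" unfolding W by (rule sub_kernel[OF V P(1)])
  have z: "act sc S g 0 = 0" using act_linear[OF V P(1) subD(3)[OF V] subD(3)[OF V], of g] by simp
  have z1: "S 0 = 0" "N 0 = 0" using kpair.lin_zero[OF self_pair V P(1)] kpair.lin_zero[OF self_pair V P(2)] by auto
  have S: "S w \<in> W" if "w \<in> W" for w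
    using that act_commute[OF V P(1,1), of w g] lin_mem[OF P(1)] z1 unfolding W by auto
  have N: "N w \<in> W" if "w \<in> W" for w
    using that act_commute[OF V P(1,2), of w g] lin_mem[OF P(2)] P(5) z1 unfolding W by auto
  have WV: "W \<subseteq> V" unfolding W by auto
  show ?thesis unfolding pairs_def
    using restrict_End[OF P(1) sW WV S] restrict_End[OF P(2) sW WV N] act_restrict[OF S] funpow_restrict[OF N]
      P(4,5) S N WV by (auto simp: W)
qed

text \<open>Restriction to V1 and V2 is inverse to gluing. The delicate point is that the kernels
  belonging to the glued S are no larger than V1 and V2.\<close>

lemma card_fibre:
  assumes V: "sub V" and ab: "a * g + b * h = 1" and V1: "sub V1" and V2: "sub V2"
    and int: "V1 \<inter> V2 = {0}" and sum: "ssum V1 V2 = V"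
  shows "card (fibre g h B V V1 V2) = card (pairs g B V1) * card (pairs h B V2)"
proof -
  let ?r = "\<lambda>(S, N). ((restrict S V1, restrict N V1), (restrict S V2, restrict N V2))"
  have dec: "\<exists>u w. u \<in> V1 \<and> w \<in> V2 \<and> v = u + w" if "v \<in> V" for v
    using that unfolding sum[symmetric] by (auto simp: ssum_def)
  have sub1: "V1 \<subseteq> V" unfolding sum[symmetric] ssum_def
    by (rule subsetI, rule image_eqI[of _ _ "(_, 0)"]) (auto simp: subD(3)[OF V2])
  have sub2: "V2 \<subseteq> V" unfolding sum[symmetric] ssum_def
    by (rule subsetI, rule image_eqI[of _ _ "(0, _)"]) (auto simp: subD(3)[OF V1])
  have ext: "S = S'" if S: "S \<in> End V" "S' \<in> End V" and e: "restrict S V1 = restrict S' V1" "restrict S V2 = restrict S' V2" for S S'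
  proof (rule lin_eqI[OF S])
    fix v assume "v \<in> V"
    then obtain u w where *: "u \<in> V1" "w \<in> V2" "v = u + w" using dec by blast
    have "S u = S' u" "S w = S' w" using e * by (metis restrict_apply')+
    have "u \<in> V" "w \<in> V" using * sub1 sub2 by auto
    then show "S v = S' v"
      using \<open>S u = S' u\<close> \<open>S w = S' w\<close> lin_add[OF S(1), of u w] lin_add[OF S(2), of u w] *(3) by simp
  qed
  have "bij_betw ?r (fibre g h B V V1 V2) (pairs g B V1 \<times> pairs h B V2)"
    unfolding bij_betw_def
  proof (intro conjI)
    show "inj_on ?r (fibre g h B V V1 V2)"
      by (rule inj_onI) (auto simp: fibre_def pairs_def intro: ext)
    show "?r ` fibre g h B V V1 V2 = pairs g B V1 \<times> pairs h B V2"
    proof (intro equalityI subsetI)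
      fix y assume "y \<in> ?r ` fibre g h B V V1 V2"
      then obtain S N where y: "y = ?r (S, N)" and p: "(S, N) \<in> pairs (g * h) B V"
        and k: "V1 = {v \<in> V. act sc S g v = 0}" "V2 = {v \<in> V. act sc S h v = 0}"
        unfolding fibre_def by blast
      show "y \<in> pairs g B V1 \<times> pairs h B V2"
        unfolding y using restrict_pair[OF V p k(1)] restrict_pair[OF V p k(2)] by simp
    next
      fix y assume "y \<in> pairs g B V1 \<times> pairs h B V2"
      then obtain S1 N1 S2 N2 where y: "y = ((S1, N1), (S2, N2))" and p1: "(S1, N1) \<in> pairs g B V1"
        and p2: "(S2, N2) \<in> pairs h B V2" by auto
      note P1 = pairsD[OF p1] and P2 = pairsD[OF p2]
      obtain S where S: "S \<in> End V" "restrict S V1 = S1" "restrict S V2 = S2"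
        using glue_End[OF V1 V2 int sum P1(1) P2(1)] by blast
      obtain N where N: "N \<in> End V" "restrict N V1 = N1" "restrict N V2 = N2"
        using glue_End[OF V1 V2 int sum P1(2) P2(2)] by blast
      have S1: "S v = S1 v" "N v = N1 v" if "v \<in> V1" for v using that S(2) N(2) by auto
      have S2: "S v = S2 v" "N v = N2 v" if "v \<in> V2" for v using that S(3) N(3) by auto
      have m1: "S v \<in> V1" "N v \<in> V1" if "v \<in> V1" for v using S1[OF that] lin_mem[OF P1(1) that] lin_mem[OF P1(2) that] by auto
      have m2: "S v \<in> V2" "N v \<in> V2" if "v \<in> V2" for v using S2[OF that] lin_mem[OF P2(1) that] lin_mem[OF P2(2) that] by auto
      have a1: "act sc S p v = act sc S1 p v" if "v \<in> V1" for v p using act_restrict[of V1 S v p] m1 that S(2) by simp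
      have a2: "act sc S p v = act sc S2 p v" if "v \<in> V2" for v p using act_restrict[of V2 S v p] m2 that S(3) by simp
      have f1: "(N ^^ B) v = 0" if "v \<in> V1" for v using funpow_restrict[of V1 N v B] m1 that N(2) P1(4) by simp
      have f2: "(N ^^ B) v = 0" if "v \<in> V2" for v using funpow_restrict[of V2 N v B] m2 that N(3) P2(4) by simp
      have z: "act sc S p 0 = 0" for p using act_linear[OF V S(1) subD(3)[OF V] subD(3)[OF V], of p] by simp
      have gh1: "act sc S (g * h) v = 0" if v: "v \<in> V1" for v
      proof -
        have vV: "v \<in> V" using v sub1 by blast
        have "act sc S (g * h) v = act sc S h (act sc S g v)" by (simp add: act_mult[OF V S(1) vV, symmetric] mult.commute)
        then show ?thesis using a1[OF v, of g] P1(3)[OF v] z by simp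
      qed
      have gh2: "act sc S (g * h) v = 0" if v: "v \<in> V2" for v
        using act_mult[OF V S(1), of v g h] v sub2 a2[OF v, of h] P2(3)[OF v] z by auto
      have p: "(S, N) \<in> pairs (g * h) B V"
      proof -
        have "act sc S (g * h) v = 0 \<and> (N ^^ B) v = 0 \<and> N (S v) = S (N v)" if vV: "v \<in> V" for v
        proof -
          obtain u w where *: "u \<in> V1" "w \<in> V2" "v = u + w" using dec[OF vV] by blast
          have uV: "u \<in> V" "w \<in> V" using * sub1 sub2 by auto
          have Su: "S u \<in> V" "S w \<in> V" "N u \<in> V" "N w \<in> V" using uV lin_mem[OF S(1)] lin_mem[OF N(1)] by auto
          have "N (S u) = S (N u)" using S1 m1 P1(5) *(1) by simp
          moreover have "N (S w) = S (N w)" using S2 m2 P2(5) *(2) by simp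
          ultimately have "N (S v) = S (N v)"
            unfolding *(3) using uV Su by (simp add: lin_add[OF S(1)] lin_add[OF N(1)])
          then show ?thesis unfolding *(3)
            using act_linear[OF V S(1) uV] funpow_linear[OF V N(1) uV] gh1 gh2 f1 f2 * by simp
        qed
        then show ?thesis using S(1) N(1) by (auto simp: pairs_def)
      qed
      \<comment> \<open>The component w of v in V2 is killed by g(S) and by h(S), hence by a g + b h
        = 1.\<close>
      have k1: "v \<in> V1" if v: "v \<in> V" "act sc S g v = 0" for v
      proof -
        obtain u w where *: "u \<in> V1" "w \<in> V2" "v = u + w" using dec[OF v(1)] by blast
        have uV: "u \<in> V" "w \<in> V" using * sub1 sub2 by auto
        have "act sc S g w = 0" using v(2) act_linear[OF V S(1) uV, of g] a1[OF *(1), of g] P1(3)[OF *(1)] *(3) by simp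
        moreover have "act sc S h w = 0" using a2[OF *(2)] P2(3)[OF *(2)] by simp
        ultimately have "w = 0"
          using act_add[OF V S(1) uV(2), of "a * g" "b * h"] act_1[OF V uV(2)] ab act_mult[OF V S(1) uV(2)] z by simp
        then show ?thesis using * by simp
      qed
      have k2: "v \<in> V2" if v: "v \<in> V" "act sc S h v = 0" for v
      proof -
        obtain u w where *: "u \<in> V1" "w \<in> V2" "v = u + w" using dec[OF v(1)] by blast
        have uV: "u \<in> V" "w \<in> V" using * sub1 sub2 by auto
        have "act sc S h u = 0" using v(2) act_linear[OF V S(1) uV, of h] a2[OF *(2), of h] P2(3)[OF *(2)] *(3) by simp
        moreover have "act sc S g u = 0" using a1[OF *(1)] P1(3)[OF *(1)] by simp
        ultimately have "u = 0"
          using act_add[OF V S(1) uV(1), of "a * g" "b * h"] act_1[OF V uV(1)] ab act_mult[OF V S(1) uV(1)] z by simp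
        then show ?thesis using * by simp
      qed
      have "{v \<in> V. act sc S g v = 0} = V1" "{v \<in> V. act sc S h v = 0} = V2"
        using k1 k2 sub1 sub2 a1 a2 P1(3) P2(3) by auto
      then have "(S, N) \<in> fibre g h B V V1 V2" using p by (simp add: fibre_def)
      moreover have "y = ?r (S, N)" using y S N by simp
      ultimately show "y \<in> ?r ` fibre g h B V V1 V2" by blast
    qed
  qed
  then show ?thesis by (simp add: bij_betw_same_card card_cartesian_product)
qed

lemma pairs_series_mult:
  assumes ab: "a * g + b * h = 1" and G: "pairs_series g B G" and H: "pairs_series h B H"
  shows "pairs_series (g * h) B (G * H)"
  unfolding pairs_series_def
proof (intro allI impI)
  fix V n assume V: "sub V" and n: "card V = CARD('a) ^ n"
  let ?q = "CARD('a)"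
  let ?D1 = "\<lambda>i. {W. sub W \<and> W \<subseteq> V \<and> card W = ?q ^ i \<and> W \<inter> {0} = {0}}"
  let ?D2 = "\<lambda>i V1. {W. sub W \<and> W \<subseteq> V \<and> card W = ?q ^ (n - i) \<and> W \<inter> V1 = {0}}"
  let ?T = "\<lambda>i. (gl ?q i * fps_nth G i) * (gl ?q (n - i) * fps_nth H (n - i))"
  \<comment> \<open>The index i repeats the dimension of V1, so that the sum over all splittings can
    be arranged as a Cauchy product.\<close>
  define I where "I = Sigma {..n} (\<lambda>i. Sigma (?D1 i) (?D2 i))"
  have fin1: "finite (?D1 i)" for i by (rule finite_subset[of _ "Pow V"]) (use subD(2)[OF V] in auto)
  have fin2: "finite (?D2 i V1)" for i V1 by (rule finite_subset[of _ "Pow V"]) (use subD(2)[OF V] in auto)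
  have finI: "finite I" unfolding I_def using fin1 fin2 by (intro finite_SigmaI) auto
  have sumV: "ssum V1 V2 = V" if V12: "V1 \<in> ?D1 i" "V2 \<in> ?D2 i V1" "i \<le> n" for i V1 V2
  proof -
    have "ssum V1 V2 \<subseteq> V" using V12 subD(4)[OF V] by (auto simp: ssum_def)
    moreover have "V1 \<inter> V2 = {0}" using V12 by blast
    then have "card (ssum V1 V2) = card V" using card_ssum[of V1 V2] V12 n by (simp flip: power_add)
    ultimately show ?thesis using subD(2)[OF V] by (simp add: card_subset_eq)
  qed
  have un: "pairs (g * h) B V = (\<Union>x\<in>I. case x of (i, V1, V2) \<Rightarrow> fibre g h B V V1 V2)"
  proof (intro equalityI subsetI)
    fix x assume x: "x \<in> pairs (g * h) B V"
    obtain S N where SN: "x = (S, N)" by (cases x)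
    note P = pairsD[OF x[unfolded SN]]
    let ?V1 = "{v \<in> V. act sc S g v = 0}" and ?V2 = "{v \<in> V. act sc S h v = 0}"
    have s: "sub ?V1" "sub ?V2" using sub_kernel[OF V P(1)] by auto
    note k = kernel_decomposition[OF V P(1) ab P(3)]
    have c: "card ?V1 * card ?V2 = card V" using card_ssum[OF s k(1)] k(2) by simp
    obtain i j where ij: "card ?V1 = ?q ^ i" "card ?V2 = ?q ^ j" using dim_exists s by blast
    have "?q ^ (i + j) = ?q ^ n" using c ij n by (simp add: power_add)
    then have "i + j = n" using Q_gt_1 by simp
    then have "i \<le> n" "j = n - i" by auto
    moreover have "?V1 \<inter> {0} = {0}" using subD(3)[OF s(1)] by auto
    moreover have "?V2 \<inter> ?V1 = {0}" using k(1) by blast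
    ultimately have "(i, ?V1, ?V2) \<in> I" using s ij by (auto simp: I_def)
    moreover have "x \<in> fibre g h B V ?V1 ?V2" using x SN by (simp add: fibre_def)
    ultimately show "x \<in> (\<Union>x\<in>I. case x of (i, V1, V2) \<Rightarrow> fibre g h B V V1 V2)" by blast
  next
    fix x assume "x \<in> (\<Union>x\<in>I. case x of (i, V1, V2) \<Rightarrow> fibre g h B V V1 V2)"
    then show "x \<in> pairs (g * h) B V" by (auto simp: fibre_def)
  qed
  have "card (pairs (g * h) B V) = (\<Sum>x\<in>I. card (case x of (i, V1, V2) \<Rightarrow> fibre g h B V V1 V2))"
    unfolding un
  proof (rule card_UNION_eq_sum[OF finI])
    fix x assume "x \<in> I"
    show "finite (case x of (i, V1, V2) \<Rightarrow> fibre g h B V V1 V2)"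
      by (rule finite_subset[OF _ finite_pairs[OF V, of "g * h" B]]) (auto simp: fibre_def)
  next
    fix x y z assume x: "x \<in> I" and y: "y \<in> I" and z: "z \<in> (case x of (i, V1, V2) \<Rightarrow> fibre g h B V V1 V2)"
      "z \<in> (case y of (i, V1, V2) \<Rightarrow> fibre g h B V V1 V2)"
    obtain i V1 V2 j W1 W2 where xy: "x = (i, V1, V2)" "y = (j, W1, W2)" by (cases x, cases y)
    have e: "V1 = W1" "V2 = W2" using z unfolding xy fibre_def by auto
    have "?q ^ i = ?q ^ j" using x y e unfolding xy I_def by auto
    then have "i = j" using Q_gt_1 by simp
    then show "x = y" using e xy by simp
  qed
  also have "\<dots> = (\<Sum>i\<le>n. \<Sum>(V1, V2)\<in>Sigma (?D1 i) (?D2 i). card (fibre g h B V V1 V2))"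
    unfolding I_def by (subst sum.Sigma) (auto intro!: sum.cong finite_SigmaI fin1 fin2)
  also have "\<dots> = (\<Sum>i\<le>n. \<Sum>V1\<in>?D1 i. \<Sum>V2\<in>?D2 i V1. card (fibre g h B V V1 V2))"
    by (intro sum.cong refl) (subst sum.Sigma, auto intro!: fin1 fin2)
  finally have "real (card (pairs (g * h) B V)) =
      (\<Sum>i\<le>n. \<Sum>V1\<in>?D1 i. \<Sum>V2\<in>?D2 i V1. real (card (fibre g h B V V1 V2)))"
    by simp
  also have "\<dots> = (\<Sum>i\<le>n. \<Sum>V1\<in>?D1 i. \<Sum>V2\<in>?D2 i V1. ?T i)"
  proof (intro sum.cong refl)
    fix i V1 V2 assume *: "i \<in> {..n}" "V1 \<in> ?D1 i" "V2 \<in> ?D2 i V1"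
    have s: "sub V1" "sub V2" "V1 \<inter> V2 = {0}" "card V1 = ?q ^ i" "card V2 = ?q ^ (n - i)" using * by auto
    have "ssum V1 V2 = V" using sumV * by auto
    then show "real (card (fibre g h B V V1 V2)) = ?T i"
      using card_fibre[OF V ab s(1-3)] G H s unfolding pairs_series_def by simp
  qed
  also have "\<dots> = (\<Sum>i\<le>n. gl ?q n * (fps_nth G i * fps_nth H (n - i)))"
  proof (intro sum.cong refl)
    fix i assume "i \<in> {..n}"
    then have i: "i \<le> n" by simp
    let ?c = "\<Prod>k<n - i. real ?q ^ n - real ?q ^ i * real ?q ^ k"
    have inner: "(\<Sum>V2\<in>?D2 i V1. ?T i) =
       ?c * (gl ?q i * fps_nth G i * fps_nth H (n - i))" if "V1 \<in> ?D1 i" for V1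
    proof -
      have "real (card (?D2 i V1)) * gl ?q (n - i) = ?c"
        using card_complements[OF V _ _ n, of V1 "n - i"] that by auto
      then show ?thesis by (simp add: algebra_simps)
    qed
    have "(\<Sum>V1\<in>?D1 i. \<Sum>V2\<in>?D2 i V1. ?T i) =
      (\<Sum>V1\<in>?D1 i. ?c * (gl ?q i * fps_nth G i * fps_nth H (n - i)))"
      by (rule sum.cong[OF refl inner])
    also have "\<dots> = (real (card (?D1 i)) * gl ?q i) * ?c * (fps_nth G i * fps_nth H (n - i))"
      by simp
    also have "real (card (?D1 i)) * gl ?q i = (\<Prod>k<i. real ?q ^ n - real ?q ^ k)"
      using card_complements[OF V sub_zero _ n i] subD(3)[OF V] by simp
    \<comment> \<open>A basis of V1 followed by a basis of V2 is a basis of V, so the choices of V1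
      and V2 together with \<open>gl ?q i\<close> and \<open>gl ?q (n - i)\<close> make up
      \<open>gl ?q n\<close>.\<close>
    also have "(\<Prod>k<i. real ?q ^ n - real ?q ^ k) * ?c = gl ?q n"
      using prod_lessThan_add[of "\<lambda>k. real ?q ^ n - real ?q ^ k" i "n - i"] i by (simp add: gl_def power_add)
    finally show "(\<Sum>V1\<in>?D1 i. \<Sum>V2\<in>?D2 i V1. ?T i) =
       gl ?q n * (fps_nth G i * fps_nth H (n - i))" .
  qed
  also have "\<dots> = gl ?q n * fps_nth (G * H) n"
    by (simp add: fps_mult_nth atLeast0AtMost sum_distrib_left)
  finally show "real (card (pairs (g * h) B V)) = gl ?q n * fps_nth (G * H) n" .
qed

end

section \<open>The contribution of one irreducible factor\<close>

lemma fspace_UNIV: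
  fixes sc :: "'a::{finite,field} \<Rightarrow> 'v::ab_group_add \<Rightarrow> 'v"
  assumes "\<And>r v w. sc r (v + w) = sc r v + sc r w" "\<And>r s v. sc (r + s) v = sc r v + sc s v"
    "\<And>r s v. sc (r * s) v = sc r (sc s v)" "\<And>v. sc 1 v = v"
  shows "fspace sc UNIV"
proof -
  have z: "sc r 0 = 0" for r using assms(1)[of r 0 0] by simp
  have z': "sc 0 v = 0" for v using assms(2)[of 0 0 v] by simp
  have inj: "inj (\<lambda>r. sc r v)" if "v \<noteq> 0" for v
  proof (rule injI, rule ccontr)
    fix r s assume rs: "sc r v = sc s v" "r \<noteq> s"
    have "sc (r - s) v + sc s v = sc r v" using assms(2)[of "r - s" s v] by simp
    then have 0: "sc (r - s) v = 0" using rs by simp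
    have "v = sc (inverse (r - s) * (r - s)) v" using rs(2) assms(4) by simp
    also have "\<dots> = 0" unfolding assms(3) 0 by (rule z)
    finally show False using that by simp
  qed
  show ?thesis unfolding fspace_def
  proof (rule kspace.intro)
    show "\<exists>s. s * r - 1 \<in> {0}" if "r \<notin> {0}" for r :: 'a using that by (intro exI[of _ "inverse r"]) simp
    show "card (range (\<lambda>r. sc r v)) = CARD('a)" if "v \<noteq> 0" for v using inj[OF that] by (rule card_image)
    show "1 < CARD('a)" by (rule CARD_field_gt_1)
  qed (use assms z' in auto)
qed

text \<open>Tuples of length m are represented by functions on all of nat that vanish from m on, so
  that spaces of every dimension share one type.\<close>

lemma truncated_functions_bij:
  fixes T :: "'b::zero set" and m :: nat
  shows "bij_betw (\<lambda>v. restrict v {..<m}) {v. (\<forall>i<m. v i \<in> T) \<and> (\<forall>i\<ge>m. v i = 0)} ({..<m} \<rightarrow>\<^sub>E T)"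
proof (rule bij_betw_byWitness[where f' = "\<lambda>w i. if i < m then w i else 0"])
  show "(\<lambda>v. restrict v {..<m}) ` {v. (\<forall>i<m. v i \<in> T) \<and> (\<forall>i\<ge>m. v i = 0)} \<subseteq> {..<m} \<rightarrow>\<^sub>E T"
    by (intro image_subsetI restrict_PiE_iff[THEN iffD2]) simp
qed (auto simp: fun_eq_iff PiE_def extensional_def dest: leD)

lemma finite_truncated_functions:
  fixes T :: "'b::zero set" and m :: nat
  shows "finite T \<Longrightarrow> finite {v. (\<forall>i<m. v i \<in> T) \<and> (\<forall>i\<ge>m. v i = 0)}"
  unfolding bij_betw_finite[OF truncated_functions_bij] by (rule finite_PiE) auto

lemma card_truncated_functions:
  fixes T :: "'b::zero set" and m :: nat
  shows "card {v. (\<forall>i<m. v i \<in> T) \<and> (\<forall>i\<ge>m. v i = 0)} = card T ^ m"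
proof -
  have "card {v. (\<forall>i<m. v i \<in> T) \<and> (\<forall>i\<ge>m. v i = 0)} = card ({..<m} \<rightarrow>\<^sub>E T)"
    by (rule bij_betw_same_card[OF truncated_functions_bij])
  also have "\<dots> = (\<Prod>i\<in>{..<m}. card T)" by (rule card_PiE) simp
  finally show ?thesis by simp
qed

definition pscale :: "'a::{finite,field} \<Rightarrow> (nat \<Rightarrow> 'a poly) \<Rightarrow> nat \<Rightarrow> 'a poly" where
  "pscale c v = (\<lambda>i. smult c (v i))"

interpretation pscale: fspace "pscale :: 'a::{finite,field} \<Rightarrow> _" UNIV
  by (rule fspace_UNIV) (auto simp: pscale_def fun_eq_iff smult_add_right smult_add_left)

text \<open>The vector space of dimension m over the residue field of f, as a space over the ground field.\<close>

definition residues_pow :: "'a::{finite,field} poly \<Rightarrow> nat \<Rightarrow> (nat \<Rightarrow> 'a poly) set" where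
  "residues_pow f m = {v. (\<forall>i<m. degree (v i) < degree f) \<and> (\<forall>i\<ge>m. v i = 0)}"

text \<open>Multiplication by X in each copy of the residue field. It is the model of an
  endomorphism annihilated by f; its matrix is made of m diagonal companion blocks.\<close>

definition mult_X_mod :: "'a::{finite,field} poly \<Rightarrow> nat \<Rightarrow> (nat \<Rightarrow> 'a poly) \<Rightarrow> nat \<Rightarrow> 'a poly" where
  "mult_X_mod f m = (\<lambda>v\<in>residues_pow f m. \<lambda>i. ([:0, 1:] * v i) mod f)"

context
  fixes f :: "'a::{finite,field} poly" and m :: nat
  assumes d: "0 < degree f"
begin

lemma card_residues_pow: "card (residues_pow f m) = CARD('a) ^ (degree f * m)"
  using card_truncated_functions[of m "{r :: 'a poly. degree r < degree f}"] card_polys_degree_less(2)[OF d, where 'a='a]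
  by (simp add: residues_pow_def power_mult)

lemma sub_residues_pow: "pscale.sub (residues_pow f m)"
proof -
  have "finite (residues_pow f m)"
    using finite_truncated_functions[OF card_polys_degree_less(1)[OF d, where 'a='a], of m] by (simp add: residues_pow_def)
  then show ?thesis unfolding pscale.sub_def
    using d by (auto simp: residues_pow_def pscale_def intro: degree_add_less le_less_trans[OF degree_smult_le])
qed

lemma mult_X_mod_End: "mult_X_mod f m \<in> pscale.End (residues_pow f m)"
proof (rule linI)
  have f0: "f \<noteq> 0" using d by auto
  fix v assume v: "v \<in> residues_pow f m"
  have "degree (p mod f) < degree f" for p using degree_mod_less[OF f0, of p] d by auto
  then show "mult_X_mod f m v \<in> residues_pow f m" using v
    by (simp add: mult_X_mod_def) (simp add: residues_pow_def)
  show "mult_X_mod f m (v + w) = mult_X_mod f m v + mult_X_mod f m w" if w: "w \<in> residues_pow f m" for w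
    using v w pscale.subD(4)[OF sub_residues_pow v w]
    by (simp add: mult_X_mod_def fun_eq_iff poly_mod_add_left distrib_left del: mult_pCons_left)
  show "mult_X_mod f m (pscale r v) = pscale r (mult_X_mod f m v)" for r
    using v pscale.subD(5)[OF sub_residues_pow v, of r]
    by (simp add: mult_X_mod_def fun_eq_iff pscale_def mod_smult_left del: mult_pCons_left)
qed (simp add: mult_X_mod_def)

text \<open>The case p = f is the one of interest: it shows that f annihilates the model
  endomorphism.\<close>

lemma act_mult_X_mod:
  "v \<in> residues_pow f m \<Longrightarrow> act pscale (mult_X_mod f m) p v = (\<lambda>i. (p * v i) mod f)"
proof (induction p arbitrary: v)
  case 0
  then show ?case by (simp add: pscale.act_0[OF sub_residues_pow] fun_eq_iff)
next
  case (pCons c p)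
  have m: "mult_X_mod f m v \<in> residues_pow f m" using lin_mem[OF mult_X_mod_End pCons(3)] .
  show ?case
  proof
    fix i
    have "degree (v i) < degree f" using pCons(3) d by (cases "i < m") (auto simp: residues_pow_def)
    then have "smult c (v i) mod f = smult c (v i)" by (simp add: mod_smult_left mod_poly_less)
    moreover have "pCons c p * v i = smult c (v i) + p * ([:0, 1:] * v i)"
      by (simp add: algebra_simps)
    moreover have "act pscale (mult_X_mod f m) (pCons c p) v i =
        smult c (v i) + (p * (([:0, 1:] * v i) mod f)) mod f"
    proof -
      have X: "mult_X_mod f m v i = ([:0, 1:] * v i) mod f" using pCons(3) by (simp add: mult_X_mod_def)
      have "act pscale (mult_X_mod f m) (pCons c p) v i =
          (pscale c v + (\<lambda>i. (p * mult_X_mod f m v i) mod f)) i"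
        by (simp only: pscale.act_pCons[OF sub_residues_pow mult_X_mod_End pCons(3)] pCons.IH[OF m])
      then show ?thesis by (simp only: plus_fun_apply pscale_def X)
    qed
    moreover have "(p * (([:0, 1:] * v i) mod f)) mod f = (p * ([:0, 1:] * v i)) mod f"
      by (rule mod_mult_right_eq)
    ultimately show "act pscale (mult_X_mod f m) (pCons c p) v i = (pCons c p * v i) mod f"
      by (simp only: poly_mod_add_left)
  qed
qed

end

context fspace
begin

lemma sub_act_self:
  assumes V: "sub V" and S: "S \<in> End V" and f: "irreducible f" and fS: "\<And>v. v \<in> V \<Longrightarrow> act sc S f v = 0"
  shows "kspace.sub (act sc S) V V"
proof -
  interpret K: kspace "act sc S" V "{r. f dvd r}" "CARD('a) ^ degree f" by (rule kspace_act[OF assms])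
  show ?thesis unfolding K.sub_def using subD(2-4)[OF V] act_mem[OF V S] by simp
qed

text \<open>Every isomorphism g over the ground field from the model space to V carries the model
  endomorphism T to exactly one S = g T g^-1, and f(S) = 0. The g that lead to a given S are the
  isomorphisms over the residue field, and their number does not depend on S.\<close>

lemma card_semisimple:
  assumes f: "irreducible f" and V: "sub V" and n: "card V = CARD('a) ^ (degree f * m)"
  shows "real (card {S \<in> End V. \<forall>v\<in>V. act sc S f v = 0}) * gl (CARD('a) ^ degree f) m = gl CARD('a) (degree f * m)"
proof -
  have d: "0 < degree f" using irreducible_degree_pos[OF f] .
  let ?M = "residues_pow f m" and ?T = "mult_X_mod f m"
  let ?D = "{S \<in> End V. \<forall>v\<in>V. act sc S f v = 0}"
  interpret F: kpair "pscale :: 'a \<Rightarrow> _" UNIV sc X "{0}" "CARD('a)" by unfold_locales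
  note M = sub_residues_pow[OF d, of m] and T = mult_X_mod_End[OF d, of m] and cM = card_residues_pow[OF d, of m]
  have fT: "act pscale ?T f v = 0" if "v \<in> ?M" for v
    using act_mult_X_mod[OF d that, of f] by (simp add: fun_eq_iff)
  let ?I = "{g \<in> lin pscale sc ?M V. inj_on g ?M}"
  let ?IS = "\<lambda>S. {g \<in> lin (act pscale ?T) (act sc S) ?M V. inj_on g ?M}"
  have IS: "?IS S = {g \<in> ?I. \<forall>v\<in>?M. g (?T v) = S (g v)}" if "S \<in> ?D" for S
    using lin_act_eq[OF pscale.fspace_axioms fspace_axioms M V T, of S] that by auto
  have surj: "g ` ?M = V" if "g \<in> ?I" for g
    using that lin_mem[of g pscale sc ?M V] card_image[of g ?M] n cM subD(2)[OF V] by (intro card_subset_eq) auto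
  have "?I = (\<Union>S\<in>?D. ?IS S)"
  proof (intro equalityI subsetI)
    fix g assume gI: "g \<in> ?I"
    then have g: "g \<in> lin pscale sc ?M V" "inj_on g ?M" by auto
    define S where "S = (\<lambda>w\<in>V. g (?T (inv_into ?M g w)))"
    have Sg: "S (g v) = g (?T v)" if "v \<in> ?M" for v
      using that g lin_mem[OF g(1) that] by (simp add: S_def inv_into_f_f)
    have ex: "\<exists>v\<in>?M. w = g v" if "w \<in> V" for w using surj[OF gI] that by blast
    have S: "S \<in> End V"
    proof (rule linI)
      show "S \<in> extensional V" by (simp add: S_def)
    next
      fix w assume "w \<in> V"
      then obtain v where v: "v \<in> ?M" "w = g v" using ex by blast
      show "S w \<in> V" using Sg[OF v(1)] v lin_mem[OF g(1) lin_mem[OF T v(1)]] by simp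
      show "S (sc r w) = sc r (S w)" for r
        using Sg[OF v(1)] Sg[OF pscale.subD(5)[OF M v(1)], of r] v lin_sc[OF g(1)] lin_sc[OF T v(1)] lin_mem[OF T v(1)] by simp
      fix w' assume "w' \<in> V"
      then obtain v' where v': "v' \<in> ?M" "w' = g v'" using ex by blast
      show "S (w + w') = S w + S w'"
        using Sg[OF v(1)] Sg[OF v'(1)] Sg[OF pscale.subD(4)[OF M v(1) v'(1)]] v v'
          lin_add[OF g(1)] lin_add[OF T v(1) v'(1)] lin_mem[OF T v(1)] lin_mem[OF T v'(1)] by simp
    qed
    have "act sc S f w = 0" if "w \<in> V" for w
    proof -
      obtain v where v: "v \<in> ?M" "w = g v" using ex \<open>w \<in> V\<close> by blast
      have "act sc S f (g v) = g (act pscale ?T f v)"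
        using act_intertwine[OF pscale.fspace_axioms fspace_axioms M V T S g(1) _ v(1)] Sg by simp
      then show ?thesis using v fT F.lin_zero[OF M g(1)] by simp
    qed
    then have "S \<in> ?D" using S by blast
    moreover from this have "g \<in> ?IS S" using IS gI Sg by auto
    ultimately show "g \<in> (\<Union>S\<in>?D. ?IS S)" by blast
  next
    fix g assume "g \<in> (\<Union>S\<in>?D. ?IS S)"
    then show "g \<in> ?I" using IS by blast
  qed
  moreover have "card (\<Union>S\<in>?D. ?IS S) = (\<Sum>S\<in>?D. card (?IS S))"
  proof (rule card_UNION_eq_sum)
    show "finite ?D" using finite_End[OF V] by simp
    show "finite (?IS S)" if "S \<in> ?D" for S
      by (intro finite_Collect_conjI disjI1) (simp add: finite_lin[OF pscale.subD(2)[OF M] subD(2)[OF V]])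
    fix S S' g assume S: "S \<in> ?D" "S' \<in> ?D" and g: "g \<in> ?IS S" "g \<in> ?IS S'"
    show "S = S'"
    proof (rule lin_eqI)
      show "S \<in> End V" "S' \<in> End V" using S by auto
      fix w assume "w \<in> V"
      moreover have "g \<in> ?I" using g IS[OF S(1)] by blast
      ultimately obtain v where v: "v \<in> ?M" "w = g v" using surj by blast
      have "g (?T v) = S (g v)" using g(1) v(1) unfolding IS[OF S(1)] by blast
      moreover have "g (?T v) = S' (g v)" using g(2) v(1) unfolding IS[OF S(2)] by blast
      ultimately show "S w = S' w" using v(2) by simp
    qed
  qed
  moreover have "real (card (?IS S)) = gl (CARD('a) ^ degree f) m" if S: "S \<in> ?D" for S
  proof -
    have S': "S \<in> End V" "\<And>v. v \<in> V \<Longrightarrow> act sc S f v = 0" using S by auto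
    interpret K: kpair "act pscale ?T" ?M "act sc S" V "{r. f dvd r}" "CARD('a) ^ degree f"
      unfolding kpair_def using pscale.kspace_act[OF M T f fT] kspace_act[OF V S'(1) f S'(2)] by blast
    show ?thesis
      using K.card_iso[OF pscale.sub_act_self[OF M T f fT] sub_act_self[OF V S'(1) f S'(2)]] cM n
      by (simp add: power_mult)
  qed
  moreover have "real (card ?I) = gl CARD('a) (degree f * m)" by (rule F.card_iso[OF M V cM n])
  ultimately show ?thesis by simp
qed

text \<open>For a fixed S the maps N are those that are linear over the residue field and satisfy
  N^B = 0, so their number depends only on the dimension over that field. Its factor
  \<open>gl (q^e) m\<close>, with q the size of the ground field and e the degree of f, turns the
  number of S into \<open>gl q n\<close>.\<close>

lemma pairs_series_irreducible:
  assumes f: "irreducible f"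
  shows "pairs_series f B (factor_fps CARD('a) (degree f) B)"
  unfolding pairs_series_def
proof (intro allI impI)
  fix V n assume V: "sub V" and n: "card V = CARD('a) ^ n"
  let ?q = "CARD('a)" and ?e = "degree f"
  have d: "0 < ?e" using irreducible_degree_pos[OF f] .
  let ?D = "{S \<in> End V. \<forall>v\<in>V. act sc S f v = 0}"
  let ?C = "\<lambda>S. {N \<in> lin (act sc S) (act sc S) V V. \<forall>v\<in>V. (N ^^ B) v = 0}"
  have C: "?C S = {N \<in> End V. (\<forall>v\<in>V. N (S v) = S (N v)) \<and> (\<forall>v\<in>V. (N ^^ B) v = 0)}" if "S \<in> ?D" for S
    using lin_act_eq[OF fspace_axioms fspace_axioms V V, of S S] that by auto
  have "pairs f B V = Sigma ?D ?C" using C by (auto simp: pairs_def)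
  moreover have "finite ?D" using finite_End[OF V] by simp
  moreover have "finite (?C S)" for S 
    by (intro finite_Collect_conjI disjI1) (simp add: finite_lin[OF subD(2)[OF V] subD(2)[OF V]])
  ultimately have card: "card (pairs f B V) = (\<Sum>S\<in>?D. card (?C S))" by (simp add: card_SigmaI)
  \<comment> \<open>Any such S makes V a space over a field with q^e elements, so that e divides n;
    otherwise no pair exists and the coefficient is 0.\<close>
  have dim: "\<exists>m. n = ?e * m \<and> real (card (?C S)) = gl (?q ^ ?e) m * (\<Sum>a\<le>m. nilw (?q ^ ?e) B m a)"
    if S: "S \<in> ?D" for S
  proof -
    have S': "S \<in> End V" "\<And>v. v \<in> V \<Longrightarrow> act sc S f v = 0" using S by auto
    interpret K: kspace "act sc S" V "{r. f dvd r}" "?q ^ ?e" by (rule kspace_act[OF V S'(1) f S'(2)])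
    have sV: "K.sub V" by (rule sub_act_self[OF V S'(1) f S'(2)])
    obtain m where m: "card V = (?q ^ ?e) ^ m" using K.dim_exists[OF sV] by blast
    then have "?q ^ n = ?q ^ (?e * m)" using n by (simp add: power_mult)
    then have "n = ?e * m" using Q_gt_1 by simp
    then show ?thesis using K.card_nilpotents[OF sV m] by blast
  qed
  show "real (card (pairs f B V)) = gl ?q n * fps_nth (factor_fps ?q ?e B) n"
  proof (cases "?e dvd n")
    case False
    then have D0: "?D = {}" using dim by fastforce
    have "card (pairs f B V) = 0" unfolding card D0 by (rule sum.empty)
    then show ?thesis using False factor_fps_nth[OF d] by simp
  next
    case True
    then obtain m where m: "n = ?e * m" by blast
    have "real (card (?C S)) = gl (?q ^ ?e) m * (\<Sum>a\<le>m. nilw (?q ^ ?e) B m a)" if "S \<in> ?D" for S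
      using dim[OF that] m d by auto
    then have "real (card (pairs f B V)) = (real (card ?D) * gl (?q ^ ?e) m) * (\<Sum>a\<le>m. nilw (?q ^ ?e) B m a)"
      using card by simp
    also have "real (card ?D) * gl (?q ^ ?e) m = gl ?q n"
      using card_semisimple[OF f V] n m by simp
    finally show ?thesis using m d factor_fps_nth[OF d] by simp
  qed
qed

lemma pairs_series_squarefree:
  assumes "h \<noteq> 0 \<and> (\<forall>f. irreducible f \<longrightarrow> \<not> f * f dvd h)"
  shows "pairs_series h B (\<Prod>f\<in>monic_irreds h. factor_fps CARD('a) (degree f) B)"
  using assms
proof (induction rule: squarefree_induct)
  case (const c)
  then show ?case using pairs_series_const by (simp add: monic_irreds_const)
next
  case (mult f g)
  obtain a b where ab: "a * f + b * g = 1" using irreducible_bezout[OF mult(1,3)] by blast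
  show ?case
    using pairs_series_mult[OF ab pairs_series_irreducible[OF mult(1)] mult(5)]
      monic_irreds_mult[OF mult(1-3)] finite_monic_irreds[OF mult(4)] by simp
qed

section \<open>Splitting a torsion endomorphism into a torsion and a unipotent part\<close>

lemma funpow_sc: "S \<in> End V \<Longrightarrow> v \<in> V \<Longrightarrow> (S ^^ k) (sc r v) = sc r ((S ^^ k) v)"
  by (induction k) (auto simp: lin_sc funpow_mem)

lemma funpow_End:
  assumes "sub V" "S \<in> End V"
  shows "restrict (S ^^ k) V \<in> End V"
  by (rule linI) (use assms funpow_mem[OF assms(2)] funpow_linear[OF assms] funpow_sc[OF assms(2)] subD(4,5)[OF assms(1)] in auto)

lemma funpow_commute:
  assumes "S \<in> End V" "U \<in> End V" "\<And>v. v \<in> V \<Longrightarrow> U (S v) = S (U v)" "v \<in> V"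
  shows "U ((S ^^ k) v) = (S ^^ k) (U v)"
  using assms(4) by (induction k) (auto simp: assms(3) funpow_mem[OF assms(1)])

lemma funpow_product:
  assumes S: "S \<in> End V" and U: "U \<in> End V" and c: "\<And>v. v \<in> V \<Longrightarrow> U (S v) = S (U v)" and v: "v \<in> V"
    and A: "\<And>v. v \<in> V \<Longrightarrow> A v = S (U v)"
  shows "(A ^^ k) v = (S ^^ k) ((U ^^ k) v)"
proof (induction k)
  case (Suc k)
  have m: "(U ^^ k) v \<in> V" "(S ^^ k) ((U ^^ k) v) \<in> V" using funpow_mem[OF U v] funpow_mem[OF S] by auto
  show ?case using Suc m A funpow_commute[OF S U c m(1)] by (simp add: funpow_swap1)
qed simp

lemma product_End:
  assumes "sub V" "S \<in> End V" "U \<in> End V"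
  shows "(\<lambda>v\<in>V. S (U v)) \<in> End V"
  by (rule linI) (use assms subD(4,5)[OF assms(1)] in \<open>auto simp: lin_mem lin_add lin_sc\<close>)

lemma one_plus_End:
  assumes "sub V" "N \<in> End V"
  shows "(\<lambda>v\<in>V. v + N v) \<in> End V"
  by (rule linI) (use assms subD[OF assms(1)] in \<open>auto simp: lin_mem lin_add lin_sc sc_add_right algebra_simps\<close>)

lemma minus_one_End:
  assumes "sub V" "U \<in> End V"
  shows "(\<lambda>v\<in>V. U v - v) \<in> End V"
proof (rule linI)
  fix r v assume v: "v \<in> V"
  then have "sc r (U v - v) = sc r (U v) - sc r v"
    using sc_add_right[of "U v" "- v" r] sc_minus_right[of v r] neg_X lin_mem[OF assms(2) v] subD(8)[OF assms(1)] by simp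
  then show "(\<lambda>v\<in>V. U v - v) (sc r v) = sc r ((\<lambda>v\<in>V. U v - v) v)"
    using v subD(5)[OF assms(1)] lin_sc[OF assms(2)] by simp
qed (use assms subD[OF assms(1)] in \<open>auto simp: lin_mem lin_add\<close>)

lemma prime_CHAR_field: "prime CHAR('a)"
proof -
  have "CHAR('a) \<noteq> 0" using finite_imp_CHAR_pos[where 'a='a] by simp
  then show ?thesis using prime_CHAR_semidom[where 'a='a] by simp
qed

text \<open>This makes identities between powers in the polynomial ring, such as the additivity of
  the B-th power, available for iterates of endomorphisms. F has to agree with p(S) on V
  only.\<close>

lemma act_eq_funpow:
  assumes "sub V" "S \<in> End V" "\<And>v. v \<in> V \<Longrightarrow> F v = act sc S p v" "v \<in> V"
  shows "(F ^^ k) v = act sc S (p ^ k) v"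
proof (induction k)
  case 0
  then show ?case using assms act_1 by simp
next
  case (Suc k)
  then show ?case using assms act_mult[OF assms(1,2,4)] act_mem[OF assms(1,2,4)] by simp
qed

lemma act_xpow: "sub V \<Longrightarrow> S \<in> End V \<Longrightarrow> v \<in> V \<Longrightarrow> act sc S ([:0, 1:] ^ k) v = (S ^^ k) v"
  using act_monom[of V S v k] by (simp add: monom_altdef)

text \<open>The identity (1 + X)^B = 1 + X^B in the polynomial ring, evaluated at N.\<close>

lemma one_plus_nilpotent_power:
  assumes V: "sub V" and N: "N \<in> End V" and B: "B = CHAR('a) ^ r" and v: "v \<in> V"
  shows "((\<lambda>v\<in>V. v + N v) ^^ B) v = v + (N ^^ B) v"
proof -
  have pr: "prime CHAR('a poly)" using prime_CHAR_field by simp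
  have "((\<lambda>v\<in>V. v + N v) ^^ B) v = act sc N ((1 + [:0, 1:]) ^ B) v"
    by (rule act_eq_funpow[OF V N _ v]) (simp add: act_add[OF V N] act_1[OF V] act_X[OF V N])
  also have "(1 + [:0, 1:] :: 'a poly) ^ B = 1 ^ B + [:0, 1:] ^ B"
    by (rule freshmans_dream'[OF pr, of _ r]) (simp add: B)
  finally show ?thesis by (simp only: power_one act_add[OF V N v] act_1[OF V v] act_xpow[OF V N v])
qed

lemma unipotent_minus_one_power:
  assumes V: "sub V" and U: "U \<in> End V" and B: "B = CHAR('a) ^ r" and v: "v \<in> V"
  shows "((\<lambda>v\<in>V. U v - v) ^^ B) v = (U ^^ B) v - v"
proof -
  have pr: "prime CHAR('a poly)" using prime_CHAR_field by simp
  have "((\<lambda>v\<in>V. U v - v) ^^ B) v = act sc U (([:0, 1:] - 1) ^ B) v"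
    by (rule act_eq_funpow[OF V U _ v]) (simp add: act_diff[OF V U] act_1[OF V] act_X[OF V U])
  also have "([:0, 1:] - 1 + 1 :: 'a poly) ^ B = ([:0, 1:] - 1) ^ B + 1 ^ B"
    by (rule freshmans_dream'[OF pr, of _ r]) (simp add: B)
  then have "([:0, 1:] - 1 :: 'a poly) ^ B = [:0, 1:] ^ B - 1" by (simp only: diff_add_cancel power_one eq_diff_eq)
  finally show ?thesis by (simp only: act_diff[OF V U v] act_1[OF V v] act_xpow[OF V U v])
qed

text \<open>The torsion part S and the unipotent part U of A are recovered as the powers of A with exponents
  \<alpha> and \<beta>, where \<alpha> is 1 modulo t and 0 modulo B, and \<beta> is 0 modulo t and 1 modulo B.\<close>

lemma card_torsion_eq_pairs:
  assumes V: "sub V" and t: "0 < t" and B: "B = CHAR('a) ^ r" and cop: "coprime t B"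
  shows "card {A \<in> End V. \<forall>v\<in>V. (A ^^ (t * B)) v = v} = card (pairs (xpow_1 t) B V)"
proof -
  let ?R = "{A \<in> End V. \<forall>v\<in>V. (A ^^ (t * B)) v = v}"
  obtain \<alpha> where \<alpha>: "[\<alpha> = 1] (mod t)" "[\<alpha> = 0] (mod B)" using binary_chinese_remainder_nat[OF cop] by blast
  obtain \<beta> where \<beta>: "[\<beta> = 0] (mod t)" "[\<beta> = 1] (mod B)" using binary_chinese_remainder_nat[OF cop] by blast
  have \<alpha>\<beta>: "[\<alpha> + \<beta> = 1] (mod t * B)"
    using cong_add[OF \<alpha>(1) \<beta>(1)] cong_add[OF \<alpha>(2) \<beta>(2)] cop by (intro coprime_cong_mult_nat) auto
  have B\<alpha>: "B dvd \<alpha>" and t\<beta>: "t dvd \<beta>" using \<alpha>(2) \<beta>(1) by (auto simp: cong_0_iff)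
  \<comment> \<open>An iterate at v depends on the exponent only modulo a period of v; the
    congruences for \<alpha> and \<beta> enter through this fact.\<close>
  have mod: "(F ^^ k) v = (F ^^ l) v" if "(F ^^ n) v = v" "[k = l] (mod n)" for F :: "'v \<Rightarrow> 'v" and k l n v
    using funpow_mod_eq[OF that(1), of k] funpow_mod_eq[OF that(1), of l] that(2) by (simp add: cong_def)
  let ?f = "\<lambda>(S, N). (\<lambda>v\<in>V. S (v + N v))"
  let ?g = "\<lambda>A. (restrict (A ^^ \<alpha>) V, \<lambda>v\<in>V. (A ^^ \<beta>) v - v)"
  have xt: "act sc S (xpow_1 t) v = (S ^^ t) v - v" if "S \<in> End V" "v \<in> V" for S v
    unfolding xpow_1_def using act_diff[OF V that] act_xpow[OF V that] act_1[OF V that(2)] by simp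
  {
    fix S N assume "(S, N) \<in> pairs (xpow_1 t) B V"
    note P = pairsD[OF this]
    define U where "U = (\<lambda>v\<in>V. v + N v)"
    define A where "A = (\<lambda>v\<in>V. S (v + N v))"
    have U: "U \<in> End V" unfolding U_def by (rule one_plus_End[OF V P(2)])
    have UV: "U v \<in> V" "v + N v = U v" if "v \<in> V" for v using that lin_mem[OF U] by (auto simp: U_def)
    have A: "A v = S (U v)" if "v \<in> V" for v using that by (simp add: A_def UV)
    have A': "A = (\<lambda>v\<in>V. S (U v))" by (simp add: A_def U_def fun_eq_iff)
    have AE: "A \<in> End V" unfolding A' by (rule product_End[OF V P(1) U])
    have c: "U (S v) = S (U v)" if "v \<in> V" for v
      using that lin_mem[OF P(1)] lin_mem[OF P(2)] P(5) by (simp add: U_def lin_add[OF P(1)])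
    have pw: "(A ^^ k) v = (S ^^ k) ((U ^^ k) v)" if "v \<in> V" for v k
      using funpow_product[of S V U v A k] P(1) U c A that by blast
    have St: "(S ^^ t) v = v" if "v \<in> V" for v using xt[OF P(1) that] P(3)[OF that] by simp
    have UB: "(U ^^ B) v = v" if "v \<in> V" for v
      unfolding U_def using one_plus_nilpotent_power[OF V P(2) B that] P(4)[OF that] by simp
    have "(A ^^ (t * B)) v = v" if v: "v \<in> V" for v
    proof -
      have "(U ^^ (t * B)) v = (U ^^ 0) v" by (rule mod[OF UB[OF v]]) (simp add: cong_0_iff)
      moreover have "(S ^^ (t * B)) v = (S ^^ 0) v" by (rule mod[OF St[OF v]]) (simp add: cong_0_iff)
      ultimately show ?thesis using pw[OF v] by simp
    qed
    then have 1: "?f (S, N) \<in> ?R" using AE by (simp add: A_def)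
    have "(A ^^ \<alpha>) v = S v" if v: "v \<in> V" for v
    proof -
      have "(U ^^ \<alpha>) v = (U ^^ 0) v" by (rule mod[OF UB[OF v] \<alpha>(2)])
      moreover have "(S ^^ \<alpha>) v = (S ^^ 1) v" by (rule mod[OF St[OF v] \<alpha>(1)])
      ultimately show ?thesis using pw[OF v] by simp
    qed
    then have 2: "restrict (A ^^ \<alpha>) V = S" using lin_ext[OF P(1)] by (auto simp: fun_eq_iff extensional_def)
    have "(A ^^ \<beta>) v = U v" if v: "v \<in> V" for v
    proof -
      have "(U ^^ \<beta>) v = (U ^^ 1) v" by (rule mod[OF UB[OF v] \<beta>(2)])
      moreover have "(S ^^ \<beta>) (U v) = (S ^^ 0) (U v)" by (rule mod[OF St[OF UV(1)[OF v]] \<beta>(1)])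
      ultimately show ?thesis using pw[OF v] by simp
    qed
    then have 3: "(\<lambda>v\<in>V. (A ^^ \<beta>) v - v) = N"
      using lin_ext[OF P(2)] by (auto simp: fun_eq_iff extensional_def U_def)
    have "?g (?f (S, N)) = (S, N)" using 2 3 by (simp add: A_def)
    note 1 this
  } note left = this
  {
    fix A assume "A \<in> ?R"
    then have A: "A \<in> End V" "\<And>v. v \<in> V \<Longrightarrow> (A ^^ (t * B)) v = v" by auto
    define S where "S = restrict (A ^^ \<alpha>) V"
    define U where "U = restrict (A ^^ \<beta>) V"
    define N where "N = (\<lambda>v\<in>V. U v - v)"
    have SU: "S \<in> End V" "U \<in> End V" unfolding S_def U_def by (rule funpow_End[OF V A(1)])+
    have N: "N \<in> End V" unfolding N_def by (rule minus_one_End[OF V SU(2)])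
    have pw: "(S ^^ k) v = (A ^^ (\<alpha> * k)) v" "(U ^^ k) v = (A ^^ (\<beta> * k)) v" if "v \<in> V" for k v
      using funpow_restrict[of V "A ^^ \<alpha>" v k] funpow_restrict[of V "A ^^ \<beta>" v k] funpow_mem[OF A(1)] that
      by (simp_all add: S_def U_def funpow_mult)
    \<comment> \<open>B divides \<alpha>, so \<alpha> t is a multiple of the period t B of A; in the
      same way t divides \<beta>.\<close>
    have St: "(S ^^ t) v = v" if "v \<in> V" for v
      unfolding pw[OF that] using mod[OF A(2)[OF that], of "\<alpha> * t" 0] B\<alpha> by (simp add: cong_0_iff mult.commute mult_dvd_mono)
    have UB: "(U ^^ B) v = v" if "v \<in> V" for v
      unfolding pw[OF that] using mod[OF A(2)[OF that], of "\<beta> * B" 0] t\<beta> by (simp add: cong_0_iff mult_dvd_mono)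
    have c: "U (S v) = S (U v)" if "v \<in> V" for v
      using that funpow_mem[OF A(1) that] by (simp add: S_def U_def) (simp add: add.commute flip: funpow_add comp_apply[of "A ^^ _" "A ^^ _"])
    have cN: "N (S v) = S (N v)" if v: "v \<in> V" for v
      using v c[OF v] lin_mem[OF SU(1) v] lin_mem[OF SU(2) v] kpair.lin_diff[OF self_pair V subD(1)[OF V] SU(1), of "U v" v]
      by (simp add: N_def)
    have "(S, N) \<in> pairs (xpow_1 t) B V"
      unfolding pairs_def using SU N St xt[OF SU(1)] cN unipotent_minus_one_power[OF V SU(2) B] UB
      by (auto simp: N_def)
    moreover have gA: "?g A = (S, N)" by (auto simp: S_def N_def U_def fun_eq_iff)
    ultimately have 1: "?g A \<in> pairs (xpow_1 t) B V" by simp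
    have "S (v + N v) = A v" if v: "v \<in> V" for v
    proof -
      have "S (v + N v) = (A ^^ (\<alpha> + \<beta>)) v"
        using v funpow_mem[OF A(1) v] by (simp add: N_def U_def S_def funpow_add)
      also have "\<dots> = (A ^^ 1) v" by (rule mod[OF A(2)[OF v] \<alpha>\<beta>])
      finally show ?thesis by simp
    qed
    then have "?f (S, N) = A" using lin_ext[OF A(1)] by (auto simp: fun_eq_iff extensional_def)
    then have "?f (?g A) = A" using gA by simp
    note 1 this
  } note right = this
  have "bij_betw ?f (pairs (xpow_1 t) B V) ?R"
    by (rule bij_betw_byWitness[where f' = ?g]) (use left right in auto)
  then show ?thesis by (simp add: bij_betw_same_card)
qed

theorem card_torsion:
  assumes V: "sub V" and n: "card V = CARD('a) ^ n" and t: "0 < t" "coprime t CARD('a)"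
    and q: "CARD('a) = CHAR('a) ^ k" and B: "B = CHAR('a) ^ r" and cop: "coprime t B"
  shows "real (card {A \<in> End V. \<forall>v\<in>V. (A ^^ (t * B)) v = v}) = gl CARD('a) n *
    fps_nth (\<Prod>d | d dvd t. factor_fps CARD('a) (ord d CARD('a)) B ^ (totient d div ord d CARD('a))) n"
proof -
  have "pairs_series (xpow_1 t) B (\<Prod>f\<in>monic_irreds (xpow_1 t :: 'a poly). factor_fps CARD('a) (degree f) B)"
    by (rule pairs_series_squarefree) (use xpow_1_nonzero[OF t(1)] xpow_1_squarefree[OF t(2,1)] in auto)
  then show ?thesis
    using card_torsion_eq_pairs[OF V t(1) B cop] V n
    unfolding pairs_series_def prod_monic_irreds_xpow_1[OF q t, of "\<lambda>e. factor_fps CARD('a) e B"] by simp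
qed

end

section \<open>Matrices\<close>

definition vscale :: "'a::{finite,field} \<Rightarrow> (nat \<Rightarrow> 'a) \<Rightarrow> nat \<Rightarrow> 'a" where
  "vscale c v = (\<lambda>i. c * v i)"

interpretation vscale: fspace "vscale :: 'a::{finite,field} \<Rightarrow> _" UNIV
  by (rule fspace_UNIV) (auto simp: vscale_def fun_eq_iff algebra_simps)

text \<open>Vectors of length n as functions on nat, so that one interpretation of
  \<open>fspace\<close> covers all n.\<close>

definition coords :: "nat \<Rightarrow> (nat \<Rightarrow> 'a::zero) set" where
  "coords n = {v. \<forall>i\<ge>n. v i = 0}"

definition mat_op :: "nat \<Rightarrow> 'a::{finite,field} mat \<Rightarrow> (nat \<Rightarrow> 'a) \<Rightarrow> nat \<Rightarrow> 'a" where
  "mat_op n A = (\<lambda>v\<in>coords n. \<lambda>i. if i < n then \<Sum>j<n. A $$ (i, j) * v j else 0)"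

lemma card_coords: "card (coords n :: (nat \<Rightarrow> 'a::{finite,zero}) set) = CARD('a) ^ n"
  using card_truncated_functions[of n "UNIV :: 'a set"] by (simp add: coords_def)

lemma sub_coords: "vscale.sub (coords n)"
proof -
  have "finite (coords n :: (nat \<Rightarrow> 'a::{finite,field}) set)"
    using finite_truncated_functions[of "UNIV :: 'a set" n] by (simp add: coords_def)
  then show ?thesis unfolding vscale.sub_def by (auto simp: coords_def vscale_def)
qed

lemma mat_op_End: "mat_op n A \<in> vscale.End (coords n)"
proof (rule linI)
  fix v :: "nat \<Rightarrow> 'a" assume v: "v \<in> coords n"
  show "mat_op n A v \<in> coords n" using v by (simp add: mat_op_def) (simp add: coords_def)
  show "mat_op n A (v + w) = mat_op n A v + mat_op n A w" if w: "w \<in> coords n" for w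
    using v w vscale.subD(4)[OF sub_coords v w]
    by (simp add: mat_op_def fun_eq_iff distrib_left sum.distrib)
  show "mat_op n A (vscale r v) = vscale r (mat_op n A v)" for r
    using v vscale.subD(5)[OF sub_coords v, of r]
    by (simp add: mat_op_def fun_eq_iff vscale_def sum_distrib_left mult_ac)
qed (simp add: mat_op_def)

definition unit_coord :: "nat \<Rightarrow> nat \<Rightarrow> 'a::zero_neq_one" where
  "unit_coord j = (\<lambda>i. if i = j then 1 else 0)"

lemma unit_coord_mem: "j < n \<Longrightarrow> unit_coord j \<in> coords n"
  by (auto simp: unit_coord_def coords_def)

lemma mat_op_unit_coord:
  fixes A :: "'a::{finite,field} mat"
  shows "i < n \<Longrightarrow> j < n \<Longrightarrow> mat_op n A (unit_coord j) i = A $$ (i, j)"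
  using unit_coord_mem[of j n, where 'a='a]
  by (simp add: mat_op_def unit_coord_def if_distrib[of "\<lambda>x. _ * x"] cong: if_cong)

lemma inj_mat_op: "inj_on (mat_op n) (carrier_mat n n :: 'a::{finite,field} mat set)"
proof (rule inj_onI)
  fix A B :: "'a mat" assume AB: "A \<in> carrier_mat n n" "B \<in> carrier_mat n n" "mat_op n A = mat_op n B"
  show "A = B"
    by (rule eq_matI) (use AB mat_op_unit_coord[of _ n _ A] mat_op_unit_coord[of _ n _ B] in auto)
qed

lemma fun_sum_apply: "(\<Sum>j\<in>J. g j) i = (\<Sum>j\<in>J. g j i :: 'a::comm_monoid_add)"
  by (induction J rule: infinite_finite_induct) (auto simp: zero_fun_def)

lemma mat_op_surj:
  assumes F: "F \<in> vscale.End (coords n :: (nat \<Rightarrow> 'a::{finite,field}) set)"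
  shows "F \<in> mat_op n ` carrier_mat n n"
proof -
  let ?V = "coords n :: (nat \<Rightarrow> 'a) set"
  define A where "A = mat n n (\<lambda>(i, j). F (unit_coord j) i)"
  \<comment> \<open>F is additive only on \<open>coords n\<close>, hence membership of the partial
    sums is carried along in the induction.\<close>
  have partial: "(\<Sum>j<k. vscale (v j) (unit_coord j)) \<in> ?V \<and>
     F (\<Sum>j<k. vscale (v j) (unit_coord j)) = (\<Sum>j<k. vscale (v j) (F (unit_coord j)))" if "k \<le> n" for v k
    using that
  proof (induction k)
    case 0
    show ?case unfolding lessThan_0 sum.empty
      using vscale.subD(3)[OF sub_coords] kpair.lin_zero[OF vscale.self_pair sub_coords F] by blast
  next
    case (Suc k)
    then have e: "unit_coord k \<in> ?V" by (intro unit_coord_mem) simp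
    then have s: "vscale (v k) (unit_coord k) \<in> ?V" by (rule vscale.subD(5)[OF sub_coords])
    have a: "(\<Sum>j<k. vscale (v j) (unit_coord j)) \<in> ?V"
      "F (\<Sum>j<k. vscale (v j) (unit_coord j)) = (\<Sum>j<k. vscale (v j) (F (unit_coord j)))"
      using Suc.IH Suc.prems by auto
    show ?case unfolding sum.lessThan_Suc lin_add[OF F a(1) s] lin_sc[OF F e] a(2)
      using vscale.subD(4)[OF sub_coords a(1) s] by blast
  qed
  have "F v = mat_op n A v" if v: "v \<in> ?V" for v
  proof -
    have "v = (\<Sum>j<n. vscale (v j) (unit_coord j))"
    proof
      fix i
      have "(\<Sum>j<n. vscale (v j) (unit_coord j)) i = (\<Sum>j<n. if i = j then v j else 0)"
        unfolding fun_sum_apply by (intro sum.cong refl) (simp add: vscale_def unit_coord_def)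
      then show "v i = (\<Sum>j<n. vscale (v j) (unit_coord j)) i" using v by (auto simp: coords_def)
    qed
    then have Fv: "F v = (\<Sum>j<n. vscale (v j) (F (unit_coord j)))" using partial[of n v] by simp
    show ?thesis
    proof
      fix i
      show "F v i = mat_op n A v i"
      proof (cases "i < n")
        case True
        then show ?thesis unfolding Fv fun_sum_apply using v
          by (simp add: mat_op_def A_def vscale_def mult.commute)
      next
        case False
        then show ?thesis using lin_mem[OF F v] v by (auto simp: mat_op_def coords_def)
      qed
    qed
  qed
  then have "F = mat_op n A" by (rule lin_eqI[OF F mat_op_End])
  moreover have "A \<in> carrier_mat n n" by (simp add: A_def)
  ultimately show ?thesis by blast
qed

lemma mat_op_mult:
  fixes A B :: "'a::{finite,field} mat"
  assumes A: "A \<in> carrier_mat n n" and B: "B \<in> carrier_mat n n" and v: "v \<in> coords n"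
  shows "mat_op n (A * B) v = mat_op n A (mat_op n B v)"
proof
  fix i
  have m: "mat_op n B v \<in> coords n" by (rule lin_mem[OF mat_op_End v])
  show "mat_op n (A * B) v i = mat_op n A (mat_op n B v) i"
  proof (cases "i < n")
    case True
    have AB: "(A * B) $$ (i, j) = (\<Sum>k<n. A $$ (i, k) * B $$ (k, j))" if "j < n" for j
      using True that A B by (simp add: scalar_prod_def atLeast0LessThan)
    have "mat_op n (A * B) v i = (\<Sum>j<n. (\<Sum>k<n. A $$ (i, k) * B $$ (k, j)) * v j)"
      using True v AB by (simp add: mat_op_def)
    also have "\<dots> = (\<Sum>j<n. \<Sum>k<n. A $$ (i, k) * (B $$ (k, j) * v j))"
      by (simp add: sum_distrib_right mult.assoc)
    also have "\<dots> = (\<Sum>k<n. \<Sum>j<n. A $$ (i, k) * (B $$ (k, j) * v j))" by (rule sum.swap)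
    also have "\<dots> = (\<Sum>k<n. A $$ (i, k) * mat_op n B v k)"
      using v by (simp add: mat_op_def sum_distrib_left)
    also have "\<dots> = mat_op n A (mat_op n B v) i" using True m by (simp add: mat_op_def[of n A])
    finally show ?thesis .
  next
    case False
    then show ?thesis using v m by (simp add: mat_op_def[of n A] mat_op_def[of n "A * B"])
  qed
qed

lemma mat_op_one: "v \<in> coords n \<Longrightarrow> mat_op n (1\<^sub>m n) v = v"
  by (auto simp: mat_op_def coords_def fun_eq_iff if_distrib[of "\<lambda>x. x * _"] cong: if_cong)

lemma mat_op_pow:
  assumes "A \<in> carrier_mat n n" "v \<in> coords n"
  shows "mat_op n (A ^\<^sub>m k) v = (mat_op n A ^^ k) v"
  using assms(2)
proof (induction k arbitrary: v)
  case 0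
  then show ?case using assms(1) mat_op_one by auto
next
  case (Suc k)
  have "mat_op n (A ^\<^sub>m Suc k) v = mat_op n (A ^\<^sub>m k) (mat_op n A v)"
    using mat_op_mult[OF pow_carrier_mat[OF assms(1), of k] assms(1) Suc(2)] by simp
  also have "\<dots> = (mat_op n A ^^ k) (mat_op n A v)" by (rule Suc.IH[OF lin_mem[OF mat_op_End Suc(2)]])
  finally show ?case by (simp add: funpow_swap1)
qed

text \<open>From right to left, an injective map of a finite set to itself is onto, its inverse is
  again linear, and \<open>mat_op_surj\<close> provides a matrix for the inverse.\<close>

lemma invertible_iff_inj:
  fixes A :: "'a::{finite,field} mat"
  assumes A: "A \<in> carrier_mat n n"
  shows "invertible_mat A \<longleftrightarrow> inj_on (mat_op n A) (coords n)"
proof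
  assume "invertible_mat A"
  then obtain B where B: "inverts_mat A B" "inverts_mat B A" by (auto simp: invertible_mat_def)
  have BA: "B * A = 1\<^sub>m (dim_row B)" "A * B = 1\<^sub>m n" using B A by (auto simp: inverts_mat_def)
  \<comment> \<open>\<open>invertible_mat\<close> does not state the size of the inverse; it is read
    off from the dimensions of the two products.\<close>
  have "dim_col B = n" using arg_cong[OF BA(2), of dim_col] by simp
  moreover have "dim_row B = n" using arg_cong[OF BA(1), of dim_col] A by simp
  ultimately have Bc: "B \<in> carrier_mat n n" by auto
  show "inj_on (mat_op n A) (coords n)"
  proof (rule inj_on_inverseI)
    fix v :: "nat \<Rightarrow> 'a" assume v: "v \<in> coords n"
    show "mat_op n B (mat_op n A v) = v"
      using mat_op_mult[OF Bc A v] BA(1) Bc mat_op_one[OF v] by simp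
  qed
next
  assume inj: "inj_on (mat_op n A) (coords n)"
  let ?V = "coords n :: (nat \<Rightarrow> 'a) set"
  have img: "mat_op n A ` ?V = ?V"
    by (rule endo_inj_surj[OF vscale.subD(2)[OF sub_coords] _ inj]) (use lin_mem[OF mat_op_End] in blast)
  define G where "G = (\<lambda>w\<in>?V. inv_into ?V (mat_op n A) w)"
  have GA: "G (mat_op n A v) = v" if "v \<in> ?V" for v
    using that inj lin_mem[OF mat_op_End that] by (simp add: G_def inv_into_f_f)
  have ex: "\<exists>v\<in>?V. w = mat_op n A v" if "w \<in> ?V" for w using that img by blast
  have "G \<in> vscale.End ?V"
  proof (rule linI)
    show "G \<in> extensional ?V" by (simp add: G_def)
  next
    fix w assume "w \<in> ?V"
    then obtain v where v: "v \<in> ?V" "w = mat_op n A v" using ex by blast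
    show "G w \<in> ?V" using v GA by simp
    show "G (vscale r w) = vscale r (G w)" for r
      using v GA[OF v(1)] GA[OF vscale.subD(5)[OF sub_coords v(1)], of r] lin_sc[OF mat_op_End v(1)] by simp
    fix w' assume "w' \<in> ?V"
    then obtain v' where v': "v' \<in> ?V" "w' = mat_op n A v'" using ex by blast
    show "G (w + w') = G w + G w'"
      using v v' GA[OF v(1)] GA[OF v'(1)] GA[OF vscale.subD(4)[OF sub_coords v(1) v'(1)]]
        lin_add[OF mat_op_End v(1) v'(1)] by simp
  qed
  then obtain B where B: "B \<in> carrier_mat n n" "G = mat_op n B" using mat_op_surj by blast
  have one: "C = 1\<^sub>m n" if "C \<in> carrier_mat n n" "\<And>v. v \<in> ?V \<Longrightarrow> mat_op n C v = v" for C
  proof (rule inj_onD[OF inj_mat_op])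
    show "mat_op n C = mat_op n (1\<^sub>m n)"
      by (rule lin_eqI[OF mat_op_End mat_op_End]) (simp add: that mat_op_one)
  qed (use that in auto)
  have 1: "B * A = 1\<^sub>m n"
    by (rule one) (use A B GA mat_op_mult[OF B(1) A] in auto)
  have 2: "A * B = 1\<^sub>m n"
  proof (rule one)
    fix w assume w: "w \<in> ?V"
    then obtain v where v: "v \<in> ?V" "w = mat_op n A v" using ex by blast
    show "mat_op n (A * B) w = w"
      using mat_op_mult[OF A B(1) w] GA[OF v(1)] v B(2) by simp
  qed (use A B in auto)
  show "invertible_mat A"
    unfolding invertible_mat_def inverts_mat_def using A B 1 2 by auto
qed

lemma card_invertible:
  "real (card {A \<in> carrier_mat n n. invertible_mat (A :: 'a::{finite,field} mat)}) = gl CARD('a) n"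
proof -
  let ?S = "{A \<in> carrier_mat n n. invertible_mat (A :: 'a mat)}"
  have "mat_op n ` ?S = {F \<in> vscale.End (coords n). inj_on F (coords n)}"
  proof (intro equalityI subsetI)
    fix F assume "F \<in> mat_op n ` ?S"
    then obtain A :: "'a mat" where "A \<in> carrier_mat n n" "invertible_mat A" "F = mat_op n A" by blast
    then show "F \<in> {F \<in> vscale.End (coords n). inj_on F (coords n)}"
      using invertible_iff_inj[of A n] mat_op_End[of n A] by simp
  next
    fix F :: "(nat \<Rightarrow> 'a) \<Rightarrow> nat \<Rightarrow> 'a"
    assume F: "F \<in> {F \<in> vscale.End (coords n). inj_on F (coords n)}"
    then obtain A where A: "A \<in> carrier_mat n n" "F = mat_op n A" using mat_op_surj[of F n] by blast
    then have "A \<in> ?S" using F invertible_iff_inj[OF A(1)] by simp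
    then show "F \<in> mat_op n ` ?S" using A(2) by blast
  qed
  moreover have "card (mat_op n ` ?S) = card ?S"
    by (rule card_image) (rule inj_on_subset[OF inj_mat_op], auto)
  moreover have "real (card {F \<in> vscale.End (coords n :: (nat \<Rightarrow> 'a) set). inj_on F (coords n)}) = gl CARD('a) n"
    by (rule kpair.card_iso[OF vscale.self_pair sub_coords sub_coords card_coords card_coords])
  ultimately show ?thesis by simp
qed

lemma card_torsion_matrices:
  assumes M: "0 < M"
  shows "card {A \<in> carrier_mat n n. invertible_mat (A :: 'a::{finite,field} mat) \<and> A ^\<^sub>m M = 1\<^sub>m n} =
    card {F \<in> vscale.End (coords n :: (nat \<Rightarrow> 'a) set). \<forall>v\<in>coords n. (F ^^ M) v = v}"
proof -
  let ?V = "coords n :: (nat \<Rightarrow> 'a) set"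
  let ?S = "{A \<in> carrier_mat n n. invertible_mat (A :: 'a mat) \<and> A ^\<^sub>m M = 1\<^sub>m n}"
  let ?R = "{F \<in> vscale.End ?V. \<forall>v\<in>?V. (F ^^ M) v = v}"
  have "mat_op n ` ?S = ?R"
  proof (intro equalityI subsetI)
    fix F assume "F \<in> mat_op n ` ?S"
    then obtain A :: "'a mat" where A: "A \<in> carrier_mat n n" "A ^\<^sub>m M = 1\<^sub>m n" "F = mat_op n A" by blast
    have "(F ^^ M) v = v" if "v \<in> ?V" for v
      using mat_op_pow[OF A(1) that, of M] A(2,3) mat_op_one[OF that] by simp
    then show "F \<in> ?R" using A(3) mat_op_End by blast
  next
    fix F assume F: "F \<in> ?R"
    then obtain A where A: "A \<in> carrier_mat n n" "F = mat_op n A" using mat_op_surj by blast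
    have id: "mat_op n (A ^\<^sub>m M) v = v" if "v \<in> ?V" for v
      using mat_op_pow[OF A(1) that, of M] A(2) F that by simp
    have "A ^\<^sub>m M = 1\<^sub>m n"
    proof (rule inj_onD[OF inj_mat_op])
      show "mat_op n (A ^\<^sub>m M) = mat_op n (1\<^sub>m n)"
        by (rule lin_eqI[OF mat_op_End mat_op_End]) (simp add: id mat_op_one)
    qed (use A(1) in auto)
    \<comment> \<open>Since M > 0, the iterate of F with exponent M - 1 is a left inverse of F;
      invertibility thus follows from the torsion condition.\<close>
    moreover have "inj_on F ?V"
    proof (rule inj_on_inverseI)
      fix v assume v: "v \<in> ?V"
      obtain m where "M = Suc m" using M by (cases M) auto
      then show "(F ^^ (M - 1)) (F v) = v" using F v by (simp add: funpow_swap1)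
    qed
    ultimately have "A \<in> ?S" using A invertible_iff_inj[OF A(1)] by simp
    then show "F \<in> mat_op n ` ?S" using A(2) by blast
  qed
  moreover have "card (mat_op n ` ?S) = card ?S"
    by (rule card_image) (rule inj_on_subset[OF inj_mat_op], auto)
  ultimately show ?thesis by simp
qed

lemma factor_fps_0: "0 < e \<Longrightarrow> fps_nth (factor_fps q e B) 0 = 1"
  by (simp add: factor_fps_nth nilw_0_0)

lemma fps_nth_0_prod_power:
  assumes "finite A" "\<And>d. d \<in> A \<Longrightarrow> fps_nth (f d) 0 = (1 :: real)"
  shows "fps_nth (\<Prod>d\<in>A. f d ^ g d) 0 = 1"
  using assms by (induction A rule: finite_induct) (auto simp: fps_power_zeroth)

theorem mainTheorem8:
  fixes p q k t r M :: nat
  assumes "prime p" and "odd p" and "k \<ge> 1"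
    and "q = p ^ k" and "card (UNIV :: 'a::{finite,field} set) = q"
    and "M \<ge> 2" and "M = t * p ^ r" and "\<not> p dvd t"
  shows "Abs_fps (\<lambda>n. if n = 0 then 1 else
            real (card {A \<in> carrier_mat n n. invertible_mat (A :: 'a mat) \<and> A ^\<^sub>m M = 1\<^sub>m n})
            / real (card {A \<in> carrier_mat n n. invertible_mat (A :: 'a mat)}))
       = (\<Prod>d \<in> {d. d dvd t}.
            factor_fps q (ord d q) (p ^ r) ^ (totient d div ord d q))"
proof (rule fps_ext)
  fix n
  let ?G = "\<Prod>d | d dvd t. factor_fps q (ord d q) (p ^ r) ^ (totient d div ord d q)"
  have q: "CARD('a) = q" by (rule assms(5))
  have "CHAR('a) dvd p ^ k" using CHAR_dvd_CARD[where 'a='a] q assms(4) by simp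
  then have p: "CHAR('a) = p"
    using prime_dvd_power_nat[OF vscale.prime_CHAR_field] primes_dvd_imp_eq[OF vscale.prime_CHAR_field assms(1)] by blast
  have t: "0 < t" using assms(6,7) by (cases t) auto
  have ctp: "coprime t p" using assms(1,8) by (metis coprime_commute prime_imp_coprime)
  have ct: "coprime t CARD('a)" "coprime t (p ^ r)" using ctp q assms(4) by auto
  have main: "real (card {A \<in> carrier_mat n n. invertible_mat (A :: 'a mat) \<and> A ^\<^sub>m M = 1\<^sub>m n}) = gl q n * fps_nth ?G n"
  proof -
    have "real (card {A \<in> vscale.End (coords n :: (nat \<Rightarrow> 'a) set). \<forall>v\<in>coords n. (A ^^ (t * p ^ r)) v = v}) =
      gl CARD('a) n * fps_nth (\<Prod>d | d dvd t. factor_fps CARD('a) (ord d CARD('a)) (p ^ r) ^ (totient d div ord d CARD('a))) n"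
      by (rule vscale.card_torsion[OF sub_coords card_coords t ct(1) _ _ ct(2), of k r]) (use q p assms(4) in auto)
    moreover have "card {A \<in> carrier_mat n n. invertible_mat (A :: 'a mat) \<and> A ^\<^sub>m M = 1\<^sub>m n} =
        card {F \<in> vscale.End (coords n :: (nat \<Rightarrow> 'a) set). \<forall>v\<in>coords n. (F ^^ M) v = v}"
      by (rule card_torsion_matrices) (use assms(6) in simp)
    ultimately show ?thesis by (simp only: assms(7) q)
  qed
  have gl0: "gl q n \<noteq> 0" using gl_pos[of q n] CARD_field_gt_1[where 'a='a] q by simp
  show "fps_nth (Abs_fps (\<lambda>n. if n = 0 then 1 else
            real (card {A \<in> carrier_mat n n. invertible_mat (A :: 'a mat) \<and> A ^\<^sub>m M = 1\<^sub>m n})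
            / real (card {A \<in> carrier_mat n n. invertible_mat (A :: 'a mat)}))) n = fps_nth ?G n"
  proof (cases "n = 0")
    case True
    \<comment> \<open>The left side has constant term 1 by definition. On the right each factor has
      constant term 1 because \<open>ord d q\<close> is positive, d being coprime to q.\<close>
    have "fps_nth ?G 0 = 1"
    proof (rule fps_nth_0_prod_power)
      show "finite {d. d dvd t}" using t by simp
      fix d assume "d \<in> {d. d dvd t}"
      then have "coprime d q" using coprime_divisors[OF _ dvd_refl ct(1), of d] q by simp
      then show "fps_nth (factor_fps q (ord d q) (p ^ r)) 0 = 1"
        by (intro factor_fps_0) (simp add: ord_eq_0 coprime_commute)
    qed
    then show ?thesis using True by simp
  next
    case False
    then show ?thesis using main card_invertible[of n, where 'a='a] gl0 q by simp
  qed
qed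

end
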